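(* Let $\mathbb{D}$ be a prederivator which satisfies the axioms (Der1)-(Der3). Then the following three statements are equivalent: (i) The prederivator $\mathbb{D}$ is a derivator, i.e., it also satisfies (Der4). (ii) The prederivator $\mathbb{D}$ satisfies base change for Grothendieck (op)fibrations. (iii) The prederivator $\mathbb{D}$ satisfies base change for comma categories, i.e., the squares associated to comma categories are $\mathbb{D}$-exact.
   Context: $\mathsf{Cat}$ is the 2-category of small categories, $\mathsf{CAT}$ that of not necessarily small categories, $e$ the terminal category. A prederivator is a strict 2-functor $\mathbb{D}\colon\mathsf{Cat}^{op}\to\mathsf{CAT}$ (contravariant on functors, covariant on natural transformations). Write $u^\ast=\mathbb{D}(u)\colon\mathbb{D}(K)\to\mathbb{D}(J)$ for $u\colon J\to K$, and $\alpha^\ast=\mathbb{D}(\alpha)$. For $k\in K$, viewed as $k\colon e\to K$, write $X_k=k^\ast X\in\mathbb{D}(e)$, $f_k=k^\ast f$. Axioms: (Der1) for all $J_1,J_2$ the functor $\mathbb{D}(J_1\sqcup J_2)\to\mathbb{D}(J_1)\times\mathbb{D}(J_2)$ induced by the inclusions is an equivalence, and $\mathbb{D}(\emptyset)$ is not the empty category; (Der2) a morphism $f$ in $\mathbb{D}(J)$ is an isomorphism iff $f_j$ is an isomorphism in $\mathbb{D}(e)$ for all $j\in J$; (Der3) every $u^\ast$ has a left adjoint $u_!$ and a right adjoint $u_\ast$ (homotopy left/right Kan extension); (Der4) for $u\colon J\to K$ and $k\in K$ let $J_{/k}$ be the category of pairs $(j,f\colon u(j)\to k)$ and $J_{k/}$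 that of pairs $(j,f\colon k\to u(j))$, with projections $\mathrm{pr}$ to $J$ and $p$ to $e$, and let $\alpha\colon u\circ\mathrm{pr}\to k\circ p$, resp. $\alpha\colon k\circ p\to u\circ\mathrm{pr}$, be the transformation with components $f$. Then the maps $p_!\mathrm{pr}^\ast\xrightarrow{\eta}p_!\mathrm{pr}^\ast u^\ast u_!\xrightarrow{\alpha^\ast}p_!p^\ast k^\ast u_!\xrightarrow{\epsilon}k^\ast u_!$ and $k^\ast u_\ast\xrightarrow{\eta}p_\ast p^\ast k^\ast u_\ast\xrightarrow{\alpha^\ast}p_\ast\mathrm{pr}^\ast u^\ast u_\ast\xrightarrow{\epsilon}p_\ast\mathrm{pr}^\ast$ are isomorphisms. **$\mathbb{D}$-exact squares.** Let $v\colon J_1\to J_2$, $u_1\colon J_1\to K_1$, $u_2\colon J_2\to K_2$, $w\colon K_1\to K_2$ be functors between small categories. If $\alpha\colon u_2v\to wu_1$ is a natural transformation, the square is $\mathbb{D}$-exact if the Beck–Chevalley transformation $\alpha_!\colon(u_1)_!v^\ast\xrightarrow{\eta}(u_1)_!v^\ast u_2^\ast(u_2)_!\xrightarrow{\alpha^\ast}(u_1)_!u_1^\ast w^\ast(u_2)_!\xrightarrow{\epsilon}w^\ast(u_2)_!$ is an isomorphism (equivalently, its conjugate $u_2^\ast w_\ast\to v_\ast u_1^\ast$ is an isomorphism). If instead $\alpha\colon wu_1\to u_2v$, the square is $\mathbb{D}$-exact if $\alpha_\ast\colon w^\ast(u_2)_\ast\xrightarrow{\eta}(u_1)_\ast u_1^\ast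 w^\ast(u_2)_\ast\xrightarrow{\alpha^\ast}(u_1)_\ast v^\ast u_2^\ast(u_2)_\ast\xrightarrow{\epsilon}(u_1)_\ast v^\ast$ is an isomorphism (equivalently, its conjugate $v_!u_1^\ast\to u_2^\ast w_!$ is an isomorphism). **Base change for Grothendieck (op)fibrations.** This means: for every pullback square in $\mathsf{Cat}$ formed by functors $v\colon J_1\to J_2$, $u_1\colon J_1\to K_1$, $u_2\colon J_2\to K_2$, $w\colon K_1\to K_2$ between small categories (so $wu_1=u_2v$ and $J_1$ is the pullback of $u_2$ and $w$), the square, equipped with the identity transformation regarded as directed $wu_1\to u_2v$, is $\mathbb{D}$-exact whenever $u_2$ is a Grothendieck fibration or $w$ is a Grothendieck opfibration. **Comma squares.** For functors $u_1\colon J_1\to K$ and $u_2\colon J_2\to K$ between small categories, the comma category $(u_1/u_2)$ has as objects triples $(j_1,j_2,\alpha\colon u_1(j_1)\to u_2(j_2))$. The associated square has the projections $\mathrm{pr}_1\colon(u_1/u_2)\to J_1$ and $\mathrm{pr}_2\colon(u_1/u_2)\to J_2$, the functors $u_1,u_2$, and the natural transformation $u_1\mathrm{pr}_1\to u_2\mathrm{pr}_2$ whose component at $(j_1,j_2,\alpha)$ is $\alpha$; $\mathbb{D}$-exactness means that the induced transformation $(\mathrm{pr}_2)_!\mathrm{pr}_1^\ast\to u_2^\ast(u_1)_!$ is an isomorphism. *)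

theory Defs
  imports "HOL-Library.FuncSet"
begin

section \<open>Categories, functors, natural transformations\<close>

text \<open>All structure maps are \<open>undefined\<close> outside their domains of definition. Hence HOL equality
  of categories, functors and natural transformations is the strict equality that the definition
  of a strict 2-functor refers to.\<close>

record ('o, 'a) cat =
  Ob :: "'o set"
  Ar :: "'a set"
  Dom :: "'a \<Rightarrow> 'o"
  Cod :: "'a \<Rightarrow> 'o"
  Id :: "'o \<Rightarrow> 'a"
  Comp :: "'a \<Rightarrow> 'a \<Rightarrow> 'a"  \<comment> \<open>\<open>Comp C g f\<close> is \<open>g\<close> after \<open>f\<close>\<close>

definition hom :: "('o, 'a) cat \<Rightarrow> 'o \<Rightarrow> 'o \<Rightarrow> 'a set" where
  "hom C x y = {f \<in> Ar C. Dom C f = x \<and> Cod C f = y}"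

definition category :: "('o, 'a) cat \<Rightarrow> bool" where
  "category C \<longleftrightarrow>
     (\<forall>f\<in>Ar C. Dom C f \<in> Ob C \<and> Cod C f \<in> Ob C) \<and>
     (\<forall>x\<in>Ob C. Id C x \<in> hom C x x) \<and>
     (\<forall>f\<in>Ar C. \<forall>g\<in>Ar C. Cod C f = Dom C g \<longrightarrow> Comp C g f \<in> hom C (Dom C f) (Cod C g)) \<and>
     (\<forall>f\<in>Ar C. Comp C f (Id C (Dom C f)) = f \<and> Comp C (Id C (Cod C f)) f = f) \<and>
     (\<forall>f\<in>Ar C. \<forall>g\<in>Ar C. \<forall>h\<in>Ar C. Cod C f = Dom C g \<and> Cod C g = Dom C h \<longrightarrow>
        Comp C h (Comp C g f) = Comp C (Comp C h g) f) \<and>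
     Dom C \<in> extensional (Ar C) \<and> Cod C \<in> extensional (Ar C) \<and> Id C \<in> extensional (Ob C) \<and>
     (\<forall>f g. \<not> (f \<in> Ar C \<and> g \<in> Ar C \<and> Cod C f = Dom C g) \<longrightarrow> Comp C g f = undefined)"

definition is_iso :: "('o, 'a) cat \<Rightarrow> 'a \<Rightarrow> bool" where
  "is_iso C f \<longleftrightarrow> f \<in> Ar C \<and>
     (\<exists>g \<in> hom C (Cod C f) (Dom C f).
        Comp C g f = Id C (Dom C f) \<and> Comp C f g = Id C (Cod C f))"

record ('o1, 'a1, 'o2, 'a2) fctr =
  Src :: "('o1, 'a1) cat"
  Tgt :: "('o2, 'a2) cat"
  FO :: "'o1 \<Rightarrow> 'o2"
  FA :: "'a1 \<Rightarrow> 'a2"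

definition is_functor :: "('o1, 'a1, 'o2, 'a2) fctr \<Rightarrow> bool" where
  "is_functor F \<longleftrightarrow> category (Src F) \<and> category (Tgt F) \<and>
     (\<forall>x\<in>Ob (Src F). FO F x \<in> Ob (Tgt F)) \<and>
     (\<forall>f\<in>Ar (Src F). FA F f \<in> hom (Tgt F) (FO F (Dom (Src F) f)) (FO F (Cod (Src F) f))) \<and>
     (\<forall>x\<in>Ob (Src F). FA F (Id (Src F) x) = Id (Tgt F) (FO F x)) \<and>
     (\<forall>f\<in>Ar (Src F). \<forall>g\<in>Ar (Src F). Cod (Src F) f = Dom (Src F) g \<longrightarrow>
        FA F (Comp (Src F) g f) = Comp (Tgt F) (FA F g) (FA F f)) \<and>
     FO F \<in> extensional (Ob (Src F)) \<and> FA F \<in> extensional (Ar (Src F))"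

definition functor_from_to ::
  "('o1, 'a1, 'o2, 'a2) fctr \<Rightarrow> ('o1, 'a1) cat \<Rightarrow> ('o2, 'a2) cat \<Rightarrow> bool" where
  "functor_from_to F A B \<longleftrightarrow> is_functor F \<and> Src F = A \<and> Tgt F = B"

definition id_fctr :: "('o, 'a) cat \<Rightarrow> ('o, 'a, 'o, 'a) fctr" where
  "id_fctr C = \<lparr>Src = C, Tgt = C, FO = (\<lambda>x\<in>Ob C. x), FA = (\<lambda>f\<in>Ar C. f)\<rparr>"

definition comp_fctr ::
  "('o2, 'a2, 'o3, 'a3) fctr \<Rightarrow> ('o1, 'a1, 'o2, 'a2) fctr \<Rightarrow> ('o1, 'a1, 'o3, 'a3) fctr"
  (infixr "\<odot>" 75) where
  "G \<odot> F = \<lparr>Src = Src F, Tgt = Tgt G,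
     FO = (\<lambda>x\<in>Ob (Src F). FO G (FO F x)), FA = (\<lambda>f\<in>Ar (Src F). FA G (FA F f))\<rparr>"

record ('o1, 'a1, 'o2, 'a2) nt =
  NS :: "('o1, 'a1, 'o2, 'a2) fctr"
  NT :: "('o1, 'a1, 'o2, 'a2) fctr"
  Cmp :: "'o1 \<Rightarrow> 'a2"

definition nat_from_to ::
  "('o1, 'a1, 'o2, 'a2) nt \<Rightarrow> ('o1, 'a1, 'o2, 'a2) fctr \<Rightarrow> ('o1, 'a1, 'o2, 'a2) fctr \<Rightarrow> bool" where
  "nat_from_to \<alpha> F G \<longleftrightarrow>
     is_functor F \<and> is_functor G \<and> Src F = Src G \<and> Tgt F = Tgt G \<and> NS \<alpha> = F \<and> NT \<alpha> = G \<and>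
     (\<forall>x\<in>Ob (Src F). Cmp \<alpha> x \<in> hom (Tgt F) (FO F x) (FO G x)) \<and>
     (\<forall>f\<in>Ar (Src F). Comp (Tgt F) (Cmp \<alpha> (Cod (Src F) f)) (FA F f)
                      = Comp (Tgt F) (FA G f) (Cmp \<alpha> (Dom (Src F) f))) \<and>
     Cmp \<alpha> \<in> extensional (Ob (Src F))"

definition id_nt :: "('o1, 'a1, 'o2, 'a2) fctr \<Rightarrow> ('o1, 'a1, 'o2, 'a2) nt" where
  "id_nt F = \<lparr>NS = F, NT = F, Cmp = (\<lambda>x\<in>Ob (Src F). Id (Tgt F) (FO F x))\<rparr>"

text \<open>Vertical composition: for \<open>\<alpha> : F \<rightarrow> G\<close> and \<open>\<beta> : G \<rightarrow> H\<close>, the transformation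
  \<open>\<beta> \<bullet> \<alpha> : F \<rightarrow> H\<close>.\<close>

definition vcomp ::
  "('o1, 'a1, 'o2, 'a2) nt \<Rightarrow> ('o1, 'a1, 'o2, 'a2) nt \<Rightarrow> ('o1, 'a1, 'o2, 'a2) nt"
  (infixr "\<bullet>" 65) where
  "\<beta> \<bullet> \<alpha> = \<lparr>NS = NS \<alpha>, NT = NT \<beta>,
     Cmp = (\<lambda>x\<in>Ob (Src (NS \<alpha>)). Comp (Tgt (NS \<alpha>)) (Cmp \<beta> x) (Cmp \<alpha> x))\<rparr>"

text \<open>Horizontal composition: for \<open>\<alpha> : F \<rightarrow> F'\<close> and \<open>\<beta> : G \<rightarrow> G'\<close>, the transformation
  \<open>\<beta> \<star> \<alpha> : G \<odot> F \<rightarrow> G' \<odot> F'\<close>.\<close>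

definition hcomp ::
  "('o2, 'a2, 'o3, 'a3) nt \<Rightarrow> ('o1, 'a1, 'o2, 'a2) nt \<Rightarrow> ('o1, 'a1, 'o3, 'a3) nt"
  (infixr "\<star>" 70) where
  "\<beta> \<star> \<alpha> = \<lparr>NS = NS \<beta> \<odot> NS \<alpha>, NT = NT \<beta> \<odot> NT \<alpha>,
     Cmp = (\<lambda>x\<in>Ob (Src (NS \<alpha>)).
       Comp (Tgt (NS \<beta>)) (Cmp \<beta> (FO (NT \<alpha>) x)) (FA (NS \<beta>) (Cmp \<alpha> x)))\<rparr>"

definition nat_iso :: "('o1, 'a1, 'o2, 'a2) nt \<Rightarrow> bool" where
  "nat_iso \<alpha> \<longleftrightarrow> nat_from_to \<alpha> (NS \<alpha>) (NT \<alpha>) \<and>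
     (\<exists>\<beta>. nat_from_to \<beta> (NT \<alpha>) (NS \<alpha>) \<and> \<beta> \<bullet> \<alpha> = id_nt (NS \<alpha>) \<and> \<alpha> \<bullet> \<beta> = id_nt (NT \<alpha>))"

definition is_equivalence :: "('o1, 'a1, 'o2, 'a2) fctr \<Rightarrow> bool" where
  "is_equivalence F \<longleftrightarrow> is_functor F \<and>
     (\<exists>G \<eta> \<epsilon>. functor_from_to G (Tgt F) (Src F) \<and>
        nat_from_to \<eta> (id_fctr (Src F)) (G \<odot> F) \<and> nat_iso \<eta> \<and>
        nat_from_to \<epsilon> (F \<odot> G) (id_fctr (Tgt F)) \<and> nat_iso \<epsilon>)"

text \<open>\<open>L\<close> is left adjoint to \<open>R\<close>, with unit \<open>\<eta>\<close> and counit \<open>\<epsilon>\<close>.\<close>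

definition adjunction ::
  "('o1, 'a1, 'o2, 'a2) fctr \<Rightarrow> ('o2, 'a2, 'o1, 'a1) fctr \<Rightarrow>
   ('o1, 'a1, 'o1, 'a1) nt \<Rightarrow> ('o2, 'a2, 'o2, 'a2) nt \<Rightarrow> bool" where
  "adjunction L R \<eta> \<epsilon> \<longleftrightarrow>
     functor_from_to L (Src L) (Tgt L) \<and> functor_from_to R (Tgt L) (Src L) \<and>
     nat_from_to \<eta> (id_fctr (Src L)) (R \<odot> L) \<and> nat_from_to \<epsilon> (L \<odot> R) (id_fctr (Tgt L)) \<and>
     (\<epsilon> \<star> id_nt L) \<bullet> (id_nt L \<star> \<eta>) = id_nt L \<and>
     (id_nt R \<star> \<epsilon>) \<bullet> (\<eta> \<star> id_nt R) = id_nt R"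

definition prod_cat :: "('o1, 'a1) cat \<Rightarrow> ('o2, 'a2) cat \<Rightarrow> ('o1 \<times> 'o2, 'a1 \<times> 'a2) cat" where
  "prod_cat A B = \<lparr>Ob = Ob A \<times> Ob B, Ar = Ar A \<times> Ar B,
     Dom = (\<lambda>f\<in>Ar A \<times> Ar B. (Dom A (fst f), Dom B (snd f))),
     Cod = (\<lambda>f\<in>Ar A \<times> Ar B. (Cod A (fst f), Cod B (snd f))),
     Id = (\<lambda>x\<in>Ob A \<times> Ob B. (Id A (fst x), Id B (snd x))),
     Comp = (\<lambda>g f. if f \<in> Ar A \<times> Ar B \<and> g \<in> Ar A \<times> Ar B \<and>
                      Cod A (fst f) = Dom A (fst g) \<and> Cod B (snd f) = Dom B (snd g)
                   then (Comp A (fst g) (fst f), Comp B (snd g) (snd f)) else undefined)\<rparr>"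

definition pairing ::
  "('o, 'a, 'o1, 'a1) fctr \<Rightarrow> ('o, 'a, 'o2, 'a2) fctr \<Rightarrow> ('o, 'a, 'o1 \<times> 'o2, 'a1 \<times> 'a2) fctr" where
  "pairing F G = \<lparr>Src = Src F, Tgt = prod_cat (Tgt F) (Tgt G),
     FO = (\<lambda>x\<in>Ob (Src F). (FO F x, FO G x)), FA = (\<lambda>f\<in>Ar (Src F). (FA F f, FA G f))\<rparr>"


section \<open>Small categories\<close>

text \<open>A type of this class plays the role of the universe in which small categories live:
  a category is small if its objects and its morphisms form \<open>small\<close> sets of elements of the
  type. The operations \<open>pair\<close>, \<open>pfst\<close>, \<open>psnd\<close> encode ordered pairs, and \<open>tag0\<close>, \<open>tag1\<close> are two
  labels for disjoint unions. The closure conditions on \<open>small\<close> hold for the elements of any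
  Grothendieck universe. Closure under power sets and the existence of an infinite small set are
  not needed for the constructions below and are not required, so that the case of all small
  categories is one instance; another one is given by the finite
  subsets of \<open>nat\<close>.\<close>

class small_universe =
  fixes small :: "'a set \<Rightarrow> bool"
    and pair :: "'a \<Rightarrow> 'a \<Rightarrow> 'a"
    and pfst :: "'a \<Rightarrow> 'a"
    and psnd :: "'a \<Rightarrow> 'a"
    and tag0 :: 'a
    and tag1 :: 'a
  assumes small_finite: "finite A \<Longrightarrow> small A"
    and small_subset: "small A \<Longrightarrow> B \<subseteq> A \<Longrightarrow> small B"
    and small_image: "small A \<Longrightarrow> small (f ` A)"
    and small_Union: "small I \<Longrightarrow> (\<And>i. i \<in> I \<Longrightarrow> small (F i)) \<Longrightarrow> small (\<Union>i\<in>I. F i)"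
    and pfst_pair [simp]: "pfst (pair x y) = x"
    and psnd_pair [simp]: "psnd (pair x y) = y"
    and tag0_neq_tag1: "tag0 \<noteq> tag1"

type_synonym 's scat = "('s, 's) cat"
type_synonym 's sfctr = "('s, 's, 's, 's) fctr"
type_synonym 's snt = "('s, 's, 's, 's) nt"

definition small_cat :: "'s::small_universe scat \<Rightarrow> bool" where
  "small_cat J \<longleftrightarrow> category J \<and> small (Ob J) \<and> small (Ar J)"

definition sfunctor :: "'s::small_universe sfctr \<Rightarrow> 's scat \<Rightarrow> 's scat \<Rightarrow> bool" where
  "sfunctor u J K \<longleftrightarrow> small_cat J \<and> small_cat K \<and> functor_from_to u J K"

definition empty_cat :: "'s scat" where
  "empty_cat = \<lparr>Ob = {}, Ar = {}, Dom = (\<lambda>_. undefined), Cod = (\<lambda>_. undefined),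
     Id = (\<lambda>_. undefined), Comp = (\<lambda>_ _. undefined)\<rparr>"

definition terminal_cat :: "'s::small_universe scat" where
  "terminal_cat = \<lparr>Ob = {tag0}, Ar = {tag0}, Dom = (\<lambda>_\<in>{tag0}. tag0), Cod = (\<lambda>_\<in>{tag0}. tag0),
     Id = (\<lambda>_\<in>{tag0}. tag0),
     Comp = (\<lambda>g f. if f = tag0 \<and> g = tag0 then tag0 else undefined)\<rparr>"

definition point :: "'s::small_universe scat \<Rightarrow> 's \<Rightarrow> 's sfctr" where
  "point K k = \<lparr>Src = terminal_cat, Tgt = K,
     FO = (\<lambda>_\<in>Ob terminal_cat. k), FA = (\<lambda>_\<in>Ar terminal_cat. Id K k)\<rparr>"

definition to_terminal :: "'s::small_universe scat \<Rightarrow> 's sfctr" where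
  "to_terminal J = \<lparr>Src = J, Tgt = terminal_cat, FO = (\<lambda>_\<in>Ob J. tag0), FA = (\<lambda>_\<in>Ar J. tag0)\<rparr>"

definition coproduct_cat :: "'s::small_universe scat \<Rightarrow> 's scat \<Rightarrow> 's scat" where
  "coproduct_cat A B =
     (let O' = pair tag0 ` Ob A \<union> pair tag1 ` Ob B;
          M = pair tag0 ` Ar A \<union> pair tag1 ` Ar B;
          s = (\<lambda>a. if pfst a = tag0 then A else B);
          d = (\<lambda>a\<in>M. pair (pfst a) (Dom (s a) (psnd a)));
          c = (\<lambda>a\<in>M. pair (pfst a) (Cod (s a) (psnd a)))
      in \<lparr>Ob = O', Ar = M, Dom = d, Cod = c,
          Id = (\<lambda>x\<in>O'. pair (pfst x) (Id (s x) (psnd x))),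
          Comp = (\<lambda>g f. if f \<in> M \<and> g \<in> M \<and> c f = d g
                        then pair (pfst f) (Comp (s f) (psnd g) (psnd f)) else undefined)\<rparr>)"

definition inclusion0 :: "'s::small_universe scat \<Rightarrow> 's scat \<Rightarrow> 's sfctr" where
  "inclusion0 A B = \<lparr>Src = A, Tgt = coproduct_cat A B,
     FO = (\<lambda>x\<in>Ob A. pair tag0 x), FA = (\<lambda>f\<in>Ar A. pair tag0 f)\<rparr>"

definition inclusion1 :: "'s::small_universe scat \<Rightarrow> 's scat \<Rightarrow> 's sfctr" where
  "inclusion1 A B = \<lparr>Src = B, Tgt = coproduct_cat A B,
     FO = (\<lambda>x\<in>Ob B. pair tag1 x), FA = (\<lambda>f\<in>Ar B. pair tag1 f)\<rparr>"

text \<open>The category with object set \<open>X\<close> whose morphisms from \<open>x\<close> to \<open>y\<close> are given by the labels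
  \<open>l \<in> H x y\<close>; such a morphism is encoded as \<open>((x, y), l)\<close>, so that it determines its domain and
  codomain.\<close>

definition labelled_cat ::
  "'s::small_universe set \<Rightarrow> ('s \<Rightarrow> 's \<Rightarrow> 's set) \<Rightarrow> ('s \<Rightarrow> 's) \<Rightarrow> ('s \<Rightarrow> 's \<Rightarrow> 's) \<Rightarrow> 's scat" where
  "labelled_cat X H i c =
     (let M = {pair (pair x y) l | x y l. x \<in> X \<and> y \<in> X \<and> l \<in> H x y}
      in \<lparr>Ob = X, Ar = M,
          Dom = (\<lambda>a\<in>M. pfst (pfst a)), Cod = (\<lambda>a\<in>M. psnd (pfst a)),
          Id = (\<lambda>x\<in>X. pair (pair x x) (i x)),
          Comp = (\<lambda>b a. if a \<in> M \<and> b \<in> M \<and> psnd (pfst a) = pfst (pfst b)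
                        then pair (pair (pfst (pfst a)) (psnd (pfst b))) (c (psnd b) (psnd a))
                        else undefined)\<rparr>)"

text \<open>The slice category of \<open>u : J \<rightarrow> K\<close> over \<open>k\<close>: objects are the pairs \<open>(j, f : u(j) \<rightarrow> k)\<close>.\<close>

definition slice_cat :: "'s::small_universe sfctr \<Rightarrow> 's \<Rightarrow> 's scat" where
  "slice_cat u k = labelled_cat
     {pair j f | j f. j \<in> Ob (Src u) \<and> f \<in> hom (Tgt u) (FO u j) k}
     (\<lambda>x y. {g \<in> hom (Src u) (pfst x) (pfst y). Comp (Tgt u) (psnd y) (FA u g) = psnd x})
     (\<lambda>x. Id (Src u) (pfst x))
     (Comp (Src u))"

text \<open>The slice category of \<open>u : J \<rightarrow> K\<close> under \<open>k\<close>: objects are the pairs \<open>(j, f : k \<rightarrow> u(j))\<close>.\<close>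

definition coslice_cat :: "'s::small_universe sfctr \<Rightarrow> 's \<Rightarrow> 's scat" where
  "coslice_cat u k = labelled_cat
     {pair j f | j f. j \<in> Ob (Src u) \<and> f \<in> hom (Tgt u) k (FO u j)}
     (\<lambda>x y. {g \<in> hom (Src u) (pfst x) (pfst y). Comp (Tgt u) (FA u g) (psnd x) = psnd y})
     (\<lambda>x. Id (Src u) (pfst x))
     (Comp (Src u))"

definition slice_pr :: "'s::small_universe sfctr \<Rightarrow> 's \<Rightarrow> 's sfctr" where
  "slice_pr u k = \<lparr>Src = slice_cat u k, Tgt = Src u,
     FO = (\<lambda>x\<in>Ob (slice_cat u k). pfst x), FA = (\<lambda>a\<in>Ar (slice_cat u k). psnd a)\<rparr>"

definition coslice_pr :: "'s::small_universe sfctr \<Rightarrow> 's \<Rightarrow> 's sfctr" where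
  "coslice_pr u k = \<lparr>Src = coslice_cat u k, Tgt = Src u,
     FO = (\<lambda>x\<in>Ob (coslice_cat u k). pfst x), FA = (\<lambda>a\<in>Ar (coslice_cat u k). psnd a)\<rparr>"

definition slice_nt :: "'s::small_universe sfctr \<Rightarrow> 's \<Rightarrow> 's snt" where
  "slice_nt u k = \<lparr>NS = u \<odot> slice_pr u k, NT = point (Tgt u) k \<odot> to_terminal (slice_cat u k),
     Cmp = (\<lambda>x\<in>Ob (slice_cat u k). psnd x)\<rparr>"

definition coslice_nt :: "'s::small_universe sfctr \<Rightarrow> 's \<Rightarrow> 's snt" where
  "coslice_nt u k = \<lparr>NS = point (Tgt u) k \<odot> to_terminal (coslice_cat u k), NT = u \<odot> coslice_pr u k,
     Cmp = (\<lambda>x\<in>Ob (coslice_cat u k). psnd x)\<rparr>"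

text \<open>The comma category of \<open>u1 : J1 \<rightarrow> K\<close> and \<open>u2 : J2 \<rightarrow> K\<close>: objects are the triples
  \<open>(j1, j2, a : u1(j1) \<rightarrow> u2(j2))\<close>, encoded as \<open>(j1, (j2, a))\<close>; morphisms are pairs
  \<open>(g1, g2)\<close> making the evident square in \<open>K\<close> commute.\<close>

definition comma_cat :: "'s::small_universe sfctr \<Rightarrow> 's sfctr \<Rightarrow> 's scat" where
  "comma_cat u1 u2 = labelled_cat
     {pair j1 (pair j2 a) | j1 j2 a.
        j1 \<in> Ob (Src u1) \<and> j2 \<in> Ob (Src u2) \<and> a \<in> hom (Tgt u1) (FO u1 j1) (FO u2 j2)}
     (\<lambda>x y. {pair g1 g2 | g1 g2.
        g1 \<in> hom (Src u1) (pfst x) (pfst y) \<and>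
        g2 \<in> hom (Src u2) (pfst (psnd x)) (pfst (psnd y)) \<and>
        Comp (Tgt u1) (psnd (psnd y)) (FA u1 g1) = Comp (Tgt u1) (FA u2 g2) (psnd (psnd x))})
     (\<lambda>x. pair (Id (Src u1) (pfst x)) (Id (Src u2) (pfst (psnd x))))
     (\<lambda>h g. pair (Comp (Src u1) (pfst h) (pfst g)) (Comp (Src u2) (psnd h) (psnd g)))"

definition comma_pr1 :: "'s::small_universe sfctr \<Rightarrow> 's sfctr \<Rightarrow> 's sfctr" where
  "comma_pr1 u1 u2 = \<lparr>Src = comma_cat u1 u2, Tgt = Src u1,
     FO = (\<lambda>x\<in>Ob (comma_cat u1 u2). pfst x), FA = (\<lambda>a\<in>Ar (comma_cat u1 u2). pfst (psnd a))\<rparr>"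

definition comma_pr2 :: "'s::small_universe sfctr \<Rightarrow> 's sfctr \<Rightarrow> 's sfctr" where
  "comma_pr2 u1 u2 = \<lparr>Src = comma_cat u1 u2, Tgt = Src u2,
     FO = (\<lambda>x\<in>Ob (comma_cat u1 u2). pfst (psnd x)), FA = (\<lambda>a\<in>Ar (comma_cat u1 u2). psnd (psnd a))\<rparr>"

definition comma_nt :: "'s::small_universe sfctr \<Rightarrow> 's sfctr \<Rightarrow> 's snt" where
  "comma_nt u1 u2 = \<lparr>NS = u1 \<odot> comma_pr1 u1 u2, NT = u2 \<odot> comma_pr2 u1 u2,
     Cmp = (\<lambda>x\<in>Ob (comma_cat u1 u2). psnd (psnd x))\<rparr>"

text \<open>The pullback is characterised by its universal property among small categories, so all
  pullback squares in \<open>Cat\<close> are covered, not just those with a chosen apex.\<close>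

definition is_pullback_square ::
  "'s::small_universe sfctr \<Rightarrow> 's sfctr \<Rightarrow> 's sfctr \<Rightarrow> 's sfctr \<Rightarrow> bool" where
  "is_pullback_square v u1 u2 w \<longleftrightarrow>
     sfunctor v (Src v) (Tgt v) \<and> sfunctor u1 (Src v) (Tgt u1) \<and>
     sfunctor u2 (Tgt v) (Tgt u2) \<and> sfunctor w (Tgt u1) (Tgt u2) \<and>
     w \<odot> u1 = u2 \<odot> v \<and>
     (\<forall>L a b. sfunctor a L (Tgt v) \<and> sfunctor b L (Tgt u1) \<and> w \<odot> b = u2 \<odot> a \<longrightarrow>
        (\<exists>!h. sfunctor h L (Src v) \<and> v \<odot> h = a \<and> u1 \<odot> h = b))"

definition cartesian :: "('o1, 'a1, 'o2, 'a2) fctr \<Rightarrow> 'a1 \<Rightarrow> bool" where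
  "cartesian u \<phi> \<longleftrightarrow> \<phi> \<in> Ar (Src u) \<and>
     (\<forall>\<psi>\<in>Ar (Src u). \<forall>g\<in>hom (Tgt u) (FO u (Dom (Src u) \<psi>)) (FO u (Dom (Src u) \<phi>)).
        Cod (Src u) \<psi> = Cod (Src u) \<phi> \<and> Comp (Tgt u) (FA u \<phi>) g = FA u \<psi> \<longrightarrow>
        (\<exists>!\<chi>. \<chi> \<in> hom (Src u) (Dom (Src u) \<psi>) (Dom (Src u) \<phi>) \<and>
              Comp (Src u) \<phi> \<chi> = \<psi> \<and> FA u \<chi> = g))"

definition opcartesian :: "('o1, 'a1, 'o2, 'a2) fctr \<Rightarrow> 'a1 \<Rightarrow> bool" where
  "opcartesian u \<phi> \<longleftrightarrow> \<phi> \<in> Ar (Src u) \<and>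
     (\<forall>\<psi>\<in>Ar (Src u). \<forall>g\<in>hom (Tgt u) (FO u (Cod (Src u) \<phi>)) (FO u (Cod (Src u) \<psi>)).
        Dom (Src u) \<psi> = Dom (Src u) \<phi> \<and> Comp (Tgt u) g (FA u \<phi>) = FA u \<psi> \<longrightarrow>
        (\<exists>!\<chi>. \<chi> \<in> hom (Src u) (Cod (Src u) \<phi>) (Cod (Src u) \<psi>) \<and>
              Comp (Src u) \<chi> \<phi> = \<psi> \<and> FA u \<chi> = g))"

definition grothendieck_fibration :: "('o1, 'a1, 'o2, 'a2) fctr \<Rightarrow> bool" where
  "grothendieck_fibration u \<longleftrightarrow> is_functor u \<and>
     (\<forall>j\<in>Ob (Src u). \<forall>f\<in>Ar (Tgt u). Cod (Tgt u) f = FO u j \<longrightarrow>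
        (\<exists>\<phi>. cartesian u \<phi> \<and> Cod (Src u) \<phi> = j \<and> FA u \<phi> = f))"

definition grothendieck_opfibration :: "('o1, 'a1, 'o2, 'a2) fctr \<Rightarrow> bool" where
  "grothendieck_opfibration u \<longleftrightarrow> is_functor u \<and>
     (\<forall>j\<in>Ob (Src u). \<forall>f\<in>Ar (Tgt u). Dom (Tgt u) f = FO u j \<longrightarrow>
        (\<exists>\<phi>. opcartesian u \<phi> \<and> Dom (Src u) \<phi> = j \<and> FA u \<phi> = f))"


section \<open>Prederivators and derivators\<close>

text \<open>The values of a prederivator may have arbitrary objects and morphisms: the
  types \<open>'b\<close> and \<open>'c\<close> are unconstrained.\<close>

record ('s, 'b, 'c) prederiv =
  PO :: "'s scat \<Rightarrow> ('b, 'c) cat"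
  PF :: "'s sfctr \<Rightarrow> ('b, 'c, 'b, 'c) fctr"
  PN :: "'s snt \<Rightarrow> ('b, 'c, 'b, 'c) nt"

definition prederivator :: "('s::small_universe, 'b, 'c) prederiv \<Rightarrow> bool" where
  "prederivator D \<longleftrightarrow>
     (\<forall>J. small_cat J \<longrightarrow> category (PO D J)) \<and>
     (\<forall>J K u. sfunctor u J K \<longrightarrow> functor_from_to (PF D u) (PO D K) (PO D J)) \<and>
     (\<forall>J K u u' \<alpha>. sfunctor u J K \<and> sfunctor u' J K \<and> nat_from_to \<alpha> u u' \<longrightarrow>
        nat_from_to (PN D \<alpha>) (PF D u) (PF D u')) \<and>
     (\<forall>J. small_cat J \<longrightarrow> PF D (id_fctr J) = id_fctr (PO D J)) \<and>
     (\<forall>J K L u v. sfunctor u J K \<and> sfunctor v K L \<longrightarrow> PF D (v \<odot> u) = PF D u \<odot> PF D v) \<and>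
     (\<forall>J K u. sfunctor u J K \<longrightarrow> PN D (id_nt u) = id_nt (PF D u)) \<and>
     (\<forall>J K u1 u2 u3 \<alpha> \<beta>. sfunctor u1 J K \<and> sfunctor u2 J K \<and> sfunctor u3 J K \<and>
        nat_from_to \<alpha> u1 u2 \<and> nat_from_to \<beta> u2 u3 \<longrightarrow> PN D (\<beta> \<bullet> \<alpha>) = PN D \<beta> \<bullet> PN D \<alpha>) \<and>
     (\<forall>J K L u u' v v' \<alpha> \<beta>. sfunctor u J K \<and> sfunctor u' J K \<and> sfunctor v K L \<and> sfunctor v' K L \<and>
        nat_from_to \<alpha> u u' \<and> nat_from_to \<beta> v v' \<longrightarrow> PN D (\<beta> \<star> \<alpha>) = PN D \<alpha> \<star> PN D \<beta>)"

definition Der1 :: "('s::small_universe, 'b, 'c) prederiv \<Rightarrow> bool" where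
  "Der1 D \<longleftrightarrow>
     (\<forall>J1 J2. small_cat J1 \<and> small_cat J2 \<longrightarrow>
        is_equivalence (pairing (PF D (inclusion0 J1 J2)) (PF D (inclusion1 J1 J2)))) \<and>
     Ob (PO D empty_cat) \<noteq> {}"

definition Der2 :: "('s::small_universe, 'b, 'c) prederiv \<Rightarrow> bool" where
  "Der2 D \<longleftrightarrow>
     (\<forall>J. small_cat J \<longrightarrow> (\<forall>f\<in>Ar (PO D J).
        is_iso (PO D J) f \<longleftrightarrow>
        (\<forall>j\<in>Ob J. is_iso (PO D terminal_cat) (FA (PF D (point J j)) f))))"

definition Der3 :: "('s::small_universe, 'b, 'c) prederiv \<Rightarrow> bool" where
  "Der3 D \<longleftrightarrow>
     (\<forall>J K u. sfunctor u J K \<longrightarrow>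
        (\<exists>L \<eta> \<epsilon>. adjunction L (PF D u) \<eta> \<epsilon>) \<and> (\<exists>R \<eta> \<epsilon>. adjunction (PF D u) R \<eta> \<epsilon>))"

text \<open>For a square \<open>v : J1 \<rightarrow> J2\<close>, \<open>u1 : J1 \<rightarrow> K1\<close>, \<open>u2 : J2 \<rightarrow> K2\<close>, \<open>w : K1 \<rightarrow> K2\<close>
  with \<open>\<alpha> : u2 v \<rightarrow> w u1\<close>, and for left adjoints \<open>L1\<close>, \<open>L2\<close> of \<open>u1*\<close>, \<open>u2*\<close>, the composite
  \<open>L1 v* \<rightarrow> L1 v* u2* L2 \<rightarrow> L1 u1* w* L2 \<rightarrow> w* L2\<close> built from the unit \<open>\<eta>2\<close> of \<open>L2\<close>, from
  \<open>\<alpha>*\<close> and from the counit \<open>\<epsilon>1\<close> of \<open>L1\<close>.\<close>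

definition bc_left where
  "bc_left D v w \<alpha> L1 \<epsilon>1 L2 \<eta>2 =
     (\<epsilon>1 \<star> id_nt (PF D w \<odot> L2)) \<bullet> (id_nt L1 \<star> PN D \<alpha> \<star> id_nt L2) \<bullet> (id_nt (L1 \<odot> PF D v) \<star> \<eta>2)"

text \<open>Dually, for \<open>\<alpha> : w u1 \<rightarrow> u2 v\<close> and right adjoints \<open>R1\<close>, \<open>R2\<close> of \<open>u1*\<close>, \<open>u2*\<close>, the composite
  \<open>w* R2 \<rightarrow> R1 u1* w* R2 \<rightarrow> R1 v* u2* R2 \<rightarrow> R1 v*\<close>.\<close>

definition bc_right where
  "bc_right D v w \<alpha> R1 \<eta>1 R2 \<epsilon>2 =
     (id_nt (R1 \<odot> PF D v) \<star> \<epsilon>2) \<bullet> (id_nt R1 \<star> PN D \<alpha> \<star> id_nt R2) \<bullet> (\<eta>1 \<star> id_nt (PF D w \<odot> R2))"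

text \<open>Adjoints exist by (Der3) but are only unique up to isomorphism. Whether the Beck--Chevalley
  transformation is invertible does not depend on them; the definitions below ask for it for every
  choice of adjunction data.\<close>

definition exact_left ::
  "('s::small_universe, 'b, 'c) prederiv \<Rightarrow> 's sfctr \<Rightarrow> 's sfctr \<Rightarrow> 's sfctr \<Rightarrow> 's sfctr \<Rightarrow> 's snt \<Rightarrow> bool"
  where
  "exact_left D v u1 u2 w \<alpha> \<longleftrightarrow>
     (\<forall>L1 \<eta>1 \<epsilon>1 L2 \<eta>2 \<epsilon>2. adjunction L1 (PF D u1) \<eta>1 \<epsilon>1 \<and> adjunction L2 (PF D u2) \<eta>2 \<epsilon>2 \<longrightarrow>
        nat_iso (bc_left D v w \<alpha> L1 \<epsilon>1 L2 \<eta>2))"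

definition exact_right ::
  "('s::small_universe, 'b, 'c) prederiv \<Rightarrow> 's sfctr \<Rightarrow> 's sfctr \<Rightarrow> 's sfctr \<Rightarrow> 's sfctr \<Rightarrow> 's snt \<Rightarrow> bool"
  where
  "exact_right D v u1 u2 w \<alpha> \<longleftrightarrow>
     (\<forall>R1 \<eta>1 \<epsilon>1 R2 \<eta>2 \<epsilon>2. adjunction (PF D u1) R1 \<eta>1 \<epsilon>1 \<and> adjunction (PF D u2) R2 \<eta>2 \<epsilon>2 \<longrightarrow>
        nat_iso (bc_right D v w \<alpha> R1 \<eta>1 R2 \<epsilon>2))"

definition Der4 :: "('s::small_universe, 'b, 'c) prederiv \<Rightarrow> bool" where
  "Der4 D \<longleftrightarrow>
     (\<forall>J K u. sfunctor u J K \<longrightarrow> (\<forall>k\<in>Ob K.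
        exact_left D (slice_pr u k) (to_terminal (slice_cat u k)) u (point K k) (slice_nt u k) \<and>
        exact_right D (coslice_pr u k) (to_terminal (coslice_cat u k)) u (point K k) (coslice_nt u k)))"

definition derivator :: "('s::small_universe, 'b, 'c) prederiv \<Rightarrow> bool" where
  "derivator D \<longleftrightarrow> prederivator D \<and> Der1 D \<and> Der2 D \<and> Der3 D \<and> Der4 D"

definition base_change_fibrations :: "('s::small_universe, 'b, 'c) prederiv \<Rightarrow> bool" where
  "base_change_fibrations D \<longleftrightarrow>
     (\<forall>v u1 u2 w. is_pullback_square v u1 u2 w \<and>
        (grothendieck_fibration u2 \<or> grothendieck_opfibration w) \<longrightarrow>
        exact_right D v u1 u2 w (id_nt (w \<odot> u1)))"

text \<open>The comma square is a square for \<open>exact_left\<close> with \<open>v = pr1\<close>, \<open>u1 = pr2\<close>, \<open>u2 = u1\<close>, \<open>w = u2\<close>: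
  the transformation in question goes from \<open>pr2_! pr1*\<close> to \<open>u2* u1_!\<close>.\<close>

definition base_change_comma :: "('s::small_universe, 'b, 'c) prederiv \<Rightarrow> bool" where
  "base_change_comma D \<longleftrightarrow>
     (\<forall>J1 J2 K u1 u2. sfunctor u1 J1 K \<and> sfunctor u2 J2 K \<longrightarrow>
        exact_left D (comma_pr1 u1 u2) (comma_pr2 u1 u2) u1 u2 (comma_nt u1 u2))"

end

theory Submission
  imports Defs
begin

text \<open>The proof replaces invertibility of Beck--Chevalley transformations by universality of arrows.
  For \<open>\<alpha> : u2 v \<rightarrow> w u1\<close> the component at \<open>X\<close> of \<open>u1\<^sub>! v* \<rightarrow> w* u2\<^sub>!\<close> is the transpose of
  \<open>v* X \<rightarrow> v* u2* Y \<rightarrow> u1* w* Y\<close>, where \<open>X \<rightarrow> u2* Y\<close> is the unit. It is invertible if and only if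
  this morphism is a universal arrow from \<open>v* X\<close> to \<open>u1*\<close>. Hence a square is exact if and only if it
  sends universal arrows to universal arrows (\<open>exact_left_iff\<close>). In this form the choice of adjoints
  disappears, exact squares can be pasted (\<open>exact_paste\<close>), and the equivalence of the two conjugate
  conditions is a bijection between sets of maps (\<open>preserves_universal_iff_couniversal\<close>,
  \<open>exact_right_iff\<close>).

  The second ingredient compares squares with different corners. If \<open>i : P \<rightarrow> J1\<close> is such that
  \<open>i*\<close> is bijective on maps from \<open>v* X\<close> to \<open>u1* Z\<close>, then the square and its restriction along \<open>i\<close> are
  exact at the same time. This holds if \<open>i\<close> has a right adjoint with a counit that \<open>v\<close> sends to
  identities, or a left adjoint with a unit that \<open>u1\<close> sends to identities, because a prederivator
  turns adjunctions between small categories into adjunctions between its values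
  (\<open>restriction_bij_coreflective\<close>, \<open>restriction_bij_reflective\<close>, \<open>exact_restrict_iff\<close>).

  The implications between the three conditions are instances of this comparison.
  \<^item> Slices and coslices are isomorphic to comma categories in which one leg is a point. Hence
    base change for comma categories implies (Der4); the half about right Kan extensions
    follows by passing to conjugates (\<open>Der4_if_comma\<close>).
  \<^item> By (Der2) and (Der4), exactness of the comma square of \<open>u1\<close> and \<open>u2\<close> can be tested at each
    object \<open>j\<close> of \<open>J2\<close>, where one has to paste it with the slice over \<open>j\<close> of the projection to \<open>J2\<close>. The
    result is the restriction of the slice square of \<open>u1\<close> over \<open>u2 j\<close> along a functor with a right
    adjoint (\<open>comma_exact_if_pointwise\<close>).
  \<^item> The pullback of \<open>w\<close> and \<open>u2\<close> is included in the comma category \<open>(w/u2)\<close>. Cartesian lifts provide a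
    right adjoint of the inclusion if \<open>u2\<close> is a fibration, opcartesian lifts a left adjoint if \<open>w\<close>
    is an opfibration. So base change for comma categories implies base change for
    (op)fibrations (\<open>base_change_fibrations_if_comma\<close>).
  \<^item> Conversely \<open>(u1/u2)\<close> is the pullback along \<open>u2\<close> of the opfibration \<open>(u1/K) \<rightarrow> K\<close>, and the exactness
    of the square over \<open>(u1/K)\<close> follows by restricting it to \<open>J1\<close>, along the left adjoint of the
    projection \<open>(u1/K) \<rightarrow> J1\<close> (\<open>comma_if_base_change_fibrations\<close>).\<close>

section \<open>Categories, functors and natural transformations\<close>

lemma homI: "f \<in> Ar C \<Longrightarrow> Dom C f = x \<Longrightarrow> Cod C f = y \<Longrightarrow> f \<in> hom C x y"
  by (simp add: hom_def)

lemma homD: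
  assumes "f \<in> hom C x y"
  shows "f \<in> Ar C" "Dom C f = x" "Cod C f = y"
  using assms by (auto simp: hom_def)

lemma Ar_hom: "f \<in> Ar C \<Longrightarrow> f \<in> hom C (Dom C f) (Cod C f)"
  by (simp add: hom_def)

lemma hom_objects:
  assumes "category C" "f \<in> hom C x y"
  shows "x \<in> Ob C" "y \<in> Ob C"
  using assms by (auto simp: hom_def category_def)

lemma Id_hom: "category C \<Longrightarrow> x \<in> Ob C \<Longrightarrow> Id C x \<in> hom C x x"
  by (simp add: category_def)

lemma Comp_hom:
  "category C \<Longrightarrow> f \<in> hom C x y \<Longrightarrow> g \<in> hom C y z \<Longrightarrow> Comp C g f \<in> hom C x z"
  by (auto simp: hom_def category_def)

lemma Comp_assoc:
  "category C \<Longrightarrow> f \<in> hom C x y \<Longrightarrow> g \<in> hom C y z \<Longrightarrow> h \<in> hom C z t \<Longrightarrow>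
   Comp C (Comp C h g) f = Comp C h (Comp C g f)"
  by (auto simp: hom_def category_def)

lemma Comp_Id_right: "category C \<Longrightarrow> f \<in> hom C x y \<Longrightarrow> Comp C f (Id C x) = f"
  by (auto simp: hom_def category_def)

lemma Comp_Id_left: "category C \<Longrightarrow> f \<in> hom C x y \<Longrightarrow> Comp C (Id C y) f = f"
  by (auto simp: hom_def category_def)

lemma is_iso_iff:
  "f \<in> hom C x y \<Longrightarrow> is_iso C f \<longleftrightarrow>
    (\<exists>g \<in> hom C y x. Comp C g f = Id C x \<and> Comp C f g = Id C y)"
  by (auto simp: is_iso_def hom_def)

lemma functor_categories:
  assumes "functor_from_to F A B"
  shows "category A" "category B" "Src F = A" "Tgt F = B" "is_functor F"
  using assms by (auto simp: functor_from_to_def is_functor_def)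

lemma functor_ob: "functor_from_to F A B \<Longrightarrow> x \<in> Ob A \<Longrightarrow> FO F x \<in> Ob B"
  by (auto simp: functor_from_to_def is_functor_def)

lemma functor_hom:
  "functor_from_to F A B \<Longrightarrow> f \<in> hom A x y \<Longrightarrow> FA F f \<in> hom B (FO F x) (FO F y)"
  by (auto simp: functor_from_to_def is_functor_def hom_def)

lemma functor_Id: "functor_from_to F A B \<Longrightarrow> x \<in> Ob A \<Longrightarrow> FA F (Id A x) = Id B (FO F x)"
  by (auto simp: functor_from_to_def is_functor_def)

lemma functor_Comp:
  "functor_from_to F A B \<Longrightarrow> f \<in> hom A x y \<Longrightarrow> g \<in> hom A y z \<Longrightarrow>
   FA F (Comp A g f) = Comp B (FA F g) (FA F f)"
  by (auto simp: functor_from_to_def is_functor_def hom_def)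

lemma functor_extensional:
  assumes "functor_from_to F A B"
  shows "FO F \<in> extensional (Ob A)" "FA F \<in> extensional (Ar A)"
  using assms by (auto simp: functor_from_to_def is_functor_def)

lemma functorI:
  assumes "category A" "category B" "Src F = A" "Tgt F = B"
    and "\<And>x. x \<in> Ob A \<Longrightarrow> FO F x \<in> Ob B"
    and "\<And>f. f \<in> Ar A \<Longrightarrow> FA F f \<in> hom B (FO F (Dom A f)) (FO F (Cod A f))"
    and "\<And>x. x \<in> Ob A \<Longrightarrow> FA F (Id A x) = Id B (FO F x)"
    and "\<And>f g. f \<in> Ar A \<Longrightarrow> g \<in> Ar A \<Longrightarrow> Cod A f = Dom A g \<Longrightarrow>
           FA F (Comp A g f) = Comp B (FA F g) (FA F f)"
    and "FO F \<in> extensional (Ob A)" "FA F \<in> extensional (Ar A)"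
  shows "functor_from_to F A B"
  using assms by (auto simp: functor_from_to_def is_functor_def)

lemma functor_eqI:
  fixes F G :: "('o1, 'a1, 'o2, 'a2) fctr"
  assumes F: "functor_from_to F A B" and G: "functor_from_to G A B"
    and "\<And>x. x \<in> Ob A \<Longrightarrow> FO F x = FO G x" and "\<And>f. f \<in> Ar A \<Longrightarrow> FA F f = FA G f"
  shows "F = G"
proof (rule fctr.equality)
  show "FO F = FO G" "FA F = FA G"
    using assms by (auto simp: functor_from_to_def is_functor_def intro: extensionalityI)
qed (use F G in \<open>auto simp: functor_from_to_def\<close>)

text \<open>A functor preserves identities, and an identity determines its object; hence a functor is
  determined by its values on arrows.\<close>

lemma functor_eqI_arrows:
  assumes F: "functor_from_to F A B" and G: "functor_from_to G A B"
    and eq: "\<And>f. f \<in> Ar A \<Longrightarrow> FA F f = FA G f"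
  shows "F = G"
proof (rule functor_eqI[OF F G _ eq])
  fix x assume x: "x \<in> Ob A"
  have "Id A x \<in> hom A x x" using x F by (simp add: Id_hom functor_categories)
  then have "FA F (Id A x) \<in> hom B (FO F x) (FO F x)" "FA G (Id A x) \<in> hom B (FO G x) (FO G x)"
    using F G functor_hom by fast+
  then show "FO F x = FO G x" using eq \<open>Id A x \<in> hom A x x\<close> by (auto simp: hom_def)
qed

lemma id_fctr_functor: "category A \<Longrightarrow> functor_from_to (id_fctr A) A A"
  by (rule functorI) (auto simp: id_fctr_def category_def hom_def)

lemma id_fctr_simps [simp]:
  "Src (id_fctr A) = A" "Tgt (id_fctr A) = A"
  "x \<in> Ob A \<Longrightarrow> FO (id_fctr A) x = x" "f \<in> Ar A \<Longrightarrow> FA (id_fctr A) f = f"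
  by (auto simp: id_fctr_def)

lemma comp_fctr_simps [simp]:
  "Src (G \<odot> F) = Src F" "Tgt (G \<odot> F) = Tgt G"
  "x \<in> Ob (Src F) \<Longrightarrow> FO (G \<odot> F) x = FO G (FO F x)"
  "f \<in> Ar (Src F) \<Longrightarrow> FA (G \<odot> F) f = FA G (FA F f)"
  by (auto simp: comp_fctr_def)

lemma comp_functor:
  assumes F: "functor_from_to F A B" and G: "functor_from_to G B C"
  shows "functor_from_to (G \<odot> F) A C"
proof (rule functorI)
  note S = functor_categories[OF F] functor_categories[OF G]
  show "category A" "category C" "Src (G \<odot> F) = A" "Tgt (G \<odot> F) = C" using S by auto
  show "FO (G \<odot> F) x \<in> Ob C" if "x \<in> Ob A" for x
    using that S functor_ob[OF F] functor_ob[OF G] by simp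
  show "FA (G \<odot> F) f \<in> hom C (FO (G \<odot> F) (Dom A f)) (FO (G \<odot> F) (Cod A f))" if "f \<in> Ar A" for f
    using that S functor_hom[OF G functor_hom[OF F Ar_hom[OF that]]]
      hom_objects[OF S(1) Ar_hom[OF that]] by simp
  show "FA (G \<odot> F) (Id A x) = Id C (FO (G \<odot> F) x)" if "x \<in> Ob A" for x
    using that S functor_Id[OF F] functor_Id[OF G] functor_ob[OF F] homD(1)[OF Id_hom[OF S(1) that]]
    by simp
  show "FA (G \<odot> F) (Comp A g f) = Comp C (FA (G \<odot> F) g) (FA (G \<odot> F) f)"
    if "f \<in> Ar A" "g \<in> Ar A" "Cod A f = Dom A g" for f g
  proof -
    have f: "f \<in> hom A (Dom A f) (Dom A g)" and g: "g \<in> hom A (Dom A g) (Cod A g)"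
      using that by (auto simp: hom_def)
    show ?thesis
      using that S homD(1)[OF Comp_hom[OF S(1) f g]] functor_Comp[OF F f g]
        functor_Comp[OF G functor_hom[OF F f] functor_hom[OF F g]] by simp
  qed
  show "FO (G \<odot> F) \<in> extensional (Ob A)" "FA (G \<odot> F) \<in> extensional (Ar A)"
    using S by (auto simp: comp_fctr_def)
qed

lemma comp_fctr_assoc:
  assumes F: "functor_from_to F A B" and G: "functor_from_to G B C" and H: "functor_from_to H C E"
  shows "(H \<odot> G) \<odot> F = H \<odot> (G \<odot> F)"
proof (rule functor_eqI_arrows)
  show "functor_from_to ((H \<odot> G) \<odot> F) A E" "functor_from_to (H \<odot> (G \<odot> F)) A E"
    by (rule comp_functor[OF F comp_functor[OF G H]], rule comp_functor[OF comp_functor[OF F G] H])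
  show "FA ((H \<odot> G) \<odot> F) f = FA (H \<odot> (G \<odot> F)) f" if "f \<in> Ar A" for f
    using functor_hom[OF F Ar_hom[OF that]] that functor_categories[OF F] functor_categories[OF G]
      functor_categories[OF H]
    by (simp add: homD)
qed

lemma comp_id_fctr:
  assumes F: "functor_from_to F A B"
  shows "F \<odot> id_fctr A = F" "id_fctr B \<odot> F = F"
proof -
  note S = functor_categories[OF F]
  show "F \<odot> id_fctr A = F"
    by (rule functor_eqI_arrows[OF comp_functor[OF id_fctr_functor F] F]) (simp_all add: S)
  show "id_fctr B \<odot> F = F"
    by (rule functor_eqI_arrows[OF comp_functor[OF F id_fctr_functor] F])
      (use S homD(1)[OF functor_hom[OF F Ar_hom]] in auto)
qed

lemma nat_functors:
  assumes "nat_from_to \<alpha> F G"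
  shows "functor_from_to F (Src F) (Tgt F)" "functor_from_to G (Src F) (Tgt F)"
    "NS \<alpha> = F" "NT \<alpha> = G"
  using assms by (auto simp: nat_from_to_def functor_from_to_def)

lemma nat_hom:
  assumes "nat_from_to \<alpha> F G" "functor_from_to F A B" "x \<in> Ob A"
  shows "Cmp \<alpha> x \<in> hom B (FO F x) (FO G x)"
  using assms by (auto simp: nat_from_to_def functor_from_to_def)

lemma nat_natural:
  assumes "nat_from_to \<alpha> F G" "functor_from_to F A B" "f \<in> hom A x y"
  shows "Comp B (Cmp \<alpha> y) (FA F f) = Comp B (FA G f) (Cmp \<alpha> x)"
  using assms by (auto simp: nat_from_to_def functor_from_to_def hom_def)

lemma nat_extensional:
  "nat_from_to \<alpha> F G \<Longrightarrow> functor_from_to F A B \<Longrightarrow> Cmp \<alpha> \<in> extensional (Ob A)"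
  by (auto simp: nat_from_to_def functor_from_to_def)

lemma natI:
  assumes "functor_from_to F A B" "functor_from_to G A B" "NS \<alpha> = F" "NT \<alpha> = G"
    and "\<And>x. x \<in> Ob A \<Longrightarrow> Cmp \<alpha> x \<in> hom B (FO F x) (FO G x)"
    and "\<And>f x y. f \<in> hom A x y \<Longrightarrow> x \<in> Ob A \<Longrightarrow> y \<in> Ob A \<Longrightarrow>
           Comp B (Cmp \<alpha> y) (FA F f) = Comp B (FA G f) (Cmp \<alpha> x)"
    and "Cmp \<alpha> \<in> extensional (Ob A)"
  shows "nat_from_to \<alpha> F G"
  using assms hom_objects[of A, OF functor_categories(1)[OF assms(1)] Ar_hom]
  by (auto simp: nat_from_to_def functor_from_to_def Ar_hom)

lemma nt_eqI:
  fixes \<alpha> \<beta> :: "('o1, 'a1, 'o2, 'a2) nt"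
  assumes "nat_from_to \<alpha> F G" "nat_from_to \<beta> F G" "functor_from_to F A B"
    and "\<And>x. x \<in> Ob A \<Longrightarrow> Cmp \<alpha> x = Cmp \<beta> x"
  shows "\<alpha> = \<beta>"
proof (rule nt.equality)
  show "Cmp \<alpha> = Cmp \<beta>"
    using assms by (auto simp: functor_from_to_def nat_from_to_def intro: extensionalityI)
qed (use assms in \<open>auto simp: nat_from_to_def\<close>)

lemma id_nt_nat: "functor_from_to F A B \<Longrightarrow> nat_from_to (id_nt F) F F"
  by (rule natI)
    (auto simp: id_nt_def functor_categories functor_ob Id_hom Comp_Id_left Comp_Id_right functor_hom
      intro!: Comp_Id_left[THEN trans] Comp_Id_right[symmetric] dest: functor_hom)

lemma id_nt_simps [simp]: "NS (id_nt F) = F" "NT (id_nt F) = F"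
  "x \<in> Ob (Src F) \<Longrightarrow> Cmp (id_nt F) x = Id (Tgt F) (FO F x)"
  by (auto simp: id_nt_def)

lemma vcomp_nat:
  assumes a: "nat_from_to \<alpha> F G" and b: "nat_from_to \<beta> G H"
  shows "nat_from_to (\<beta> \<bullet> \<alpha>) F H"
proof -
  define A B where "A = Src F" and "B = Tgt F"
  have F: "functor_from_to F A B" and G: "functor_from_to G A B"
    using nat_functors[OF a] by (auto simp: A_def B_def)
  have H: "functor_from_to H A B" using nat_functors[OF b] functor_categories[OF G] by auto
  note S = functor_categories[OF F] functor_categories[OF G] nat_functors(3,4)[OF a]
    nat_functors(3,4)[OF b]
  show ?thesis
  proof (rule natI[OF F H])
    show "Cmp (\<beta> \<bullet> \<alpha>) x \<in> hom B (FO F x) (FO H x)" if "x \<in> Ob A" for x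
      using Comp_hom[OF S(2) nat_hom[OF a F that] nat_hom[OF b G that]] that S
      by (simp add: vcomp_def)
    show "Comp B (Cmp (\<beta> \<bullet> \<alpha>) y) (FA F f) = Comp B (FA H f) (Cmp (\<beta> \<bullet> \<alpha>) x)"
      if f: "f \<in> hom A x y" and x: "x \<in> Ob A" and y: "y \<in> Ob A" for f x y
    proof -
      note h = nat_hom[OF a F x] nat_hom[OF b G x] nat_hom[OF a F y] nat_hom[OF b G y]
        functor_hom[OF F f] functor_hom[OF G f] functor_hom[OF H f]
      have "Comp B (Comp B (Cmp \<beta> y) (Cmp \<alpha> y)) (FA F f)
          = Comp B (Cmp \<beta> y) (Comp B (FA G f) (Cmp \<alpha> x))"
        using h nat_natural[OF a F f] by (simp add: Comp_assoc[OF S(2)])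
      also have "\<dots> = Comp B (Comp B (Cmp \<beta> y) (FA G f)) (Cmp \<alpha> x)"
        using h by (simp add: Comp_assoc[OF S(2)])
      also have "\<dots> = Comp B (FA H f) (Comp B (Cmp \<beta> x) (Cmp \<alpha> x))"
        using h nat_natural[OF b G f] by (simp add: Comp_assoc[OF S(2)])
      finally show ?thesis using x y S by (simp add: vcomp_def)
    qed
  qed (use S in \<open>auto simp: vcomp_def\<close>)
qed

lemma hcomp_nat:
  assumes a: "nat_from_to \<alpha> F F'" and F: "functor_from_to F A B"
    and b: "nat_from_to \<beta> G G'" and G: "functor_from_to G B C"
  shows "nat_from_to (\<beta> \<star> \<alpha>) (G \<odot> F) (G' \<odot> F')"
proof -
  have F': "functor_from_to F' A B" and G': "functor_from_to G' B C"
    using nat_functors[OF a] nat_functors[OF b] functor_categories[OF F] functor_categories[OF G]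
    by auto
  note S = functor_categories[OF F] functor_categories[OF G] functor_categories[OF F']
    functor_categories[OF G'] nat_functors(3,4)[OF a] nat_functors(3,4)[OF b]
  note C = Comp_assoc[OF S(7)]
  have c: "Cmp (\<beta> \<star> \<alpha>) x = Comp C (Cmp \<beta> (FO F' x)) (FA G (Cmp \<alpha> x))" if "x \<in> Ob A" for x
    using that S by (simp add: hcomp_def)
  show ?thesis
  proof (rule natI[OF comp_functor[OF F G] comp_functor[OF F' G']])
    show "Cmp (\<beta> \<star> \<alpha>) x \<in> hom C (FO (G \<odot> F) x) (FO (G' \<odot> F') x)" if x: "x \<in> Ob A" for x
      using Comp_hom[OF S(7) functor_hom[OF G nat_hom[OF a F x]]
          nat_hom[OF b G functor_ob[OF F' x]]] x S c by simp
    show "Comp C (Cmp (\<beta> \<star> \<alpha>) y) (FA (G \<odot> F) f) = Comp C (FA (G' \<odot> F') f) (Cmp (\<beta> \<star> \<alpha>) x)"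
      if f: "f \<in> hom A x y" and x: "x \<in> Ob A" and y: "y \<in> Ob A" for f x y
    proof -
      note h = functor_hom[OF G nat_hom[OF a F x]] functor_hom[OF G nat_hom[OF a F y]]
        nat_hom[OF b G functor_ob[OF F' x]] nat_hom[OF b G functor_ob[OF F' y]]
        functor_hom[OF G functor_hom[OF F f]] functor_hom[OF G functor_hom[OF F' f]]
        functor_hom[OF G' functor_hom[OF F' f]]
      have "Comp C (Comp C (Cmp \<beta> (FO F' y)) (FA G (Cmp \<alpha> y))) (FA G (FA F f))
          = Comp C (Cmp \<beta> (FO F' y)) (FA G (Comp B (Cmp \<alpha> y) (FA F f)))"
        using h functor_Comp[OF G functor_hom[OF F f] nat_hom[OF a F y]] by (simp add: C)
      also have "\<dots> = Comp C (Comp C (Cmp \<beta> (FO F' y)) (FA G (FA F' f))) (FA G (Cmp \<alpha> x))"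
        using h functor_Comp[OF G nat_hom[OF a F x] functor_hom[OF F' f]] nat_natural[OF a F f]
        by (simp add: C)
      also have "\<dots> = Comp C (FA G' (FA F' f)) (Comp C (Cmp \<beta> (FO F' x)) (FA G (Cmp \<alpha> x)))"
        using h nat_natural[OF b G functor_hom[OF F' f]] by (simp add: C)
      finally show ?thesis using c x y f S homD(1)[OF f] by simp
    qed
  qed (use S in \<open>auto simp: hcomp_def\<close>)
qed

lemma whisker_left_nat:
  "nat_from_to \<alpha> F F' \<Longrightarrow> functor_from_to F A B \<Longrightarrow> functor_from_to G B C \<Longrightarrow>
   nat_from_to (id_nt G \<star> \<alpha>) (G \<odot> F) (G \<odot> F')"
  by (rule hcomp_nat[OF _ _ id_nt_nat])

lemma whisker_right_nat:
  "functor_from_to F A B \<Longrightarrow> nat_from_to \<beta> G G' \<Longrightarrow> functor_from_to G B C \<Longrightarrow>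
   nat_from_to (\<beta> \<star> id_nt F) (G \<odot> F) (G' \<odot> F)"
  by (rule hcomp_nat[OF id_nt_nat])

lemma whisker_left_Cmp:
  assumes a: "nat_from_to \<alpha> F F'" and F: "functor_from_to F A B" and G: "functor_from_to G B C"
    and x: "x \<in> Ob A"
  shows "Cmp (id_nt G \<star> \<alpha>) x = FA G (Cmp \<alpha> x)"
proof -
  have F': "functor_from_to F' A B" using nat_functors[OF a] functor_categories[OF F] by auto
  show ?thesis
    using functor_hom[OF G nat_hom[OF a F x]] x functor_categories[OF F] functor_categories[OF G]
      nat_functors(3,4)[OF a] functor_ob[OF F' x]
    by (simp add: hcomp_def Comp_Id_left)
qed

lemma whisker_right_Cmp:
  assumes F: "functor_from_to F A B" and b: "nat_from_to \<beta> G G'" and G: "functor_from_to G B C"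
    and x: "x \<in> Ob A"
  shows "Cmp (\<beta> \<star> id_nt F) x = Cmp \<beta> (FO F x)"
  using nat_hom[OF b G functor_ob[OF F x]] x functor_categories[OF F] functor_categories[OF G]
    nat_functors(3,4)[OF b] functor_Id[OF G functor_ob[OF F x]] functor_ob[OF F x]
  by (simp add: hcomp_def Comp_Id_right)

lemma vcomp_Cmp:
  "nat_from_to \<alpha> F G \<Longrightarrow> functor_from_to F A B \<Longrightarrow> x \<in> Ob A \<Longrightarrow>
   Cmp (\<beta> \<bullet> \<alpha>) x = Comp B (Cmp \<beta> x) (Cmp \<alpha> x)"
  by (auto simp: vcomp_def nat_from_to_def functor_from_to_def)

lemma nat_iso_iff_components:
  assumes a: "nat_from_to \<alpha> F G" and F: "functor_from_to F A B"
  shows "nat_iso \<alpha> \<longleftrightarrow> (\<forall>x\<in>Ob A. is_iso B (Cmp \<alpha> x))"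
proof
  have G: "functor_from_to G A B" using nat_functors[OF a] functor_categories[OF F] by auto
  note S = functor_categories[OF F] functor_categories[OF G] nat_functors(3,4)[OF a]
  {
    assume "nat_iso \<alpha>"
    then obtain \<beta> where b: "nat_from_to \<beta> G F" "\<beta> \<bullet> \<alpha> = id_nt F" "\<alpha> \<bullet> \<beta> = id_nt G"
      using S by (auto simp: nat_iso_def)
    show "\<forall>x\<in>Ob A. is_iso B (Cmp \<alpha> x)"
    proof
      fix x assume x: "x \<in> Ob A"
      have "Comp B (Cmp \<beta> x) (Cmp \<alpha> x) = Id B (FO F x)"
        using vcomp_Cmp[OF a F x, of \<beta>] b(2) x S by simp
      moreover have "Comp B (Cmp \<alpha> x) (Cmp \<beta> x) = Id B (FO G x)"
        using vcomp_Cmp[OF b(1) G x, of \<alpha>] b(3) x S by simp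
      ultimately show "is_iso B (Cmp \<alpha> x)"
        using is_iso_iff[OF nat_hom[OF a F x]] nat_hom[OF b(1) G x] by blast
    qed
  }
  assume iso: "\<forall>x\<in>Ob A. is_iso B (Cmp \<alpha> x)"
  define b where "b x = (SOME g. g \<in> hom B (FO G x) (FO F x) \<and>
      Comp B g (Cmp \<alpha> x) = Id B (FO F x) \<and> Comp B (Cmp \<alpha> x) g = Id B (FO G x))" for x
  have b: "b x \<in> hom B (FO G x) (FO F x)" "Comp B (b x) (Cmp \<alpha> x) = Id B (FO F x)"
    "Comp B (Cmp \<alpha> x) (b x) = Id B (FO G x)" if "x \<in> Ob A" for x
  proof -
    have "\<exists>g. g \<in> hom B (FO G x) (FO F x) \<and>
      Comp B g (Cmp \<alpha> x) = Id B (FO F x) \<and> Comp B (Cmp \<alpha> x) g = Id B (FO G x)"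
      using iso that is_iso_iff[OF nat_hom[OF a F that]] by blast
    from someI_ex[OF this] show "b x \<in> hom B (FO G x) (FO F x)"
      "Comp B (b x) (Cmp \<alpha> x) = Id B (FO F x)" "Comp B (Cmp \<alpha> x) (b x) = Id B (FO G x)"
      by (auto simp: b_def)
  qed
  define \<beta> where "\<beta> = \<lparr>NS = G, NT = F, Cmp = (\<lambda>x\<in>Ob A. b x)\<rparr>"
  have \<beta>: "nat_from_to \<beta> G F"
  proof (rule natI[OF G F])
    fix f x y assume f: "f \<in> hom A x y" and x: "x \<in> Ob A" and y: "y \<in> Ob A"
    note h = nat_hom[OF a F x] nat_hom[OF a F y] functor_hom[OF F f] functor_hom[OF G f] b(1)[OF x]
      b(1)[OF y]
    have "Comp B (b y) (FA G f) = Comp B (b y) (Comp B (FA G f) (Comp B (Cmp \<alpha> x) (b x)))"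
      using h b(3)[OF x] by (simp add: Comp_Id_right[OF S(2)])
    also have "\<dots> = Comp B (b y) (Comp B (Comp B (FA G f) (Cmp \<alpha> x)) (b x))"
      using h by (simp add: Comp_assoc[OF S(2)])
    also have "\<dots> = Comp B (b y) (Comp B (Comp B (Cmp \<alpha> y) (FA F f)) (b x))"
      using nat_natural[OF a F f] by simp
    also have "\<dots> = Comp B (b y) (Comp B (Cmp \<alpha> y) (Comp B (FA F f) (b x)))"
      using h by (simp add: Comp_assoc[OF S(2)])
    also have "\<dots> = Comp B (Comp B (b y) (Cmp \<alpha> y)) (Comp B (FA F f) (b x))"
      using h Comp_hom[OF S(2) h(5) h(3)] by (simp add: Comp_assoc[OF S(2)])
    also have "\<dots> = Comp B (FA F f) (b x)"
      using h Comp_hom[OF S(2) h(5) h(3)] b(2)[OF y] by (simp add: Comp_Id_left[OF S(2)])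
    finally show "Comp B (Cmp \<beta> y) (FA G f) = Comp B (FA F f) (Cmp \<beta> x)"
      using x y by (simp add: \<beta>_def)
  qed (auto simp: \<beta>_def b)
  have "\<beta> \<bullet> \<alpha> = id_nt F"
    by (rule nt_eqI[OF vcomp_nat[OF a \<beta>] id_nt_nat[OF F] F])
      (use vcomp_Cmp[OF a F, of _ \<beta>] b S in \<open>auto simp: \<beta>_def\<close>)
  moreover have "\<alpha> \<bullet> \<beta> = id_nt G"
    by (rule nt_eqI[OF vcomp_nat[OF \<beta> a] id_nt_nat[OF G] G])
      (use vcomp_Cmp[OF \<beta> G, of _ \<alpha>] b S in \<open>auto simp: \<beta>_def\<close>)
  ultimately show "nat_iso \<alpha>" using a \<beta> S by (auto simp: nat_iso_def)
qed

section \<open>Opposite categories\<close>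

definition op_cat :: "('o, 'a) cat \<Rightarrow> ('o, 'a) cat" where
  "op_cat C = \<lparr>Ob = Ob C, Ar = Ar C, Dom = Cod C, Cod = Dom C, Id = Id C,
     Comp = (\<lambda>g f. Comp C f g)\<rparr>"

definition op_fctr :: "('o1, 'a1, 'o2, 'a2) fctr \<Rightarrow> ('o1, 'a1, 'o2, 'a2) fctr" where
  "op_fctr F = \<lparr>Src = op_cat (Src F), Tgt = op_cat (Tgt F), FO = FO F, FA = FA F\<rparr>"

definition op_nt :: "('o1, 'a1, 'o2, 'a2) nt \<Rightarrow> ('o1, 'a1, 'o2, 'a2) nt" where
  "op_nt \<alpha> = \<lparr>NS = op_fctr (NT \<alpha>), NT = op_fctr (NS \<alpha>), Cmp = Cmp \<alpha>\<rparr>"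

lemma op_cat_simps [simp]:
  "Ob (op_cat C) = Ob C" "Ar (op_cat C) = Ar C" "Dom (op_cat C) = Cod C" "Cod (op_cat C) = Dom C"
  "Id (op_cat C) = Id C" "Comp (op_cat C) g f = Comp C f g" "hom (op_cat C) x y = hom C y x"
  by (auto simp: op_cat_def hom_def)

lemma op_fctr_simps [simp]:
  "Src (op_fctr F) = op_cat (Src F)" "Tgt (op_fctr F) = op_cat (Tgt F)"
  "FO (op_fctr F) = FO F" "FA (op_fctr F) = FA F"
  by (auto simp: op_fctr_def)

lemma op_nt_simps [simp]:
  "NS (op_nt \<alpha>) = op_fctr (NT \<alpha>)" "NT (op_nt \<alpha>) = op_fctr (NS \<alpha>)" "Cmp (op_nt \<alpha>) = Cmp \<alpha>"
  by (auto simp: op_nt_def)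

lemma op_op [simp]:
  fixes C :: "('o, 'a) cat" and F :: "('o1, 'a1, 'o2, 'a2) fctr" and \<alpha> :: "('o1, 'a1, 'o2, 'a2) nt"
  shows "op_cat (op_cat C) = C" "op_fctr (op_fctr F) = F" "op_nt (op_nt \<alpha>) = \<alpha>"
proof -
  show c: "op_cat (op_cat C) = C" for C :: "('p, 'b) cat" by (simp add: op_cat_def)
  show f: "op_fctr (op_fctr F) = F" for F :: "('o1, 'a1, 'o2, 'a2) fctr"
    unfolding op_fctr_def using c by (auto simp: op_cat_def)
  show "op_nt (op_nt \<alpha>) = \<alpha>" by (rule nt.equality) (auto simp: f)
qed

lemma op_category: "category C \<Longrightarrow> category (op_cat C)"
  unfolding category_def by auto

lemma op_functor:
  assumes F: "functor_from_to F A B"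
  shows "functor_from_to (op_fctr F) (op_cat A) (op_cat B)"
proof (rule functorI)
  note S = functor_categories[OF F]
  show "category (op_cat A)" "category (op_cat B)" using S op_category by blast+
  show "FA (op_fctr F) (Comp (op_cat A) g f) = Comp (op_cat B) (FA (op_fctr F) g) (FA (op_fctr F) f)"
    if "f \<in> Ar (op_cat A)" "g \<in> Ar (op_cat A)" "Cod (op_cat A) f = Dom (op_cat A) g" for f g
    using functor_Comp[OF F, of g _ "Dom A f" f] that by (simp add: hom_def)
  show "FO (op_fctr F) \<in> extensional (Ob (op_cat A))" "FA (op_fctr F) \<in> extensional (Ar (op_cat A))"
    using functor_extensional[OF F] by simp_all
qed (use functor_categories[OF F] functor_ob[OF F] functor_hom[OF F Ar_hom] functor_Id[OF F] in auto)

lemma op_nat: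
  assumes a: "nat_from_to \<alpha> F G"
  shows "nat_from_to (op_nt \<alpha>) (op_fctr G) (op_fctr F)"
proof (rule natI)
  define A B where "A = Src F" and "B = Tgt F"
  have F: "functor_from_to F A B" and G: "functor_from_to G A B"
    using nat_functors[OF a] by (auto simp: A_def B_def)
  show "functor_from_to (op_fctr G) (op_cat A) (op_cat B)"
    "functor_from_to (op_fctr F) (op_cat A) (op_cat B)"
    using op_functor F G by blast+
  show "Cmp (op_nt \<alpha>) \<in> extensional (Ob (op_cat A))"
    using nat_extensional[OF a F] by simp
  show "Cmp (op_nt \<alpha>) x \<in> hom (op_cat B) (FO (op_fctr G) x) (FO (op_fctr F) x)"
    if "x \<in> Ob (op_cat A)" for x
    using nat_hom[OF a F] that by simp
  show "Comp (op_cat B) (Cmp (op_nt \<alpha>) y) (FA (op_fctr G) f)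
      = Comp (op_cat B) (FA (op_fctr F) f) (Cmp (op_nt \<alpha>) x)"
    if "f \<in> hom (op_cat A) x y" for f x y
    using nat_natural[OF a F, of f y x] that by simp
qed (use nat_functors[OF a] in simp_all)

lemma op_id_fctr: "op_fctr (id_fctr C) = id_fctr (op_cat C)"
  by (auto simp: op_fctr_def id_fctr_def)

lemma op_comp_fctr: "op_fctr (G \<odot> F) = op_fctr G \<odot> op_fctr F"
  by (auto simp: op_fctr_def comp_fctr_def)

lemma op_id_nt: "op_nt (id_nt F) = id_nt (op_fctr F)"
  by (auto simp: op_nt_def id_nt_def)

lemma op_vcomp:
  "nat_from_to \<alpha> F G \<Longrightarrow> nat_from_to \<beta> G H \<Longrightarrow> op_nt (\<beta> \<bullet> \<alpha>) = op_nt \<alpha> \<bullet> op_nt \<beta>"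
  by (auto simp: op_nt_def vcomp_def nat_from_to_def)

text \<open>The horizontal composite is defined through one of the two paths around a naturality square;
  passing to opposites exchanges the paths.\<close>

lemma op_hcomp:
  assumes a: "nat_from_to \<alpha> F F'" and F: "functor_from_to F A B"
    and b: "nat_from_to \<beta> G G'" and G: "functor_from_to G B C"
  shows "op_nt (\<beta> \<star> \<alpha>) = op_nt \<beta> \<star> op_nt \<alpha>"
proof -
  have F': "functor_from_to F' A B" and G': "functor_from_to G' B C"
    using nat_functors[OF a] nat_functors[OF b] functor_categories[OF F] functor_categories[OF G]
    by auto
  show ?thesis
    using nat_natural[OF b G nat_hom[OF a F]] functor_categories[OF F] functor_categories[OF G]
      functor_categories[OF F'] functor_categories[OF G'] nat_functors(3,4)[OF a]
      nat_functors(3,4)[OF b]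
    by (auto simp: op_nt_def hcomp_def op_comp_fctr intro!: ext)
qed

lemma op_is_iso: "f \<in> Ar C \<Longrightarrow> is_iso (op_cat C) f \<longleftrightarrow> is_iso C f"
  by (auto simp: is_iso_def)

section \<open>Universal arrows and adjunctions\<close>

definition universal_arrow ::
  "('o1, 'a1, 'o2, 'a2) fctr \<Rightarrow> 'o2 \<Rightarrow> 'o1 \<Rightarrow> 'a2 \<Rightarrow> bool" where
  "universal_arrow R X Y t \<longleftrightarrow> Y \<in> Ob (Src R) \<and> t \<in> hom (Tgt R) X (FO R Y) \<and>
     (\<forall>Z\<in>Ob (Src R). \<forall>g\<in>hom (Tgt R) X (FO R Z).
        \<exists>!h. h \<in> hom (Src R) Y Z \<and> Comp (Tgt R) (FA R h) t = g)"

definition couniversal_arrow ::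
  "('o1, 'a1, 'o2, 'a2) fctr \<Rightarrow> 'o2 \<Rightarrow> 'o1 \<Rightarrow> 'a2 \<Rightarrow> bool" where
  "couniversal_arrow L X Y t \<longleftrightarrow> Y \<in> Ob (Src L) \<and> t \<in> hom (Tgt L) (FO L Y) X \<and>
     (\<forall>Z\<in>Ob (Src L). \<forall>g\<in>hom (Tgt L) (FO L Z) X.
        \<exists>!h. h \<in> hom (Src L) Z Y \<and> Comp (Tgt L) t (FA L h) = g)"

lemma couniversal_arrow_op: "couniversal_arrow L X Y t \<longleftrightarrow> universal_arrow (op_fctr L) X Y t"
  by (simp add: couniversal_arrow_def universal_arrow_def)

lemma universal_arrowD:
  assumes "universal_arrow R X Y t" "functor_from_to R B A"
  shows "Y \<in> Ob B" "t \<in> hom A X (FO R Y)" "X \<in> Ob A"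
  using assms hom_objects(1)[OF functor_categories(2)[OF assms(2)]]
  by (auto simp: universal_arrow_def functor_from_to_def)

lemma universal_arrow_factor:
  assumes "universal_arrow R X Y t" "functor_from_to R B A" "Z \<in> Ob B" "g \<in> hom A X (FO R Z)"
  obtains h where "h \<in> hom B Y Z" "Comp A (FA R h) t = g"
  using assms unfolding universal_arrow_def functor_categories(3,4)[OF assms(2)] by blast

lemma universal_arrow_eq:
  assumes "universal_arrow R X Y t" and R: "functor_from_to R B A"
    and h: "h \<in> hom B Y Z" and "h' \<in> hom B Y Z" "Comp A (FA R h) t = Comp A (FA R h') t"
  shows "h = h'"
proof -
  have "Comp A (FA R h') t \<in> hom A X (FO R Z)" "Z \<in> Ob B"
    using Comp_hom[OF functor_categories(2)[OF R] universal_arrowD(2)[OF assms(1) R]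
        functor_hom[OF R assms(4)]] hom_objects(2)[OF functor_categories(1)[OF R] h] by auto
  then have "\<exists>!k. k \<in> hom B Y Z \<and> Comp A (FA R k) t = Comp A (FA R h') t"
    using assms(1) R by (auto simp: universal_arrow_def functor_from_to_def)
  then show ?thesis using assms by blast
qed

text \<open>Universal arrows from \<open>X\<close> are unique up to a unique isomorphism, and every isomorphism occurs: this
  turns the invertibility of a comparison morphism into the universality of an arrow.\<close>

lemma universal_arrow_iso:
  assumes t: "universal_arrow R X Y t" and R: "functor_from_to R B A" and f: "f \<in> hom B Y Z"
  shows "universal_arrow R X Z (Comp A (FA R f) t) \<longleftrightarrow> is_iso B f"
proof
  note B = functor_categories(1)[OF R] and A = functor_categories(2)[OF R]
  note Y = universal_arrowD[OF t R]
  have Z: "Z \<in> Ob B" using hom_objects[OF B f] by simp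
  {
    assume u: "universal_arrow R X Z (Comp A (FA R f) t)"
    note ft = universal_arrowD[OF u R]
    obtain g where g: "g \<in> hom B Z Y" "Comp A (FA R g) (Comp A (FA R f) t) = t"
      using universal_arrow_factor[OF u R Y(1) Y(2)] .
    note gf = Comp_hom[OF B f g(1)] and fg = Comp_hom[OF B g(1) f]
    have "Comp B g f = Id B Y"
      by (rule universal_arrow_eq[OF t R gf Id_hom[OF B Y(1)]])
        (use g functor_Comp[OF R f g(1)] functor_Id[OF R Y(1)]
          Comp_assoc[OF A Y(2) functor_hom[OF R f] functor_hom[OF R g(1)]]
          Comp_Id_left[OF A Y(2)] in simp)
    moreover have "Comp B f g = Id B Z"
      by (rule universal_arrow_eq[OF u R fg Id_hom[OF B Z]])
        (use g functor_Comp[OF R g(1) f] functor_Id[OF R Z]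
          Comp_assoc[OF A ft(2) functor_hom[OF R g(1)] functor_hom[OF R f]]
          Comp_Id_left[OF A ft(2)] in simp)
    ultimately show "is_iso B f" using is_iso_iff[OF f] g(1) by blast
  }
  assume "is_iso B f"
  then obtain g where g: "g \<in> hom B Z Y" "Comp B g f = Id B Y" "Comp B f g = Id B Z"
    using is_iso_iff[OF f] by blast
  show "universal_arrow R X Z (Comp A (FA R f) t)"
    unfolding universal_arrow_def functor_categories(3,4)[OF R]
  proof (intro conjI ballI Z)
    show "Comp A (FA R f) t \<in> hom A X (FO R Z)" by (rule Comp_hom[OF A Y(2) functor_hom[OF R f]])
    fix W k assume W: "W \<in> Ob B" and k: "k \<in> hom A X (FO R W)"
    have as: "Comp A (FA R h) (Comp A (FA R f) t) = Comp A (FA R (Comp B h f)) t"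
      if "h \<in> hom B Z W" for h
      using Comp_assoc[OF A Y(2) functor_hom[OF R f] functor_hom[OF R that]]
        functor_Comp[OF R f that] by simp
    obtain h where h: "h \<in> hom B Y W" "Comp A (FA R h) t = k"
      using universal_arrow_factor[OF t R W k] .
    have hg: "Comp B h g \<in> hom B Z W" by (rule Comp_hom[OF B g(1) h(1)])
    have "Comp B (Comp B h g) f = h"
      using Comp_assoc[OF B f g(1) h(1)] g(2) Comp_Id_right[OF B h(1)] by simp
    then have 1: "Comp A (FA R (Comp B h g)) (Comp A (FA R f) t) = k" using as[OF hg] h by simp
    have 2: "h' = Comp B h g"
      if "h' \<in> hom B Z W \<and> Comp A (FA R h') (Comp A (FA R f) t) = k" for h'
    proof -
      have h': "h' \<in> hom B Z W" using that by simp
      have "Comp B h' f = h"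
        by (rule universal_arrow_eq[OF t R Comp_hom[OF B f h'] h(1)])
          (use that as[OF h'] h(2) in simp)
      then show ?thesis using Comp_assoc[OF B g(1) f h'] g(3) Comp_Id_right[OF B h'] by simp
    qed
    show "\<exists>!h. h \<in> hom B Z W \<and> Comp A (FA R h) (Comp A (FA R f) t) = k"
      using hg 1 2 by blast
  qed
qed

lemma adjunction_functors:
  assumes "adjunction L R \<eta> \<epsilon>" "functor_from_to R B A"
  shows "functor_from_to L A B" "nat_from_to \<eta> (id_fctr A) (R \<odot> L)"
    "nat_from_to \<epsilon> (L \<odot> R) (id_fctr B)"
  using assms by (auto simp: adjunction_def functor_from_to_def)

lemma adjunction_functor_right:
  "adjunction L R \<eta> \<epsilon> \<Longrightarrow> functor_from_to L A B \<Longrightarrow> functor_from_to R B A"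
  by (auto simp: adjunction_def functor_from_to_def)

lemma adjunction_components:
  assumes a: "adjunction L R \<eta> \<epsilon>" and R: "functor_from_to R B A"
  shows "X \<in> Ob A \<Longrightarrow> Cmp \<eta> X \<in> hom A X (FO R (FO L X))"
    "Y \<in> Ob B \<Longrightarrow> Cmp \<epsilon> Y \<in> hom B (FO L (FO R Y)) Y"
    "f \<in> hom A X X' \<Longrightarrow> Comp A (Cmp \<eta> X') f = Comp A (FA R (FA L f)) (Cmp \<eta> X)"
    "g \<in> hom B Y Y' \<Longrightarrow> Comp B (Cmp \<epsilon> Y') (FA L (FA R g)) = Comp B g (Cmp \<epsilon> Y)"
    "X \<in> Ob A \<Longrightarrow> Comp B (Cmp \<epsilon> (FO L X)) (FA L (Cmp \<eta> X)) = Id B (FO L X)"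
    "Y \<in> Ob B \<Longrightarrow> Comp A (FA R (Cmp \<epsilon> Y)) (Cmp \<eta> (FO R Y)) = Id A (FO R Y)"
proof -
  note L = adjunction_functors(1)[OF a R] and e = adjunction_functors(2)[OF a R]
    and c = adjunction_functors(3)[OF a R]
  note S = functor_categories[OF L] functor_categories[OF R]
  have iA: "functor_from_to (id_fctr A) A A" and iB: "functor_from_to (id_fctr B) B B"
    using S by (auto intro: id_fctr_functor)
  note LR = comp_functor[OF R L] and RL = comp_functor[OF L R]
  show "Cmp \<eta> X \<in> hom A X (FO R (FO L X))" if "X \<in> Ob A"
    using nat_hom[OF e iA that] that S by simp
  show "Cmp \<epsilon> Y \<in> hom B (FO L (FO R Y)) Y" if "Y \<in> Ob B"
    using nat_hom[OF c LR that] that S by simp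
  show "Comp A (Cmp \<eta> X') f = Comp A (FA R (FA L f)) (Cmp \<eta> X)" if "f \<in> hom A X X'"
    using nat_natural[OF e iA that] homD(1)[OF that] S by simp
  show "Comp B (Cmp \<epsilon> Y') (FA L (FA R g)) = Comp B g (Cmp \<epsilon> Y)" if "g \<in> hom B Y Y'"
    using nat_natural[OF c LR that] homD(1)[OF that] S by simp
  have ile: "nat_from_to (id_nt L \<star> \<eta>) L (L \<odot> R \<odot> L)"
    using whisker_left_nat[OF e iA L] by (simp add: comp_id_fctr[OF L])
  have er: "nat_from_to (\<eta> \<star> id_nt R) R ((R \<odot> L) \<odot> R)"
    using whisker_right_nat[OF R e iA] by (simp add: comp_id_fctr[OF R])
  show "Comp B (Cmp \<epsilon> (FO L X)) (FA L (Cmp \<eta> X)) = Id B (FO L X)" if "X \<in> Ob A"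
  proof -
    have "Cmp ((\<epsilon> \<star> id_nt L) \<bullet> (id_nt L \<star> \<eta>)) X = Cmp (id_nt L) X"
      using a by (simp add: adjunction_def)
    then show ?thesis
      by (simp add: vcomp_Cmp[OF ile L that] whisker_left_Cmp[OF e iA L that]
          whisker_right_Cmp[OF L c LR that] that S)
  qed
  show "Comp A (FA R (Cmp \<epsilon> Y)) (Cmp \<eta> (FO R Y)) = Id A (FO R Y)" if "Y \<in> Ob B"
  proof -
    have "Cmp ((id_nt R \<star> \<epsilon>) \<bullet> (\<eta> \<star> id_nt R)) Y = Cmp (id_nt R) Y"
      using a by (simp add: adjunction_def)
    then show ?thesis
      by (simp add: vcomp_Cmp[OF er R that] whisker_left_Cmp[OF c LR R that]
          whisker_right_Cmp[OF R e iA that] that S)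
  qed
qed

lemma unit_universal:
  assumes a: "adjunction L R \<eta> \<epsilon>" and R: "functor_from_to R B A" and X: "X \<in> Ob A"
  shows "universal_arrow R X (FO L X) (Cmp \<eta> X)"
proof -
  note L = adjunction_functors(1)[OF a R]
  note B = functor_categories(1)[OF R] and A = functor_categories(2)[OF R]
  note K = adjunction_components[OF a R]
  show ?thesis
    unfolding universal_arrow_def functor_categories(3,4)[OF R]
  proof (intro conjI ballI functor_ob[OF L X] K(1)[OF X])
    fix Z g assume Z: "Z \<in> Ob B" and g: "g \<in> hom A X (FO R Z)"
    let ?h = "Comp B (Cmp \<epsilon> Z) (FA L g)"
    have h: "?h \<in> hom B (FO L X) Z" by (rule Comp_hom[OF B functor_hom[OF L g] K(2)[OF Z]])
    have "Comp A (FA R ?h) (Cmp \<eta> X)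
        = Comp A (FA R (Cmp \<epsilon> Z)) (Comp A (FA R (FA L g)) (Cmp \<eta> X))"
      using functor_Comp[OF R functor_hom[OF L g] K(2)[OF Z]]
        Comp_assoc[OF A K(1)[OF X] functor_hom[OF R functor_hom[OF L g]]
          functor_hom[OF R K(2)[OF Z]]] by simp
    also have "\<dots> = Comp A (Comp A (FA R (Cmp \<epsilon> Z)) (Cmp \<eta> (FO R Z))) g"
      using K(3)[OF g] Comp_assoc[OF A g K(1)[OF functor_ob[OF R Z]]
          functor_hom[OF R K(2)[OF Z]]] by simp
    also have "\<dots> = g" using K(6)[OF Z] Comp_Id_left[OF A g] by simp
    finally have 1: "Comp A (FA R ?h) (Cmp \<eta> X) = g" .
    have 2: "k = ?h" if "k \<in> hom B (FO L X) Z \<and> Comp A (FA R k) (Cmp \<eta> X) = g" for k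
    proof -
      have k: "k \<in> hom B (FO L X) Z" and g': "g = Comp A (FA R k) (Cmp \<eta> X)" using that by auto
      have "?h = Comp B (Comp B (Cmp \<epsilon> Z) (FA L (FA R k))) (FA L (Cmp \<eta> X))"
        unfolding g' using functor_Comp[OF L K(1)[OF X] functor_hom[OF R k]]
          Comp_assoc[OF B functor_hom[OF L K(1)[OF X]] functor_hom[OF L functor_hom[OF R k]]
            K(2)[OF Z]] by simp
      also have "\<dots> = Comp B k (Comp B (Cmp \<epsilon> (FO L X)) (FA L (Cmp \<eta> X)))"
        using K(4)[OF k] Comp_assoc[OF B functor_hom[OF L K(1)[OF X]]
            K(2)[OF functor_ob[OF L X]] k] by simp
      also have "\<dots> = k" using K(5)[OF X] Comp_Id_right[OF B k] by simp
      finally show ?thesis ..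
    qed
    show "\<exists>!h. h \<in> hom B (FO L X) Z \<and> Comp A (FA R h) (Cmp \<eta> X) = g"
      using h 1 2 by blast
  qed
qed

lemma op_adjunction:
  assumes a: "adjunction L R \<eta> \<epsilon>"
  shows "adjunction (op_fctr R) (op_fctr L) (op_nt \<epsilon>) (op_nt \<eta>)"
proof -
  define A B where "A = Src L" and "B = Tgt L"
  have L: "functor_from_to L A B" and R: "functor_from_to R B A"
    and t: "(\<epsilon> \<star> id_nt L) \<bullet> (id_nt L \<star> \<eta>) = id_nt L" "(id_nt R \<star> \<epsilon>) \<bullet> (\<eta> \<star> id_nt R) = id_nt R"
    using a by (auto simp: adjunction_def A_def B_def)
  note e = adjunction_functors(2)[OF a R] and c = adjunction_functors(3)[OF a R]
  have iA: "functor_from_to (id_fctr A) A A" and iB: "functor_from_to (id_fctr B) B B"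
    using functor_categories[OF L] by (auto intro: id_fctr_functor)
  note LR = comp_functor[OF R L] and RL = comp_functor[OF L R]
  have *: "nat_from_to (id_nt L \<star> \<eta>) L (L \<odot> R \<odot> L)" "nat_from_to (\<epsilon> \<star> id_nt L) (L \<odot> R \<odot> L) L"
    "nat_from_to (\<eta> \<star> id_nt R) R (R \<odot> L \<odot> R)" "nat_from_to (id_nt R \<star> \<epsilon>) (R \<odot> L \<odot> R) R"
    using whisker_left_nat[OF e iA L] whisker_right_nat[OF R e iA] whisker_left_nat[OF c LR R]
      whisker_right_nat[OF L c LR]
    by (simp_all add: comp_id_fctr[OF R] comp_id_fctr[OF L] comp_fctr_assoc[OF L R L]
        comp_fctr_assoc[OF R L R])
  have "(op_nt \<eta> \<star> id_nt (op_fctr R)) \<bullet> (id_nt (op_fctr R) \<star> op_nt \<epsilon>) = id_nt (op_fctr R)"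
    using arg_cong[OF t(2), of op_nt] op_vcomp[OF *(3,4)] op_hcomp[OF c LR id_nt_nat[OF R] R]
      op_hcomp[OF id_nt_nat[OF R] R e iA] by (simp add: op_id_nt)
  moreover have "(id_nt (op_fctr L) \<star> op_nt \<eta>) \<bullet> (op_nt \<epsilon> \<star> id_nt (op_fctr L)) = id_nt (op_fctr L)"
    using arg_cong[OF t(1), of op_nt] op_vcomp[OF *(1,2)] op_hcomp[OF e iA id_nt_nat[OF L] L]
      op_hcomp[OF id_nt_nat[OF L] L c LR] by (simp add: op_id_nt)
  ultimately show ?thesis
    using op_functor[OF L] op_functor[OF R] op_nat[OF e] op_nat[OF c] functor_categories[OF L]
      functor_categories[OF R]
    by (simp add: adjunction_def op_id_fctr op_comp_fctr)
qed

text \<open>A morphism into the value of a right adjoint is universal precisely if its transpose is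
  invertible: the transpose compares it with the unit, which is universal.\<close>

lemma transpose_iso_iff_universal:
  assumes a: "adjunction L R \<eta> \<epsilon>" and R: "functor_from_to R B A"
    and Y: "Y \<in> Ob B" and t: "t \<in> hom A X (FO R Y)"
  shows "is_iso B (Comp B (Cmp \<epsilon> Y) (FA L t)) \<longleftrightarrow> universal_arrow R X Y t"
proof -
  note L = adjunction_functors(1)[OF a R]
  note B = functor_categories(1)[OF R] and A = functor_categories(2)[OF R]
  note K = adjunction_components[OF a R]
  have X: "X \<in> Ob A" using hom_objects[OF A t] by simp
  let ?h = "Comp B (Cmp \<epsilon> Y) (FA L t)"
  have h: "?h \<in> hom B (FO L X) Y" by (rule Comp_hom[OF B functor_hom[OF L t] K(2)[OF Y]])
  have "Comp A (FA R ?h) (Cmp \<eta> X)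
      = Comp A (FA R (Cmp \<epsilon> Y)) (Comp A (FA R (FA L t)) (Cmp \<eta> X))"
    using functor_Comp[OF R functor_hom[OF L t] K(2)[OF Y]]
      Comp_assoc[OF A K(1)[OF X] functor_hom[OF R functor_hom[OF L t]]
        functor_hom[OF R K(2)[OF Y]]] by simp
  also have "\<dots> = Comp A (Comp A (FA R (Cmp \<epsilon> Y)) (Cmp \<eta> (FO R Y))) t"
    using K(3)[OF t] Comp_assoc[OF A t K(1)[OF functor_ob[OF R Y]]
        functor_hom[OF R K(2)[OF Y]]] by simp
  also have "\<dots> = t" using K(6)[OF Y] Comp_Id_left[OF A t] by simp
  finally show ?thesis
    using universal_arrow_iso[OF unit_universal[OF a R X] R h] by simp
qed

section \<open>Beck--Chevalley transformations and universal arrows\<close>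

lemma functor_is_iso:
  assumes F: "functor_from_to F A B" and f: "f \<in> hom A x y" and iso: "is_iso A f"
  shows "is_iso B (FA F f)"
proof -
  obtain g where g: "g \<in> hom A y x" "Comp A g f = Id A x" "Comp A f g = Id A y"
    using iso is_iso_iff[OF f] by blast
  note xy = hom_objects[OF functor_categories(1)[OF F] f]
  have "Comp B (FA F g) (FA F f) = Id B (FO F x)" "Comp B (FA F f) (FA F g) = Id B (FO F y)"
    using functor_Comp[OF F f g(1)] functor_Comp[OF F g(1) f] g functor_Id[OF F] xy by simp_all
  then show ?thesis using is_iso_iff[OF functor_hom[OF F f]] functor_hom[OF F g(1)] by blast
qed

text \<open>Let \<open>a : V R2 \<rightarrow> R1 W\<close>. The morphism on the right is \<open>V X \<rightarrow> V R2 Y \<rightarrow> R1 W Y\<close>, the image of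
  \<open>t : X \<rightarrow> R2 Y\<close> under the square.\<close>

definition preserves_universal where
  "preserves_universal V R1 R2 W a \<longleftrightarrow> (\<forall>X Y t. universal_arrow R2 X Y t \<longrightarrow>
     universal_arrow R1 (FO V X) (FO W Y) (Comp (Tgt R1) (Cmp a Y) (FA V t)))"

text \<open>Here \<open>a : L1 W \<rightarrow> V L2\<close>, and \<open>t : L2 Y \<rightarrow> X\<close> is sent to \<open>L1 W Y \<rightarrow> V L2 Y \<rightarrow> V X\<close>.\<close>

definition preserves_couniversal where
  "preserves_couniversal V L1 L2 W a \<longleftrightarrow> (\<forall>X Y t. couniversal_arrow L2 X Y t \<longrightarrow>
     couniversal_arrow L1 (FO V X) (FO W Y) (Comp (Tgt L1) (FA V t) (Cmp a Y)))"

lemma preserves_couniversal_op: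
  "preserves_couniversal V L1 L2 W a \<longleftrightarrow>
   preserves_universal (op_fctr V) (op_fctr L1) (op_fctr L2) (op_fctr W) (op_nt a)"
  by (simp add: preserves_couniversal_def preserves_universal_def couniversal_arrow_op)

lemma preserves_universal_op:
  "preserves_universal V R1 R2 W a \<longleftrightarrow>
   preserves_couniversal (op_fctr V) (op_fctr R1) (op_fctr R2) (op_fctr W) (op_nt a)"
  by (simp add: preserves_couniversal_op)

locale functor_square =
  fixes V :: "('o, 'a, 'o1, 'a1) fctr" and W :: "('p, 'b, 'p1, 'b1) fctr"
    and R1 :: "('p1, 'b1, 'o1, 'a1) fctr" and R2 :: "('p, 'b, 'o, 'a) fctr"
    and a :: "('p, 'b, 'o1, 'a1) nt" and A1 A2 B1 B2
  assumes V: "functor_from_to V A2 A1" and W: "functor_from_to W B2 B1"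
    and R1: "functor_from_to R1 B1 A1" and R2: "functor_from_to R2 B2 A2"
    and a: "nat_from_to a (V \<odot> R2) (R1 \<odot> W)"
begin

lemma cats: "category A1" "category A2" "category B1" "category B2"
  using V W functor_categories by blast+

lemma a_hom: "Y \<in> Ob B2 \<Longrightarrow> Cmp a Y \<in> hom A1 (FO V (FO R2 Y)) (FO R1 (FO W Y))"
  using nat_hom[OF a comp_functor[OF R2 V]] functor_categories[OF R2] functor_categories[OF W]
  by simp

lemma a_natural:
  "f \<in> hom B2 Y Y' \<Longrightarrow>
   Comp A1 (Cmp a Y') (FA V (FA R2 f)) = Comp A1 (FA R1 (FA W f)) (Cmp a Y)"
  using nat_natural[OF a comp_functor[OF R2 V]] functor_categories[OF R2] functor_categories[OF W]
  by (simp add: homD(1))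

lemma opposite_square:
  "functor_square (op_fctr R1) (op_fctr R2) (op_fctr V) (op_fctr W) (op_nt a)
     (op_cat A1) (op_cat B1) (op_cat A2) (op_cat B2)"
  by unfold_locales
    (use V W R1 R2 op_functor op_nat[OF a] in \<open>auto simp: op_comp_fctr\<close>)

lemma transport_hom:
  assumes "Y \<in> Ob B2" "t \<in> hom A2 X (FO R2 Y)"
  shows "Comp A1 (Cmp a Y) (FA V t) \<in> hom A1 (FO V X) (FO R1 (FO W Y))"
  by (rule Comp_hom[OF cats(1) functor_hom[OF V assms(2)] a_hom[OF assms(1)]])

lemma transport_Comp:
  assumes t: "t \<in> hom A2 X (FO R2 Y)" and f: "f \<in> hom B2 Y Y'"
  shows "Comp A1 (Cmp a Y') (FA V (Comp A2 (FA R2 f) t))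
    = Comp A1 (FA R1 (FA W f)) (Comp A1 (Cmp a Y) (FA V t))"
proof -
  note Y = hom_objects[OF cats(4) f]
  note h = functor_hom[OF V t] functor_hom[OF V functor_hom[OF R2 f]] a_hom[OF Y(1)] a_hom[OF Y(2)]
    functor_hom[OF R1 functor_hom[OF W f]]
  show ?thesis
    using functor_Comp[OF V t functor_hom[OF R2 f]] a_natural[OF f]
      Comp_assoc[OF cats(1) h(1,2,4)] Comp_assoc[OF cats(1) h(1,3,5)] by simp
qed

text \<open>The components of a Beck--Chevalley transformation are the transposes of the images of the
  unit, and the unit is one universal arrow among many isomorphic ones.\<close>

lemma transposes_iso_iff_preserves_universal:
  assumes L1: "adjunction L1 R1 \<eta>1 \<epsilon>1" and L2: "adjunction L2 R2 \<eta>2 \<epsilon>2"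
  shows "(\<forall>X\<in>Ob A2. is_iso B1 (Comp B1 (Cmp \<epsilon>1 (FO W (FO L2 X)))
            (FA L1 (Comp A1 (Cmp a (FO L2 X)) (FA V (Cmp \<eta>2 X))))))
    \<longleftrightarrow> preserves_universal V R1 R2 W a" (is "(\<forall>X\<in>Ob A2. ?iso X) \<longleftrightarrow> _")
proof -
  have fL2: "functor_from_to L2 A2 B2" using adjunction_functors(1)[OF L2 R2] .
  have e: "Cmp \<eta>2 X \<in> hom A2 X (FO R2 (FO L2 X))" if "X \<in> Ob A2" for X
    using adjunction_components(1)[OF L2 R2 that] .
  have iso: "?iso X \<longleftrightarrow> universal_arrow R1 (FO V X) (FO W (FO L2 X))
      (Comp A1 (Cmp a (FO L2 X)) (FA V (Cmp \<eta>2 X)))" if X: "X \<in> Ob A2" for X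
    by (rule transpose_iso_iff_universal[OF L1 R1
          functor_ob[OF W functor_ob[OF fL2 X]] transport_hom[OF functor_ob[OF fL2 X] e[OF X]]])
  show ?thesis
  proof
    assume "preserves_universal V R1 R2 W a"
    then show "\<forall>X\<in>Ob A2. ?iso X"
      using iso unit_universal[OF L2 R2] functor_categories(4)[OF R1]
      by (simp add: preserves_universal_def)
  next
    assume all: "\<forall>X\<in>Ob A2. ?iso X"
    show "preserves_universal V R1 R2 W a"
      unfolding preserves_universal_def functor_categories(4)[OF R1]
    proof (intro allI impI)
      fix X Y t assume t: "universal_arrow R2 X Y t"
      note Y = universal_arrowD[OF t R2]
      note u = unit_universal[OF L2 R2 Y(3)]
      obtain f where f: "f \<in> hom B2 (FO L2 X) Y" "Comp A2 (FA R2 f) (Cmp \<eta>2 X) = t"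
        using universal_arrow_factor[OF u R2 Y(1) Y(2)] .
      have "is_iso B2 f" using universal_arrow_iso[OF u R2 f(1)] t f(2) by simp
      then have "is_iso B1 (FA W f)" by (rule functor_is_iso[OF W f(1)])
      moreover have "universal_arrow R1 (FO V X) (FO W (FO L2 X))
          (Comp A1 (Cmp a (FO L2 X)) (FA V (Cmp \<eta>2 X)))"
        using all iso Y(3) by blast
      ultimately show "universal_arrow R1 (FO V X) (FO W Y) (Comp A1 (Cmp a Y) (FA V t))"
        using universal_arrow_iso[OF _ R1 functor_hom[OF W f(1)]] f(2)
          transport_Comp[OF e[OF Y(3)] f(1)] by simp
    qed
  qed
qed

text \<open>The passage to conjugates, one morphism at a time. Both properties say that for all \<open>X\<close> and
  \<open>Z\<close> every map \<open>V X \<rightarrow> R1 Z\<close> arises via \<open>a\<close> from exactly one map \<open>X \<rightarrow> R2 Y'\<close>, where \<open>W Y' \<rightarrow> Z\<close> is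
  couniversal: the first property factors such a map through a map \<open>W Y \<rightarrow> Z\<close>, which corresponds
  to a map \<open>Y \<rightarrow> Y'\<close> and hence to a map \<open>X \<rightarrow> R2 Y'\<close>.\<close>

lemma preserves_universal_imp_couniversal:
  assumes pu: "preserves_universal V R1 R2 W a"
    and ex: "\<And>X. X \<in> Ob A2 \<Longrightarrow> \<exists>Y t. universal_arrow R2 X Y t"
  shows "preserves_couniversal R1 V W R2 a"
  unfolding preserves_couniversal_def functor_categories(4)[OF V]
proof (intro allI impI)
  fix Z Y' e assume e: "couniversal_arrow W Z Y' e"
  have Y': "Y' \<in> Ob B2" and eh: "e \<in> hom B1 (FO W Y') Z"
    using e functor_categories[OF W] by (auto simp: couniversal_arrow_def)
  note ae = Comp_hom[OF cats(1) a_hom[OF Y'] functor_hom[OF R1 eh]]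
  show "couniversal_arrow V (FO R1 Z) (FO R2 Y') (Comp A1 (FA R1 e) (Cmp a Y'))"
    unfolding couniversal_arrow_def functor_categories(3,4)[OF V]
  proof (intro conjI ballI functor_ob[OF R2 Y'] ae)
    fix X \<phi> assume X: "X \<in> Ob A2" and \<phi>: "\<phi> \<in> hom A1 (FO V X) (FO R1 Z)"
    obtain Y t where t: "universal_arrow R2 X Y t" using ex[OF X] by blast
    note Y = universal_arrowD[OF t R2]
    define \<theta> where "\<theta> = Comp A1 (Cmp a Y) (FA V t)"
    have \<theta>: "universal_arrow R1 (FO V X) (FO W Y) \<theta>"
      using pu t functor_categories(4)[OF R1] by (simp add: preserves_universal_def \<theta>_def)
    have Z: "Z \<in> Ob B1" using hom_objects[OF cats(3) eh] by simp
    obtain g where g: "g \<in> hom B1 (FO W Y) Z" "Comp A1 (FA R1 g) \<theta> = \<phi>"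
      using universal_arrow_factor[OF \<theta> R1 Z \<phi>] .
    have ex1: "\<exists>!h. h \<in> hom B2 Y Y' \<and> Comp B1 e (FA W h) = g"
      using e Y(1) g(1) functor_categories[OF W] by (auto simp: couniversal_arrow_def)
    have key: "Comp A1 (Comp A1 (FA R1 e) (Cmp a Y')) (FA V (Comp A2 (FA R2 h) t))
        = Comp A1 (FA R1 (Comp B1 e (FA W h))) \<theta>" if h: "h \<in> hom B2 Y Y'" for h
    proof -
      note th = universal_arrowD(2)[OF \<theta> R1]
      have "Comp A1 (Comp A1 (FA R1 e) (Cmp a Y')) (FA V (Comp A2 (FA R2 h) t))
          = Comp A1 (FA R1 e) (Comp A1 (FA R1 (FA W h)) \<theta>)"
        using Comp_assoc[OF cats(1) functor_hom[OF V Comp_hom[OF cats(2) Y(2) functor_hom[OF R2 h]]]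
            a_hom[OF Y'] functor_hom[OF R1 eh]] transport_Comp[OF Y(2) h]
        by (simp add: \<theta>_def)
      then show ?thesis
        using functor_Comp[OF R1 functor_hom[OF W h] eh]
          Comp_assoc[OF cats(1) th functor_hom[OF R1 functor_hom[OF W h]] functor_hom[OF R1 eh]]
        by simp
    qed
    obtain h where h: "h \<in> hom B2 Y Y'" "Comp B1 e (FA W h) = g" using ex1 by blast
    have 1: "Comp A1 (Comp A1 (FA R1 e) (Cmp a Y')) (FA V (Comp A2 (FA R2 h) t)) = \<phi>"
      using key[OF h(1)] h(2) g(2) by simp
    have 2: "k = Comp A2 (FA R2 h) t"
      if k: "k \<in> hom A2 X (FO R2 Y') \<and> Comp A1 (Comp A1 (FA R1 e) (Cmp a Y')) (FA V k) = \<phi>" for k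
    proof -
      obtain h' where h': "h' \<in> hom B2 Y Y'" "Comp A2 (FA R2 h') t = k"
        using universal_arrow_factor[OF t R2 Y'] k by blast
      have "Comp B1 e (FA W h') = g"
        by (rule universal_arrow_eq[OF \<theta> R1 Comp_hom[OF cats(3) functor_hom[OF W h'(1)] eh] g(1)])
          (use key[OF h'(1)] h'(2) k g(2) in simp)
      then have "h' = h" using ex1 h h'(1) by blast
      then show ?thesis using h'(2) by simp
    qed
    show "\<exists>!k. k \<in> hom A2 X (FO R2 Y') \<and>
        Comp A1 (Comp A1 (FA R1 e) (Cmp a Y')) (FA V k) = \<phi>"
      using Comp_hom[OF cats(2) Y(2) functor_hom[OF R2 h(1)]] 1 2 by blast
  qed
qed

end

lemma (in functor_square) preserves_universal_iff_couniversal: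
  assumes exR: "\<And>X. X \<in> Ob A2 \<Longrightarrow> \<exists>Y t. universal_arrow R2 X Y t"
    and exW: "\<And>Z. Z \<in> Ob B1 \<Longrightarrow> \<exists>Y t. couniversal_arrow W Z Y t"
  shows "preserves_universal V R1 R2 W a \<longleftrightarrow> preserves_couniversal R1 V W R2 a"
proof
  assume "preserves_couniversal R1 V W R2 a"
  then have "preserves_couniversal (op_fctr V) (op_fctr R1) (op_fctr R2) (op_fctr W) (op_nt a)"
    using functor_square.preserves_universal_imp_couniversal[OF opposite_square] exW
    by (simp add: preserves_couniversal_op couniversal_arrow_op)
  then show "preserves_universal V R1 R2 W a" by (simp add: preserves_universal_op)
qed (use preserves_universal_imp_couniversal exR in blast)

context functor_square
begin

text \<open>The unit, \<open>a\<close> and the counit occur only whiskered, so each factor of the composite has components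
  of the form of a functor applied to one component; functoriality of \<open>L1\<close> merges the first two,
  so that the composite is the transpose of the image of the unit.\<close>

lemma beck_chevalley_left:
  assumes L1: "adjunction L1 R1 \<eta>1 \<epsilon>1" and L2: "adjunction L2 R2 \<eta>2 \<epsilon>2"
  defines "bc \<equiv> (\<epsilon>1 \<star> id_nt (W \<odot> L2)) \<bullet> (id_nt L1 \<star> a \<star> id_nt L2) \<bullet> (id_nt (L1 \<odot> V) \<star> \<eta>2)"
  shows "nat_from_to bc (L1 \<odot> V) (W \<odot> L2)"
    and "X \<in> Ob A2 \<Longrightarrow> Cmp bc X = Comp B1 (Cmp \<epsilon>1 (FO W (FO L2 X)))
            (FA L1 (Comp A1 (Cmp a (FO L2 X)) (FA V (Cmp \<eta>2 X))))"
proof -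
  note fL1 = adjunction_functors(1)[OF L1 R1] and fL2 = adjunction_functors(1)[OF L2 R2]
  note e1 = adjunction_functors(3)[OF L1 R1] and e2 = adjunction_functors(2)[OF L2 R2]
  note VR = comp_functor[OF R2 V] and RW = comp_functor[OF W R1]
  note LV = comp_functor[OF V fL1] and WL = comp_functor[OF fL2 W] and LR = comp_functor[OF R1 fL1]
    and RL = comp_functor[OF fL2 R2]
  note iA = id_fctr_functor[OF cats(2)]
  have n1: "nat_from_to (id_nt (L1 \<odot> V) \<star> \<eta>2) (L1 \<odot> V) (L1 \<odot> (V \<odot> R2) \<odot> L2)"
    using whisker_left_nat[OF e2 iA LV]
    by (simp add: comp_id_fctr[OF LV] comp_fctr_assoc[OF RL V fL1] comp_fctr_assoc[OF fL2 R2 V])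
  have aL: "nat_from_to (a \<star> id_nt L2) ((V \<odot> R2) \<odot> L2) ((R1 \<odot> W) \<odot> L2)"
    by (rule whisker_right_nat[OF fL2 a VR])
  note aLf = comp_functor[OF fL2 VR]
  have n2: "nat_from_to (id_nt L1 \<star> a \<star> id_nt L2) (L1 \<odot> (V \<odot> R2) \<odot> L2) (L1 \<odot> (R1 \<odot> W) \<odot> L2)"
    by (rule whisker_left_nat[OF aL aLf fL1])
  have n3: "nat_from_to (\<epsilon>1 \<star> id_nt (W \<odot> L2)) (L1 \<odot> (R1 \<odot> W) \<odot> L2) (W \<odot> L2)"
    using whisker_right_nat[OF WL e1 LR]
    by (simp add: comp_id_fctr[OF WL] comp_fctr_assoc[OF WL R1 fL1] comp_fctr_assoc[OF fL2 W R1])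
  show "nat_from_to bc (L1 \<odot> V) (W \<odot> L2)"
    unfolding bc_def by (rule vcomp_nat[OF vcomp_nat[OF n1 n2] n3])
  assume X: "X \<in> Ob A2"
  note LX = functor_ob[OF fL2 X]
  note h = functor_hom[OF V adjunction_components(1)[OF L2 R2 X]] a_hom[OF LX]
  have "Cmp bc X = Comp B1 (Cmp (\<epsilon>1 \<star> id_nt (W \<odot> L2)) X)
      (Comp B1 (Cmp (id_nt L1 \<star> a \<star> id_nt L2) X) (Cmp (id_nt (L1 \<odot> V) \<star> \<eta>2) X))"
    unfolding bc_def by (simp add: vcomp_Cmp[OF vcomp_nat[OF n1 n2] LV X] vcomp_Cmp[OF n1 LV X])
  also have "Cmp (\<epsilon>1 \<star> id_nt (W \<odot> L2)) X = Cmp \<epsilon>1 (FO W (FO L2 X))"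
    using whisker_right_Cmp[OF WL e1 LR X] X functor_categories[OF fL2] by simp
  also have "Cmp (id_nt L1 \<star> a \<star> id_nt L2) X = FA L1 (Cmp a (FO L2 X))"
    using whisker_left_Cmp[OF aL aLf fL1 X] whisker_right_Cmp[OF fL2 a VR X] by simp
  also have "Cmp (id_nt (L1 \<odot> V) \<star> \<eta>2) X = FA L1 (FA V (Cmp \<eta>2 X))"
    using whisker_left_Cmp[OF e2 iA LV X] adjunction_components(1)[OF L2 R2 X]
      functor_categories[OF V] by (simp add: homD(1))
  also have "Comp B1 (FA L1 (Cmp a (FO L2 X))) (FA L1 (FA V (Cmp \<eta>2 X)))
      = FA L1 (Comp A1 (Cmp a (FO L2 X)) (FA V (Cmp \<eta>2 X)))"
    using functor_Comp[OF fL1 h] by simp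
  finally show "Cmp bc X = Comp B1 (Cmp \<epsilon>1 (FO W (FO L2 X)))
      (FA L1 (Comp A1 (Cmp a (FO L2 X)) (FA V (Cmp \<eta>2 X))))" .
qed

lemma nat_iso_beck_chevalley_left:
  assumes L1: "adjunction L1 R1 \<eta>1 \<epsilon>1" and L2: "adjunction L2 R2 \<eta>2 \<epsilon>2"
  shows "nat_iso ((\<epsilon>1 \<star> id_nt (W \<odot> L2)) \<bullet> (id_nt L1 \<star> a \<star> id_nt L2) \<bullet> (id_nt (L1 \<odot> V) \<star> \<eta>2))
    \<longleftrightarrow> preserves_universal V R1 R2 W a"
  using nat_iso_iff_components[OF beck_chevalley_left(1)[OF L1 L2]
      comp_functor[OF V adjunction_functors(1)[OF L1 R1]]]
    beck_chevalley_left(2)[OF L1 L2] transposes_iso_iff_preserves_universal[OF L1 L2]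
  by simp

end

lemma nat_iso_op: "nat_iso \<alpha> \<Longrightarrow> nat_iso (op_nt \<alpha>)"
  unfolding nat_iso_def
  by (metis op_id_nt op_nat op_nt_simps(1) op_nt_simps(2) op_vcomp)

lemma nat_iso_op_iff: "nat_iso (op_nt \<alpha>) \<longleftrightarrow> nat_iso \<alpha>"
  by (metis nat_iso_op op_op(3))

lemma vcomp_assoc:
  assumes a: "nat_from_to \<alpha> F G" and b: "nat_from_to \<beta> G H" and c: "nat_from_to \<gamma> H I"
    and F: "functor_from_to F A B"
  shows "(\<gamma> \<bullet> \<beta>) \<bullet> \<alpha> = \<gamma> \<bullet> (\<beta> \<bullet> \<alpha>)"
proof (rule nt_eqI[OF vcomp_nat[OF a vcomp_nat[OF b c]] vcomp_nat[OF vcomp_nat[OF a b] c] F])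
  have G: "functor_from_to G A B" using nat_functors[OF a] functor_categories[OF F] by auto
  have H: "functor_from_to H A B" using nat_functors[OF b] functor_categories[OF G] by auto
  fix x assume x: "x \<in> Ob A"
  show "Cmp ((\<gamma> \<bullet> \<beta>) \<bullet> \<alpha>) x = Cmp (\<gamma> \<bullet> (\<beta> \<bullet> \<alpha>)) x"
    using Comp_assoc[OF functor_categories(2)[OF F] nat_hom[OF a F x] nat_hom[OF b G x]
        nat_hom[OF c H x]]
    by (simp add: vcomp_Cmp[OF a F x] vcomp_Cmp[OF vcomp_nat[OF a b] F x] vcomp_Cmp[OF b G x])
qed

text \<open>Read in the opposite categories, the transformation between right adjoints is the one between
  left adjoints.\<close>

lemma nat_iso_beck_chevalley_right:
  assumes V: "functor_from_to V A2 A1" and W: "functor_from_to W B2 B1"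
    and U1: "functor_from_to U1 B1 A1" and U2: "functor_from_to U2 B2 A2"
    and a: "nat_from_to a (U1 \<odot> W) (V \<odot> U2)"
    and R1: "adjunction U1 R1 \<eta>1 \<epsilon>1" and R2: "adjunction U2 R2 \<eta>2 \<epsilon>2"
  shows "nat_iso ((id_nt (R1 \<odot> V) \<star> \<epsilon>2) \<bullet> (id_nt R1 \<star> a \<star> id_nt R2) \<bullet> (\<eta>1 \<star> id_nt (W \<odot> R2)))
    \<longleftrightarrow> preserves_couniversal V U1 U2 W a" (is "nat_iso (?n3 \<bullet> ?n2 \<bullet> ?n1) \<longleftrightarrow> _")
proof -
  interpret op: functor_square "op_fctr V" "op_fctr W" "op_fctr U1" "op_fctr U2" "op_nt a"
    "op_cat A1" "op_cat A2" "op_cat B1" "op_cat B2"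
    by unfold_locales (use V W U1 U2 op_functor op_nat[OF a] in \<open>auto simp: op_comp_fctr\<close>)
  note fR1 = adjunction_functor_right[OF R1 U1] and fR2 = adjunction_functor_right[OF R2 U2]
  note e1 = adjunction_functors(2)[OF R1 fR1] and e2 = adjunction_functors(3)[OF R2 fR2]
  note UW = comp_functor[OF W U1] and VU = comp_functor[OF U2 V]
  note RV = comp_functor[OF V fR1] and WR = comp_functor[OF fR2 W] and UR = comp_functor[OF fR2 U2]
  note iB = id_fctr_functor[OF functor_categories(1)[OF U1]]
  have n1: "nat_from_to ?n1 (W \<odot> R2) (R1 \<odot> (U1 \<odot> W) \<odot> R2)"
    using whisker_right_nat[OF WR e1 iB]
    by (simp add: comp_id_fctr[OF WR] comp_fctr_assoc[OF WR U1 fR1] comp_fctr_assoc[OF fR2 W U1])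
  have aR: "nat_from_to (a \<star> id_nt R2) ((U1 \<odot> W) \<odot> R2) ((V \<odot> U2) \<odot> R2)"
    by (rule whisker_right_nat[OF fR2 a UW])
  note aRf = comp_functor[OF fR2 UW]
  have n2: "nat_from_to ?n2 (R1 \<odot> (U1 \<odot> W) \<odot> R2) (R1 \<odot> (V \<odot> U2) \<odot> R2)"
    by (rule whisker_left_nat[OF aR aRf fR1])
  have n3: "nat_from_to ?n3 (R1 \<odot> (V \<odot> U2) \<odot> R2) (R1 \<odot> V)"
    using whisker_left_nat[OF e2 UR RV]
    by (simp add: comp_id_fctr[OF RV] comp_fctr_assoc[OF UR V fR1] comp_fctr_assoc[OF fR2 U2 V])
  have f3: "functor_from_to (op_fctr (R1 \<odot> V)) (op_cat A2) (op_cat B1)" by (rule op_functor[OF RV])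
  have "op_nt (?n3 \<bullet> ?n2 \<bullet> ?n1) = op_nt ?n1 \<bullet> op_nt ?n2 \<bullet> op_nt ?n3"
    using op_vcomp[OF vcomp_nat[OF n1 n2] n3] op_vcomp[OF n1 n2]
      vcomp_assoc[OF op_nat[OF n3] op_nat[OF n2] op_nat[OF n1] f3] by simp
  also have "op_nt ?n1 = op_nt \<eta>1 \<star> id_nt (op_fctr W \<odot> op_fctr R2)"
    using op_hcomp[OF id_nt_nat[OF WR] WR e1 iB] by (simp add: op_id_nt op_comp_fctr)
  also have "op_nt ?n2 = id_nt (op_fctr R1) \<star> op_nt a \<star> id_nt (op_fctr R2)"
    using op_hcomp[OF aR aRf id_nt_nat[OF fR1] fR1] op_hcomp[OF id_nt_nat[OF fR2] fR2 a UW]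
    by (simp add: op_id_nt)
  also have "op_nt ?n3 = id_nt (op_fctr R1 \<odot> op_fctr V) \<star> op_nt \<epsilon>2"
    using op_hcomp[OF e2 UR id_nt_nat[OF RV] RV] by (simp add: op_id_nt op_comp_fctr)
  finally show ?thesis
    using op.nat_iso_beck_chevalley_left[OF op_adjunction[OF R1] op_adjunction[OF R2]]
      nat_iso_op_iff[of "?n3 \<bullet> ?n2 \<bullet> ?n1"] by (simp add: preserves_couniversal_op)
qed

section \<open>Prederivators\<close>

lemma sfunctorD:
  assumes "sfunctor u J K"
  shows "functor_from_to u J K" "small_cat J" "small_cat K" "category J" "category K"
    "Src u = J" "Tgt u = K"
  using assms by (auto simp: sfunctor_def small_cat_def functor_from_to_def)

lemma sfunctor_comp: "sfunctor u J K \<Longrightarrow> sfunctor v K L \<Longrightarrow> sfunctor (v \<odot> u) J L"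
  by (auto simp: sfunctor_def intro: comp_functor)

lemma sfunctor_id: "small_cat J \<Longrightarrow> sfunctor (id_fctr J) J J"
  by (auto simp: sfunctor_def small_cat_def intro: id_fctr_functor)

lemma sfunctor_nat:
  assumes "nat_from_to \<alpha> u u'" "sfunctor u J K"
  shows "sfunctor u' J K"
  using assms by (auto simp: sfunctor_def nat_from_to_def functor_from_to_def)

lemma op_small_cat: "small_cat J \<Longrightarrow> small_cat (op_cat J)"
  by (simp add: small_cat_def op_category)

lemma op_sfunctor: "sfunctor u J K \<Longrightarrow> sfunctor (op_fctr u) (op_cat J) (op_cat K)"
  by (simp add: sfunctor_def op_small_cat op_functor)

locale prederiv =
  fixes D :: "('s::small_universe, 'b, 'c) prederiv"
  assumes prederivator: "prederivator D"
begin

abbreviation ob :: "'s sfctr \<Rightarrow> 'b \<Rightarrow> 'b" where "ob u \<equiv> FO (PF D u)"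
abbreviation ar :: "'s sfctr \<Rightarrow> 'c \<Rightarrow> 'c" where "ar u \<equiv> FA (PF D u)"
abbreviation cmp :: "'s snt \<Rightarrow> 'b \<Rightarrow> 'c" where "cmp \<alpha> \<equiv> Cmp (PN D \<alpha>)"

lemma PO_category: "small_cat J \<Longrightarrow> category (PO D J)"
  using prederivator by (simp add: prederivator_def)

lemma PF_functor: "sfunctor u J K \<Longrightarrow> functor_from_to (PF D u) (PO D K) (PO D J)"
  using prederivator by (simp add: prederivator_def)

lemma PF_id: "small_cat J \<Longrightarrow> PF D (id_fctr J) = id_fctr (PO D J)"
  using prederivator by (simp add: prederivator_def)

lemmas strict_2_functor_laws = prederivator[unfolded prederivator_def, THEN conjunct2, THEN conjunct2]

lemma PN_nat:
  assumes "nat_from_to \<alpha> u u'" "sfunctor u J K"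
  shows "nat_from_to (PN D \<alpha>) (PF D u) (PF D u')"
  by (rule strict_2_functor_laws[THEN conjunct1, rule_format])
    (use assms sfunctor_nat[OF assms] in blast)

lemma PF_comp:
  assumes "sfunctor u J K" "sfunctor v K L"
  shows "PF D (v \<odot> u) = PF D u \<odot> PF D v"
  by (rule strict_2_functor_laws[THEN conjunct2, THEN conjunct2, THEN conjunct1, rule_format])
    (use assms in blast)

lemma PN_id:
  assumes "sfunctor u J K"
  shows "PN D (id_nt u) = id_nt (PF D u)"
  by (rule strict_2_functor_laws[THEN conjunct2, THEN conjunct2, THEN conjunct2, THEN conjunct1,
        rule_format]) (rule assms)

lemma PN_vcomp:
  assumes "sfunctor u J K" "nat_from_to \<alpha> u u'" "nat_from_to \<beta> u' u''"
  shows "PN D (\<beta> \<bullet> \<alpha>) = PN D \<beta> \<bullet> PN D \<alpha>"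
  by (rule strict_2_functor_laws[THEN conjunct2, THEN conjunct2, THEN conjunct2, THEN conjunct2,
        THEN conjunct1, rule_format])
    (use assms sfunctor_nat[OF assms(2,1)] sfunctor_nat[OF assms(3) sfunctor_nat[OF assms(2,1)]]
      in blast)

lemma PN_hcomp:
  assumes "sfunctor u J K" "sfunctor v K L" "nat_from_to \<alpha> u u'" "nat_from_to \<beta> v v'"
  shows "PN D (\<beta> \<star> \<alpha>) = PN D \<alpha> \<star> PN D \<beta>"
  by (rule strict_2_functor_laws[THEN conjunct2, THEN conjunct2, THEN conjunct2, THEN conjunct2,
        THEN conjunct2, rule_format])
    (use assms sfunctor_nat[OF assms(3,1)] sfunctor_nat[OF assms(4,2)] in blast)

lemma ob_Ob: "sfunctor u J K \<Longrightarrow> X \<in> Ob (PO D K) \<Longrightarrow> ob u X \<in> Ob (PO D J)"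
  by (rule functor_ob[OF PF_functor])

lemma ar_hom: "sfunctor u J K \<Longrightarrow> f \<in> hom (PO D K) X Y \<Longrightarrow> ar u f \<in> hom (PO D J) (ob u X) (ob u Y)"
  by (rule functor_hom[OF PF_functor])

lemma ar_Comp:
  "sfunctor u J K \<Longrightarrow> f \<in> hom (PO D K) X Y \<Longrightarrow> g \<in> hom (PO D K) Y Z \<Longrightarrow>
   ar u (Comp (PO D K) g f) = Comp (PO D J) (ar u g) (ar u f)"
  by (rule functor_Comp[OF PF_functor])

lemma ob_comp:
  "sfunctor u J K \<Longrightarrow> sfunctor v K L \<Longrightarrow> X \<in> Ob (PO D L) \<Longrightarrow> ob (v \<odot> u) X = ob u (ob v X)"
  using functor_categories[OF PF_functor[of v K L]] by (simp add: PF_comp)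

lemma ar_comp:
  "sfunctor u J K \<Longrightarrow> sfunctor v K L \<Longrightarrow> f \<in> hom (PO D L) X Y \<Longrightarrow> ar (v \<odot> u) f = ar u (ar v f)"
  using functor_categories[OF PF_functor[of v K L]] by (simp add: PF_comp homD(1))

lemma cmp_hom:
  "nat_from_to \<alpha> u u' \<Longrightarrow> sfunctor u J K \<Longrightarrow> X \<in> Ob (PO D K) \<Longrightarrow>
   cmp \<alpha> X \<in> hom (PO D J) (ob u X) (ob u' X)"
  by (rule nat_hom[OF PN_nat PF_functor])

lemma cmp_natural:
  "nat_from_to \<alpha> u u' \<Longrightarrow> sfunctor u J K \<Longrightarrow> f \<in> hom (PO D K) X Y \<Longrightarrow>
   Comp (PO D J) (cmp \<alpha> Y) (ar u f) = Comp (PO D J) (ar u' f) (cmp \<alpha> X)"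
  by (rule nat_natural[OF PN_nat PF_functor])

lemma cmp_id: "sfunctor u J K \<Longrightarrow> X \<in> Ob (PO D K) \<Longrightarrow> cmp (id_nt u) X = Id (PO D J) (ob u X)"
  using functor_categories[OF PF_functor[of u J K]] by (simp add: PN_id)

lemma cmp_vcomp:
  "sfunctor u J K \<Longrightarrow> nat_from_to \<alpha> u u' \<Longrightarrow> nat_from_to \<beta> u' u'' \<Longrightarrow> X \<in> Ob (PO D K) \<Longrightarrow>
   cmp (\<beta> \<bullet> \<alpha>) X = Comp (PO D J) (cmp \<beta> X) (cmp \<alpha> X)"
  using vcomp_Cmp[OF PN_nat PF_functor] by (simp add: PN_vcomp)

lemma cmp_whisker_left:
  assumes a: "nat_from_to \<alpha> u u'" and u: "sfunctor u J K" and v: "sfunctor v K L"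
    and X: "X \<in> Ob (PO D L)"
  shows "cmp (id_nt v \<star> \<alpha>) X = cmp \<alpha> (ob v X)"
  using PN_hcomp[OF u v a id_nt_nat[OF sfunctorD(1)[OF v]]]
    whisker_right_Cmp[OF PF_functor[OF v] PN_nat[OF a u] PF_functor[OF u] X]
  by (simp add: PN_id[OF v])

lemma cmp_whisker_right:
  assumes b: "nat_from_to \<beta> v v'" and u: "sfunctor u J K" and v: "sfunctor v K L"
    and X: "X \<in> Ob (PO D L)"
  shows "cmp (\<beta> \<star> id_nt u) X = ar u (cmp \<beta> X)"
  using PN_hcomp[OF u v id_nt_nat[OF sfunctorD(1)[OF u]] b]
    whisker_left_Cmp[OF PN_nat[OF b v] PF_functor[OF v] PF_functor[OF u] X]
  by (simp add: PN_id[OF u])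

end

text \<open>The opposite prederivator \<open>J \<mapsto> D(J\<^sup>o\<^sup>p)\<^sup>o\<^sup>p\<close>. It reverses functors on both sides, so that a statement
  about right adjoints between small categories turns into one about left adjoints.\<close>

definition op_prederiv :: "('s::small_universe, 'b, 'c) prederiv \<Rightarrow> ('s, 'b, 'c) prederiv" where
  "op_prederiv D = \<lparr>PO = (\<lambda>J. op_cat (PO D (op_cat J))), PF = (\<lambda>u. op_fctr (PF D (op_fctr u))),
     PN = (\<lambda>\<alpha>. op_nt (PN D (op_nt \<alpha>)))\<rparr>"

lemma op_prederiv_simps [simp]:
  "PO (op_prederiv D) J = op_cat (PO D (op_cat J))"
  "PF (op_prederiv D) u = op_fctr (PF D (op_fctr u))"
  "PN (op_prederiv D) \<alpha> = op_nt (PN D (op_nt \<alpha>))"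
  by (simp_all add: op_prederiv_def)

context prederiv
begin

lemma op_prederiv: "prederiv (op_prederiv D)"
proof
  show "prederivator (op_prederiv D)"
    unfolding prederivator_def op_prederiv_simps
  proof (intro conjI allI impI; (elim conjE)?)
    show "category (op_cat (PO D (op_cat J)))" if "small_cat J" for J
      by (rule op_category[OF PO_category[OF op_small_cat[OF that]]])
    show "functor_from_to (op_fctr (PF D (op_fctr u))) (op_cat (PO D (op_cat K)))
        (op_cat (PO D (op_cat J)))" if "sfunctor u J K" for u J K
      by (rule op_functor[OF PF_functor[OF op_sfunctor[OF that]]])
    show "nat_from_to (op_nt (PN D (op_nt \<alpha>))) (op_fctr (PF D (op_fctr u)))
        (op_fctr (PF D (op_fctr u')))"
      if "sfunctor u' J K" "nat_from_to \<alpha> u u'" for \<alpha> u u' J K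
      by (rule op_nat[OF PN_nat[OF op_nat[OF that(2)] op_sfunctor[OF that(1)]]])
    show "op_fctr (PF D (op_fctr (id_fctr J))) = id_fctr (op_cat (PO D (op_cat J)))"
      if "small_cat J" for J
      using PF_id[OF op_small_cat[OF that]] by (simp add: op_id_fctr)
    show "op_fctr (PF D (op_fctr (v \<odot> u))) = op_fctr (PF D (op_fctr u)) \<odot> op_fctr (PF D (op_fctr v))"
      if "sfunctor u J K" "sfunctor v K L" for u v J K L
      using PF_comp[OF op_sfunctor[OF that(1)] op_sfunctor[OF that(2)]] by (simp add: op_comp_fctr)
    show "op_nt (PN D (op_nt (id_nt u))) = id_nt (op_fctr (PF D (op_fctr u)))"
      if "sfunctor u J K" for u J K
      using PN_id[OF op_sfunctor[OF that]] by (simp add: op_id_nt)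
    show "op_nt (PN D (op_nt (\<beta> \<bullet> \<alpha>))) = op_nt (PN D (op_nt \<beta>)) \<bullet> op_nt (PN D (op_nt \<alpha>))"
      if u: "sfunctor u1 J K" "sfunctor u2 J K" "sfunctor u3 J K"
        and a: "nat_from_to \<alpha> u1 u2" "nat_from_to \<beta> u2 u3" for u1 u2 u3 \<alpha> \<beta> J K
      using PN_vcomp[OF op_sfunctor[OF u(3)] op_nat[OF a(2)] op_nat[OF a(1)]] op_vcomp[OF a]
        op_vcomp[OF PN_nat[OF op_nat[OF a(2)] op_sfunctor[OF u(3)]]
          PN_nat[OF op_nat[OF a(1)] op_sfunctor[OF u(2)]]]
      by simp
    show "op_nt (PN D (op_nt (\<beta> \<star> \<alpha>))) = op_nt (PN D (op_nt \<alpha>)) \<star> op_nt (PN D (op_nt \<beta>))"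
      if u: "sfunctor u J K" "sfunctor u' J K" "sfunctor v K L" "sfunctor v' K L"
        and a: "nat_from_to \<alpha> u u'" "nat_from_to \<beta> v v'" for u u' v v' \<alpha> \<beta> J K L
      using PN_hcomp[OF op_sfunctor[OF u(2)] op_sfunctor[OF u(4)] op_nat[OF a(1)] op_nat[OF a(2)]]
        op_hcomp[OF a(1) sfunctorD(1)[OF u(1)] a(2) sfunctorD(1)[OF u(3)]]
        op_hcomp[OF PN_nat[OF op_nat[OF a(2)] op_sfunctor[OF u(4)]] PF_functor[OF op_sfunctor[OF u(4)]]
          PN_nat[OF op_nat[OF a(1)] op_sfunctor[OF u(2)]] PF_functor[OF op_sfunctor[OF u(2)]]]
      by simp
  qed
qed

end

section \<open>Restriction along coreflective functors\<close>

text \<open>Couniversal arrows chosen object by object assemble into a right adjoint \<open>\<rho>\<close> of \<open>i\<close> with counit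
  \<open>\<kappa>\<close> and unit \<open>\<nu>\<close>; the last conclusion is a triangle identity.\<close>

lemma coreflection_functor:
  assumes i: "functor_from_to i P C"
    and cu: "\<And>c. c \<in> Ob C \<Longrightarrow> couniversal_arrow i c (r c) (k c)"
  obtains \<rho> \<kappa> \<nu> where "functor_from_to \<rho> C P" "nat_from_to \<kappa> (i \<odot> \<rho>) (id_fctr C)"
    "nat_from_to \<nu> (id_fctr P) (\<rho> \<odot> i)" "\<And>c. c \<in> Ob C \<Longrightarrow> FO \<rho> c = r c"
    "\<And>c. c \<in> Ob C \<Longrightarrow> Cmp \<kappa> c = k c"
    "\<And>x. x \<in> Ob P \<Longrightarrow> Comp C (k (FO i x)) (FA i (Cmp \<nu> x)) = Id C (FO i x)"
proof -
  note cats = functor_categories[OF i]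
  have r: "r c \<in> Ob P" and k: "k c \<in> hom C (FO i (r c)) c"
    and ex1: "\<And>x g. x \<in> Ob P \<Longrightarrow> g \<in> hom C (FO i x) c \<Longrightarrow>
        \<exists>!h. h \<in> hom P x (r c) \<and> Comp C (k c) (FA i h) = g" if "c \<in> Ob C" for c
    using cu[OF that] cats by (auto simp: couniversal_arrow_def)
  define lift where "lift c x g = (THE h. h \<in> hom P x (r c) \<and> Comp C (k c) (FA i h) = g)" for c x g
  have lift: "lift c x g \<in> hom P x (r c)" "Comp C (k c) (FA i (lift c x g)) = g"
    if "c \<in> Ob C" "x \<in> Ob P" "g \<in> hom C (FO i x) c" for c x g
    using theI'[OF ex1[OF that]] by (auto simp: lift_def)
  have uniq: "h = h'" if "c \<in> Ob C" "h \<in> hom P x (r c)" "h' \<in> hom P x (r c)"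
    "Comp C (k c) (FA i h) = Comp C (k c) (FA i h')" for c x h h'
    using ex1[OF that(1) hom_objects(1)[OF cats(1) that(2)]
        Comp_hom[OF cats(2) functor_hom[OF i that(2)] k[OF that(1)]]] that by metis
  define \<rho> where "\<rho> = \<lparr>Src = C, Tgt = P, FO = (\<lambda>c\<in>Ob C. r c),
    FA = (\<lambda>f\<in>Ar C. lift (Cod C f) (r (Dom C f)) (Comp C f (k (Dom C f))))\<rparr>"
  have \<rho>: "FA \<rho> f \<in> hom P (r c) (r d)" "Comp C (k d) (FA i (FA \<rho> f)) = Comp C f (k c)"
    if f: "f \<in> hom C c d" for f c d
  proof -
    note cd = hom_objects[OF cats(2) f]
    have "FA \<rho> f = lift d (r c) (Comp C f (k c))" using f by (simp add: \<rho>_def homD)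
    then show "FA \<rho> f \<in> hom P (r c) (r d)" "Comp C (k d) (FA i (FA \<rho> f)) = Comp C f (k c)"
      using lift[OF cd(2) r[OF cd(1)] Comp_hom[OF cats(2) k[OF cd(1)] f]] by simp_all
  qed
  have \<rho>o: "FO \<rho> c = r c" if "c \<in> Ob C" for c using that by (simp add: \<rho>_def)
  have fun_rho: "functor_from_to \<rho> C P"
  proof (rule functorI)
    show "FA \<rho> f \<in> hom P (FO \<rho> (Dom C f)) (FO \<rho> (Cod C f))" if "f \<in> Ar C" for f
      using \<rho>(1)[OF Ar_hom[OF that]] hom_objects[OF cats(2) Ar_hom[OF that]] \<rho>o by simp
    show "FA \<rho> (Id C c) = Id P (FO \<rho> c)" if c: "c \<in> Ob C" for c
    proof (rule uniq[OF c])
      note I = Id_hom[OF cats(2) c]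
      show "FA \<rho> (Id C c) \<in> hom P (r c) (r c)" by (rule \<rho>(1)[OF I])
      show "Id P (FO \<rho> c) \<in> hom P (r c) (r c)" using Id_hom[OF cats(1) r[OF c]] \<rho>o[OF c] by simp
      show "Comp C (k c) (FA i (FA \<rho> (Id C c))) = Comp C (k c) (FA i (Id P (FO \<rho> c)))"
        using \<rho>(2)[OF I] k[OF c] functor_Id[OF i r[OF c]] \<rho>o[OF c]
        by (simp add: Comp_Id_left[OF cats(2)] Comp_Id_right[OF cats(2)])
    qed
    show "FA \<rho> (Comp C g f) = Comp P (FA \<rho> g) (FA \<rho> f)"
      if "f \<in> Ar C" "g \<in> Ar C" "Cod C f = Dom C g" for f g
    proof -
      define a b d where "a = Dom C f" and "b = Cod C f" and "d = Cod C g"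
      have f: "f \<in> hom C a b" and g: "g \<in> hom C b d"
        using that by (auto simp: hom_def a_def b_def d_def)
      note ob = hom_objects[OF cats(2) f] hom_objects[OF cats(2) g]
      note gf = Comp_hom[OF cats(2) f g]
      note ih = functor_hom[OF i \<rho>(1)[OF f]] functor_hom[OF i \<rho>(1)[OF g]]
      show ?thesis
      proof (rule uniq[OF ob(4) \<rho>(1)[OF gf] Comp_hom[OF cats(1) \<rho>(1)[OF f] \<rho>(1)[OF g]]])
        have "Comp C (k d) (FA i (Comp P (FA \<rho> g) (FA \<rho> f)))
            = Comp C (Comp C (k d) (FA i (FA \<rho> g))) (FA i (FA \<rho> f))"
          using functor_Comp[OF i \<rho>(1)[OF f] \<rho>(1)[OF g]]
            Comp_assoc[OF cats(2) ih(1) ih(2) k[OF ob(4)]] by simp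
        also have "\<dots> = Comp C g (Comp C (k b) (FA i (FA \<rho> f)))"
          using \<rho>(2)[OF g] Comp_assoc[OF cats(2) ih(1) k[OF ob(2)] g] by simp
        also have "\<dots> = Comp C (Comp C g f) (k a)"
          using \<rho>(2)[OF f] Comp_assoc[OF cats(2) k[OF ob(1)] f g] by simp
        finally show "Comp C (k d) (FA i (FA \<rho> (Comp C g f)))
            = Comp C (k d) (FA i (Comp P (FA \<rho> g) (FA \<rho> f)))" using \<rho>(2)[OF gf] by simp
      qed
    qed
  qed (use cats r in \<open>auto simp: \<rho>_def\<close>)
  note frho = functor_categories[OF fun_rho]
  define \<kappa> where "\<kappa> = \<lparr>NS = i \<odot> \<rho>, NT = id_fctr C, Cmp = (\<lambda>c\<in>Ob C. k c)\<rparr>"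
  have \<kappa>: "nat_from_to \<kappa> (i \<odot> \<rho>) (id_fctr C)"
  proof (rule natI[OF comp_functor[OF fun_rho i] id_fctr_functor[OF cats(2)]])
    show "Cmp \<kappa> c \<in> hom C (FO (i \<odot> \<rho>) c) (FO (id_fctr C) c)" if "c \<in> Ob C" for c
      using k[OF that] \<rho>o[OF that] that frho by (simp add: \<kappa>_def)
    show "Comp C (Cmp \<kappa> d) (FA (i \<odot> \<rho>) f) = Comp C (FA (id_fctr C) f) (Cmp \<kappa> c)"
      if f: "f \<in> hom C c d" and "c \<in> Ob C" "d \<in> Ob C" for f c d
      using \<rho>(2)[OF f] that homD(1)[OF f] frho by (simp add: \<kappa>_def)
  qed (auto simp: \<kappa>_def)
  define n where "n x = lift (FO i x) x (Id C (FO i x))" for x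
  have n: "n x \<in> hom P x (r (FO i x))" "Comp C (k (FO i x)) (FA i (n x)) = Id C (FO i x)"
    if "x \<in> Ob P" for x
    using lift[OF functor_ob[OF i that] that Id_hom[OF cats(2) functor_ob[OF i that]]]
    by (auto simp: n_def)
  define \<nu> where "\<nu> = \<lparr>NS = id_fctr P, NT = \<rho> \<odot> i, Cmp = (\<lambda>x\<in>Ob P. n x)\<rparr>"
  have \<nu>: "nat_from_to \<nu> (id_fctr P) (\<rho> \<odot> i)"
  proof (rule natI[OF id_fctr_functor[OF cats(1)] comp_functor[OF i fun_rho]])
    show "Cmp \<nu> x \<in> hom P (FO (id_fctr P) x) (FO (\<rho> \<odot> i) x)" if "x \<in> Ob P" for x
      using n(1)[OF that] \<rho>o[OF functor_ob[OF i that]] that cats by (simp add: \<nu>_def)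
    show "Comp P (Cmp \<nu> y) (FA (id_fctr P) f) = Comp P (FA (\<rho> \<odot> i) f) (Cmp \<nu> x)"
      if f: "f \<in> hom P x y" and x: "x \<in> Ob P" and y: "y \<in> Ob P" for f x y
    proof -
      note jf = functor_hom[OF i f]
      note rif = \<rho>(1)[OF jf]
      note h = functor_hom[OF i n(1)[OF x]] functor_hom[OF i n(1)[OF y]] functor_hom[OF i rif]
        k[OF functor_ob[OF i x]] k[OF functor_ob[OF i y]]
      have "Comp P (n y) f = Comp P (FA \<rho> (FA i f)) (n x)"
      proof (rule uniq[OF functor_ob[OF i y] Comp_hom[OF cats(1) f n(1)[OF y]]
            Comp_hom[OF cats(1) n(1)[OF x] rif]])
        have "Comp C (k (FO i y)) (FA i (Comp P (n y) f)) = FA i f"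
          using functor_Comp[OF i f n(1)[OF y]] Comp_assoc[OF cats(2) jf h(2) h(5)] n(2)[OF y]
            Comp_Id_left[OF cats(2) jf] by simp
        moreover have "Comp C (k (FO i y)) (FA i (Comp P (FA \<rho> (FA i f)) (n x))) = FA i f"
          using functor_Comp[OF i n(1)[OF x] rif] Comp_assoc[OF cats(2) h(1) h(3) h(5)]
            \<rho>(2)[OF jf] Comp_assoc[OF cats(2) h(1) h(4) jf] n(2)[OF x] Comp_Id_right[OF cats(2) jf]
          by simp
        ultimately show "Comp C (k (FO i y)) (FA i (Comp P (n y) f))
            = Comp C (k (FO i y)) (FA i (Comp P (FA \<rho> (FA i f)) (n x)))" by simp
      qed
      then show ?thesis using x y homD(1)[OF f] cats by (simp add: \<nu>_def)
    qed
  qed (auto simp: \<nu>_def)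
  show ?thesis
    by (rule that[OF fun_rho \<kappa> \<nu>]) (use \<rho>o n(2) in \<open>auto simp: \<kappa>_def \<nu>_def\<close>)
qed

text \<open>The functor \<open>i\<close> has a right adjoint with a counit that becomes an identity under \<open>p\<close>. Stated
  through couniversal arrows, this can be checked for concrete \<open>i\<close> without constructing the right
  adjoint as a functor.\<close>

definition coreflective_over where
  "coreflective_over i p \<longleftrightarrow> (\<forall>c\<in>Ob (Tgt i). \<exists>x k. couniversal_arrow i c x k \<and>
     FA p k = Id (Tgt p) (FO p c))"

context prederiv
begin

text \<open>A prederivator turns the right adjoint \<open>\<rho>\<close> of \<open>i\<close> into a left adjoint \<open>\<rho>*\<close> of \<open>i*\<close>. Since the counit
  is an identity over \<open>p\<close>, the object \<open>p* X\<close> equals \<open>\<rho>* (i* p* X)\<close>, and the bijection is that of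
  this adjunction; its inverse sends \<open>\<phi>\<close> to \<open>\<rho>* \<phi>\<close> followed by the counit.\<close>

lemma restriction_bij_coreflective:
  assumes i: "sfunctor i P C" and p: "sfunctor p C K"
    and cor: "coreflective_over i p"
    and X: "X \<in> Ob (PO D K)" and B: "B \<in> Ob (PO D C)"
  shows "bij_betw (ar i) (hom (PO D C) (ob p X) B) (hom (PO D P) (ob i (ob p X)) (ob i B))"
proof -
  note fi = sfunctorD(1)[OF i] and fp = sfunctorD(1)[OF p]
  note si = sfunctorD[OF i] and sp = sfunctorD[OF p]
  obtain r k where rk: "\<And>c. c \<in> Ob C \<Longrightarrow> couniversal_arrow i c (r c) (k c)"
    and pk: "\<And>c. c \<in> Ob C \<Longrightarrow> FA p (k c) = Id K (FO p c)"
    using cor unfolding coreflective_over_def si sp by metis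
  obtain \<rho> \<kappa> \<nu> where f\<rho>: "functor_from_to \<rho> C P" and \<kappa>: "nat_from_to \<kappa> (i \<odot> \<rho>) (id_fctr C)"
    and \<nu>: "nat_from_to \<nu> (id_fctr P) (\<rho> \<odot> i)" and \<rho>o: "\<And>c. c \<in> Ob C \<Longrightarrow> FO \<rho> c = r c"
    and \<kappa>k: "\<And>c. c \<in> Ob C \<Longrightarrow> Cmp \<kappa> c = k c"
    and tri: "\<And>x. x \<in> Ob P \<Longrightarrow> Comp C (k (FO i x)) (FA i (Cmp \<nu> x)) = Id C (FO i x)"
    using coreflection_functor[OF fi rk] by blast
  have \<rho>: "sfunctor \<rho> C P" using f\<rho> si by (simp add: sfunctor_def)
  note s\<rho> = sfunctorD[OF \<rho>]
  note i\<rho> = sfunctor_comp[OF \<rho> i] and \<rho>i = sfunctor_comp[OF i \<rho>] and pi = sfunctor_comp[OF i p]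
  note idC = sfunctor_id[OF si(3)] and idP = sfunctor_id[OF si(2)]
  note f = sfunctorD(1)[OF i\<rho>] sfunctorD(1)[OF \<rho>i] sfunctorD(1)[OF pi]
  have kh: "k c \<in> hom C (FO i (FO \<rho> c)) c" if "c \<in> Ob C" for c
    using nat_hom[OF \<kappa> f(1) that] that \<kappa>k s\<rho> by simp
  have nh: "Cmp \<nu> x \<in> hom P x (FO \<rho> (FO i x))" if "x \<in> Ob P" for x
    using nat_hom[OF \<nu> id_fctr_functor[OF si(4)] that] that si by simp
  \<comment> \<open>Since \<open>p\<close> sends the counit to identities, whiskering makes it an identity transformation;
    by the triangle identity the same follows for the unit and \<open>p \<odot> i\<close>.\<close>
  have pir_ob: "FO p (FO i (FO \<rho> c)) = FO p c" if "c \<in> Ob C" for c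
    using homD(2)[OF functor_hom[OF fp kh[OF that]]] pk[OF that]
      homD(2)[OF Id_hom[OF sp(5) functor_ob[OF fp that]]] by simp
  have pir: "p \<odot> i \<odot> \<rho> = p"
  proof (rule functor_eqI_arrows[OF comp_functor[OF f(1) fp] fp])
    fix g assume g: "g \<in> Ar C"
    note gh = Ar_hom[OF g]
    note ob = hom_objects[OF si(5) gh]
    note ig = functor_hom[OF fi functor_hom[OF f\<rho> gh]]
    have "Comp C (k (Cod C g)) (FA i (FA \<rho> g)) = Comp C g (k (Dom C g))"
      using nat_natural[OF \<kappa> f(1) gh] \<kappa>k ob g s\<rho> by simp
    then have "Comp K (Id K (FO p (Cod C g))) (FA p (FA i (FA \<rho> g)))
        = Comp K (FA p g) (Id K (FO p (Dom C g)))"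
      using functor_Comp[OF fp ig kh[OF ob(2)]] functor_Comp[OF fp kh[OF ob(1)] gh] pk ob by simp
    moreover have "FA p (FA i (FA \<rho> g)) \<in> hom K (FO p (Dom C g)) (FO p (Cod C g))"
      using functor_hom[OF fp ig] ob pir_ob by simp
    ultimately show "FA (p \<odot> i \<odot> \<rho>) g = FA p g"
      using functor_hom[OF fp gh] g s\<rho> by (simp add: Comp_Id_left[OF sp(5)] Comp_Id_right[OF sp(5)])
  qed
  have p\<kappa>: "id_nt p \<star> \<kappa> = id_nt p"
  proof (rule nt_eqI[OF _ id_nt_nat[OF fp] fp])
    show "nat_from_to (id_nt p \<star> \<kappa>) p p"
      using whisker_left_nat[OF \<kappa> f(1) fp] by (simp add: pir comp_id_fctr[OF fp])
    show "Cmp (id_nt p \<star> \<kappa>) c = Cmp (id_nt p) c" if "c \<in> Ob C" for c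
      using whisker_left_Cmp[OF \<kappa> f(1) fp that] pk[OF that] \<kappa>k[OF that] that sp by simp
  qed
  have q\<nu>: "id_nt (p \<odot> i) \<star> \<nu> = id_nt (p \<odot> i)"
  proof (rule nt_eqI[OF _ id_nt_nat[OF f(3)] f(3)])
    have "(p \<odot> i) \<odot> \<rho> \<odot> i = p \<odot> i"
      using comp_fctr_assoc[OF fi f\<rho> f(3)] comp_fctr_assoc[OF f\<rho> fi fp] pir by simp
    then show "nat_from_to (id_nt (p \<odot> i) \<star> \<nu>) (p \<odot> i) (p \<odot> i)"
      using whisker_left_nat[OF \<nu> id_fctr_functor[OF si(4)] f(3)]
      by (simp add: comp_id_fctr[OF f(3)])
    show "Cmp (id_nt (p \<odot> i) \<star> \<nu>) x = Cmp (id_nt (p \<odot> i)) x" if x: "x \<in> Ob P" for x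
    proof -
      note ix = functor_ob[OF fi x]
      note inh = functor_hom[OF fi nh[OF x]]
      have "FA p (FA i (Cmp \<nu> x)) = Comp K (FA p (k (FO i x))) (FA p (FA i (Cmp \<nu> x)))"
        using Comp_Id_left[OF sp(5) functor_hom[OF fp inh]] pir_ob[OF ix] pk[OF ix] by simp
      also have "\<dots> = Id K (FO p (FO i x))"
        using functor_Comp[OF fp inh kh[OF ix]] tri[OF x] functor_Id[OF fp ix] by simp
      finally show ?thesis
        using whisker_left_Cmp[OF \<nu> id_fctr_functor[OF si(4)] f(3) x] x homD(1)[OF nh[OF x]] si sp
        by simp
    qed
  qed
  have \<kappa>i\<nu>: "(\<kappa> \<star> id_nt i) \<bullet> (id_nt i \<star> \<nu>) = id_nt i"
  proof (rule nt_eqI[OF vcomp_nat id_nt_nat[OF fi] fi])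
    note idPf = id_fctr_functor[OF si(4)]
    show n1: "nat_from_to (id_nt i \<star> \<nu>) i (i \<odot> \<rho> \<odot> i)"
      using whisker_left_nat[OF \<nu> idPf fi] by (simp add: comp_id_fctr[OF fi])
    show "nat_from_to (\<kappa> \<star> id_nt i) (i \<odot> \<rho> \<odot> i) i"
      using whisker_right_nat[OF fi \<kappa> f(1)]
      by (simp add: comp_id_fctr[OF fi] comp_fctr_assoc[OF fi f\<rho> fi])
    show "Cmp ((\<kappa> \<star> id_nt i) \<bullet> (id_nt i \<star> \<nu>)) x = Cmp (id_nt i) x" if x: "x \<in> Ob P" for x
      using vcomp_Cmp[OF n1 fi x] whisker_left_Cmp[OF \<nu> idPf fi x]
        whisker_right_Cmp[OF fi \<kappa> f(1) x] tri[OF x] \<kappa>k[OF functor_ob[OF fi x]] x si by simp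
  qed
  let ?C = "PO D C" and ?P = "PO D P"
  let ?pX = "ob p X"
  have pX: "?pX \<in> Ob ?C" and catC: "category ?C" and catP: "category ?P"
    using ob_Ob[OF p X] PO_category si by blast+
  have rip: "ob \<rho> (ob i ?pX) = ?pX"
    using ob_comp[OF i\<rho> p X] ob_comp[OF \<rho> i pX] by (simp add: pir)
  have rii: "ob \<rho> (ob i B) = ob (i \<odot> \<rho>) B" using ob_comp[OF \<rho> i B] by simp
  have cB: "cmp \<kappa> B \<in> hom ?C (ob \<rho> (ob i B)) B"
    using cmp_hom[OF \<kappa> i\<rho> B] B PF_id[OF si(3)] rii by simp
  have cpX: "cmp \<kappa> ?pX = Id ?C ?pX"
    using cmp_whisker_left[OF \<kappa> i\<rho> p X] cmp_id[OF p X] by (simp add: p\<kappa>)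
  have npX: "cmp \<nu> (ob i ?pX) = Id ?P (ob i ?pX)"
    using cmp_whisker_left[OF \<nu> idP pi X] cmp_id[OF pi X] ob_comp[OF i p X] by (simp add: q\<nu>)
  have nB: "cmp \<nu> (ob i B) \<in> hom ?P (ob i B) (ob i (ob \<rho> (ob i B)))"
    using cmp_hom[OF \<nu> idP ob_Ob[OF i B]] ob_Ob[OF i B] PF_id[OF si(2)]
      ob_comp[OF i \<rho> ob_Ob[OF i B]] by simp
  have triB: "Comp ?P (ar i (cmp \<kappa> B)) (cmp \<nu> (ob i B)) = Id ?P (ob i B)"
  proof -
    have "cmp ((\<kappa> \<star> id_nt i) \<bullet> (id_nt i \<star> \<nu>)) B
        = Comp ?P (cmp (\<kappa> \<star> id_nt i) B) (cmp (id_nt i \<star> \<nu>) B)"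
    proof (rule cmp_vcomp[OF i _ _ B])
      show "nat_from_to (id_nt i \<star> \<nu>) i (i \<odot> \<rho> \<odot> i)"
        using whisker_left_nat[OF \<nu> id_fctr_functor[OF si(4)] fi] by (simp add: comp_id_fctr[OF fi])
      show "nat_from_to (\<kappa> \<star> id_nt i) (i \<odot> \<rho> \<odot> i) i"
        using whisker_right_nat[OF fi \<kappa> f(1)]
        by (simp add: comp_id_fctr[OF fi] comp_fctr_assoc[OF fi f\<rho> fi])
    qed
    then show ?thesis
      using cmp_whisker_right[OF \<kappa> i i\<rho> B] cmp_whisker_left[OF \<nu> idP i B] cmp_id[OF i B]
      by (simp add: \<kappa>i\<nu>)
  qed
  have inv: "Comp ?C (cmp \<kappa> B) (ar \<rho> (ar i \<psi>)) = \<psi>" if \<psi>: "\<psi> \<in> hom ?C ?pX B" for \<psi>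
    using cmp_natural[OF \<kappa> i\<rho> \<psi>] ar_comp[OF \<rho> i \<psi>] PF_id[OF si(3)] homD(1)[OF \<psi>] cpX
      Comp_Id_right[OF catC \<psi>] by simp
  show ?thesis
  proof (rule bij_betw_byWitness[where f' = "\<lambda>\<phi>. Comp ?C (cmp \<kappa> B) (ar \<rho> \<phi>)"])
    show "\<forall>\<psi>\<in>hom ?C ?pX B. Comp ?C (cmp \<kappa> B) (ar \<rho> (ar i \<psi>)) = \<psi>" using inv by blast
    show "ar i ` hom ?C ?pX B \<subseteq> hom ?P (ob i ?pX) (ob i B)" using ar_hom[OF i] by blast
    have r\<phi>: "ar \<rho> \<phi> \<in> hom ?C ?pX (ob \<rho> (ob i B))" if "\<phi> \<in> hom ?P (ob i ?pX) (ob i B)" for \<phi>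
      using ar_hom[OF \<rho> that] rip by simp
    show "(\<lambda>\<phi>. Comp ?C (cmp \<kappa> B) (ar \<rho> \<phi>)) ` hom ?P (ob i ?pX) (ob i B) \<subseteq> hom ?C ?pX B"
      using Comp_hom[OF catC r\<phi> cB] by blast
    show "\<forall>\<phi>\<in>hom ?P (ob i ?pX) (ob i B). ar i (Comp ?C (cmp \<kappa> B) (ar \<rho> \<phi>)) = \<phi>"
    proof
      fix \<phi> assume \<phi>: "\<phi> \<in> hom ?P (ob i ?pX) (ob i B)"
      note h = ar_hom[OF i r\<phi>[OF \<phi>]] ar_hom[OF i cB]
      have nat: "Comp ?P (cmp \<nu> (ob i B)) \<phi> = ar i (ar \<rho> \<phi>)"
        using cmp_natural[OF \<nu> idP \<phi>] PF_id[OF si(2)] homD(1)[OF \<phi>] npX ar_comp[OF i \<rho> \<phi>]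
          Comp_Id_right[OF catP h(1)] by simp
      have "ar i (Comp ?C (cmp \<kappa> B) (ar \<rho> \<phi>)) = Comp ?P (ar i (cmp \<kappa> B)) (ar i (ar \<rho> \<phi>))"
        by (rule ar_Comp[OF i r\<phi>[OF \<phi>] cB])
      also have "\<dots> = Comp ?P (Comp ?P (ar i (cmp \<kappa> B)) (cmp \<nu> (ob i B))) \<phi>"
        using Comp_assoc[OF catP \<phi> nB h(2)] nat by simp
      also have "\<dots> = \<phi>" using triB Comp_Id_left[OF catP \<phi>] by simp
      finally show "ar i (Comp ?C (cmp \<kappa> B) (ar \<rho> \<phi>)) = \<phi>" .
    qed
  qed
qed

end

text \<open>The dual notion: \<open>i\<close> has a left adjoint with a unit that becomes an identity under \<open>p\<close>.\<close>

definition reflective_over where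
  "reflective_over i p \<longleftrightarrow> (\<forall>c\<in>Ob (Tgt i). \<exists>x k. universal_arrow i c x k \<and>
     FA p k = Id (Tgt p) (FO p c))"

lemma (in prederiv) restriction_bij_reflective:
  assumes i: "sfunctor i P C" and p: "sfunctor p C K" and ref: "reflective_over i p"
    and Z: "Z \<in> Ob (PO D K)" and A: "A \<in> Ob (PO D C)"
  shows "bij_betw (ar i) (hom (PO D C) A (ob p Z)) (hom (PO D P) (ob i A) (ob i (ob p Z)))"
proof -
  interpret op: prederiv "op_prederiv D" by (rule op_prederiv)
  have "coreflective_over (op_fctr i) (op_fctr p)"
    using ref by (simp add: coreflective_over_def reflective_over_def couniversal_arrow_op)
  from op.restriction_bij_coreflective[OF op_sfunctor[OF i] op_sfunctor[OF p] this, of Z A] Z A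
  show ?thesis by simp
qed

section \<open>Exact squares\<close>

text \<open>The transformation points in the direction of a left Beck--Chevalley transformation
  \<open>u1\<^sub>! v* \<rightarrow> w* u2\<^sub>!\<close>.\<close>

definition lax_square where
  "lax_square v u1 u2 w \<alpha> J1 J2 K1 K2 \<longleftrightarrow> sfunctor v J1 J2 \<and> sfunctor u1 J1 K1 \<and>
     sfunctor u2 J2 K2 \<and> sfunctor w K1 K2 \<and> nat_from_to \<alpha> (u2 \<odot> v) (w \<odot> u1)"

text \<open>For \<open>\<alpha> : u2 v \<rightarrow> w u1\<close> and \<open>\<alpha>' : u1 v' \<rightarrow> w' u1'\<close> this is the composite
  \<open>u2 v v' \<rightarrow> w u1 v' \<rightarrow> w w' u1'\<close>.\<close>

definition paste where
  "paste w \<alpha> v' \<alpha>' = (id_nt w \<star> \<alpha>') \<bullet> (\<alpha> \<star> id_nt v')"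

lemma lax_squareD:
  assumes "lax_square v u1 u2 w \<alpha> J1 J2 K1 K2"
  shows "sfunctor v J1 J2" "sfunctor u1 J1 K1" "sfunctor u2 J2 K2" "sfunctor w K1 K2"
    "nat_from_to \<alpha> (u2 \<odot> v) (w \<odot> u1)"
  using assms by (auto simp: lax_square_def)

lemma identity_lax_square:
  assumes u: "sfunctor u J K"
  shows "lax_square (id_fctr J) u u (id_fctr K) (id_nt u) J J K K"
proof -
  note s = sfunctorD[OF u]
  show ?thesis
    using u sfunctor_id[OF s(2)] sfunctor_id[OF s(3)] id_nt_nat[OF s(1)] comp_id_fctr[OF s(1)]
    by (simp add: lax_square_def)
qed

lemma lax_square_restrict:
  assumes sq: "lax_square v u1 u2 w \<alpha> J1 J2 K1 K2" and i: "sfunctor i P J1"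
  shows "lax_square (v \<odot> i) (u1 \<odot> i) u2 w (\<alpha> \<star> id_nt i) P J2 K1 K2"
proof -
  note s = lax_squareD[OF sq]
  have "nat_from_to (\<alpha> \<star> id_nt i) (u2 \<odot> v \<odot> i) (w \<odot> u1 \<odot> i)"
    using whisker_right_nat[OF sfunctorD(1)[OF i] s(5) sfunctorD(1)[OF sfunctor_comp[OF s(1,3)]]]
    by (simp add: comp_fctr_assoc[OF sfunctorD(1)[OF i] sfunctorD(1)[OF s(1)] sfunctorD(1)[OF s(3)]]
        comp_fctr_assoc[OF sfunctorD(1)[OF i] sfunctorD(1)[OF s(2)] sfunctorD(1)[OF s(4)]])
  then show ?thesis
    using s sfunctor_comp[OF i s(1)] sfunctor_comp[OF i s(2)] by (simp add: lax_square_def)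
qed

lemma paste_nat:
  assumes sq: "lax_square v u1 u2 w \<alpha> J1 J2 K1 K2" and sq': "lax_square v' u1' u1 w' \<alpha>' J1' J1 K1' K1"
  shows "nat_from_to (\<alpha> \<star> id_nt v') (u2 \<odot> (v \<odot> v')) (w \<odot> (u1 \<odot> v'))"
    "nat_from_to (id_nt w \<star> \<alpha>') (w \<odot> (u1 \<odot> v')) ((w \<odot> w') \<odot> u1')"
    "lax_square (v \<odot> v') u1' u2 (w \<odot> w') (paste w \<alpha> v' \<alpha>') J1' J2 K1' K2"
proof -
  note s = lax_squareD[OF sq] and s' = lax_squareD[OF sq']
  show 1: "nat_from_to (\<alpha> \<star> id_nt v') (u2 \<odot> (v \<odot> v')) (w \<odot> (u1 \<odot> v'))"
    by (rule lax_squareD(5)[OF lax_square_restrict[OF sq s'(1)]])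
  show 2: "nat_from_to (id_nt w \<star> \<alpha>') (w \<odot> (u1 \<odot> v')) ((w \<odot> w') \<odot> u1')"
    using whisker_left_nat[OF s'(5) sfunctorD(1)[OF sfunctor_comp[OF s'(1,3)]] sfunctorD(1)[OF s(4)]]
    by (simp add: comp_fctr_assoc[OF sfunctorD(1)[OF s'(2)] sfunctorD(1)[OF s'(4)]
          sfunctorD(1)[OF s(4)]])
  show "lax_square (v \<odot> v') u1' u2 (w \<odot> w') (paste w \<alpha> v' \<alpha>') J1' J2 K1' K2"
    using s s' sfunctor_comp[OF s'(1) s(1)] sfunctor_comp[OF s'(4) s(4)] vcomp_nat[OF 1 2]
    by (simp add: lax_square_def paste_def)
qed

lemma paste_Cmp:
  assumes sq: "lax_square v u1 u2 w \<alpha> J1 J2 K1 K2" and sq': "lax_square v' u1' u1 w' \<alpha>' J1' J1 K1' K1"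
    and x: "x \<in> Ob J1'"
  shows "Cmp (paste w \<alpha> v' \<alpha>') x = Comp K2 (FA w (Cmp \<alpha>' x)) (Cmp \<alpha> (FO v' x))"
proof -
  note s = lax_squareD[OF sq] and s' = lax_squareD[OF sq']
  show ?thesis
    unfolding paste_def
    using vcomp_Cmp[OF paste_nat(1)[OF sq sq']
        sfunctorD(1)[OF sfunctor_comp[OF sfunctor_comp[OF s'(1) s(1)] s(3)]] x]
      whisker_left_Cmp[OF s'(5) sfunctorD(1)[OF sfunctor_comp[OF s'(1,3)]] sfunctorD(1)[OF s(4)] x]
      whisker_right_Cmp[OF sfunctorD(1)[OF s'(1)] s(5) sfunctorD(1)[OF sfunctor_comp[OF s(1,3)]] x]
    by simp
qed

context prederiv
begin

abbreviation exact where
  "exact v u1 u2 w \<alpha> \<equiv> preserves_universal (PF D v) (PF D u1) (PF D u2) (PF D w) (PN D \<alpha>)"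

lemma functor_square_PF:
  assumes sq: "lax_square v u1 u2 w \<alpha> J1 J2 K1 K2"
  shows "functor_square (PF D v) (PF D w) (PF D u1) (PF D u2) (PN D \<alpha>)
     (PO D J1) (PO D J2) (PO D K1) (PO D K2)"
proof -
  note s = lax_squareD[OF sq]
  show ?thesis
    by unfold_locales
      (use s PF_functor PN_nat[OF s(5) sfunctor_comp[OF s(1,3)]] PF_comp[OF s(1,3)]
        PF_comp[OF s(2,4)] in auto)
qed

lemma exactD:
  assumes sq: "lax_square v u1 u2 w \<alpha> J1 J2 K1 K2" and "exact v u1 u2 w \<alpha>"
    and "universal_arrow (PF D u2) X Y t"
  shows "universal_arrow (PF D u1) (ob v X) (ob w Y) (Comp (PO D J1) (cmp \<alpha> Y) (ar v t))"
  using assms functor_categories(4)[OF PF_functor[OF lax_squareD(2)[OF sq]]]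
  by (auto simp: preserves_universal_def)

lemma exactI:
  assumes sq: "lax_square v u1 u2 w \<alpha> J1 J2 K1 K2"
    and "\<And>X Y t. universal_arrow (PF D u2) X Y t \<Longrightarrow> X \<in> Ob (PO D J2) \<Longrightarrow> Y \<in> Ob (PO D K2) \<Longrightarrow>
      t \<in> hom (PO D J2) X (ob u2 Y) \<Longrightarrow>
      universal_arrow (PF D u1) (ob v X) (ob w Y) (Comp (PO D J1) (cmp \<alpha> Y) (ar v t))"
  shows "exact v u1 u2 w \<alpha>"
  using assms(2) functor_categories(4)[OF PF_functor[OF lax_squareD(2)[OF sq]]]
    universal_arrowD[OF _ PF_functor[OF lax_squareD(3)[OF sq]]]
  by (auto simp: preserves_universal_def)

text \<open>Restriction along a functor that is bijective on the relevant sets of maps neither creates nor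
  destroys universality.\<close>

lemma universal_arrow_restrict:
  assumes i: "sfunctor i P C" and q: "sfunctor q C L" and Y: "Y \<in> Ob (PO D L)"
    and t: "t \<in> hom (PO D C) A (ob q Y)"
    and bij: "\<And>Z. Z \<in> Ob (PO D L) \<Longrightarrow>
      bij_betw (ar i) (hom (PO D C) A (ob q Z)) (hom (PO D P) (ob i A) (ob i (ob q Z)))"
  shows "universal_arrow (PF D (q \<odot> i)) (ob i A) Y (ar i t) \<longleftrightarrow> universal_arrow (PF D q) A Y t"
proof -
  note qi = sfunctor_comp[OF i q]
  note F = functor_categories(3,4)[OF PF_functor[OF q]] functor_categories(3,4)[OF PF_functor[OF qi]]
  have catC: "category (PO D C)" by (rule PO_category[OF sfunctorD(2)[OF q]])
  let ?A = "\<lambda>Z. hom (PO D C) A (ob q Z)" and ?B = "\<lambda>Z. hom (PO D P) (ob i A) (ob i (ob q Z))"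
  have eq: "Comp (PO D P) (ar (q \<odot> i) h) (ar i t) = ar i (Comp (PO D C) (ar q h) t)"
    and in_A: "Comp (PO D C) (ar q h) t \<in> ?A Z"
    if "h \<in> hom (PO D L) Y Z" for h Z
    using ar_comp[OF i q that] ar_Comp[OF i t ar_hom[OF q that]] Comp_hom[OF catC t ar_hom[OF q that]]
    by simp_all
  have *: "(\<forall>g\<in>?B Z. \<exists>!h. h \<in> hom (PO D L) Y Z \<and> Comp (PO D P) (ar (q \<odot> i) h) (ar i t) = g)
      \<longleftrightarrow> (\<forall>g\<in>?A Z. \<exists>!h. h \<in> hom (PO D L) Y Z \<and> Comp (PO D C) (ar q h) t = g)"
    if Z: "Z \<in> Ob (PO D L)" for Z
  proof -
    have img: "?B Z = ar i ` ?A Z" and inj: "inj_on (ar i) (?A Z)"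
      using bij[OF Z] by (auto simp: bij_betw_def)
    have "(h \<in> hom (PO D L) Y Z \<and> Comp (PO D P) (ar (q \<odot> i) h) (ar i t) = ar i g)
        \<longleftrightarrow> (h \<in> hom (PO D L) Y Z \<and> Comp (PO D C) (ar q h) t = g)" if "g \<in> ?A Z" for g h
      using eq in_A inj_onD[OF inj _ in_A that] by auto
    then show ?thesis unfolding img by simp
  qed
  have ti: "ar i t \<in> ?B Y" by (rule ar_hom[OF i t])
  have o: "ob (q \<odot> i) Z = ob i (ob q Z)" if "Z \<in> Ob (PO D L)" for Z by (rule ob_comp[OF i q that])
  show ?thesis
    unfolding universal_arrow_def F using * ti t Y o by simp
qed

text \<open>The criterion by which all squares below are compared: for every universal arrow \<open>X \<rightarrow> u2* Y\<close>, its
  image is a map \<open>v* X \<rightarrow> u1* w* Y\<close>, and \<open>i*\<close> is bijective on maps \<open>v* X \<rightarrow> u1* Z\<close> as soon as the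
  source comes from \<open>v\<close> or the target from \<open>u1\<close> in the way required.\<close>

lemma exact_restrict_iff:
  assumes sq: "lax_square v u1 u2 w \<alpha> J1 J2 K1 K2" and i: "sfunctor i P J1"
    and "coreflective_over i v \<or> reflective_over i u1"
  shows "exact (v \<odot> i) (u1 \<odot> i) u2 w (\<alpha> \<star> id_nt i) \<longleftrightarrow> exact v u1 u2 w \<alpha>"
proof -
  note s = lax_squareD[OF sq]
  note sqi = lax_square_restrict[OF sq i]
  have "universal_arrow (PF D (u1 \<odot> i)) (ob (v \<odot> i) X) (ob w Y)
        (Comp (PO D P) (cmp (\<alpha> \<star> id_nt i) Y) (ar (v \<odot> i) t))
    \<longleftrightarrow> universal_arrow (PF D u1) (ob v X) (ob w Y) (Comp (PO D J1) (cmp \<alpha> Y) (ar v t))"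
    if t: "universal_arrow (PF D u2) X Y t" for X Y t
  proof -
    interpret fs: functor_square "PF D v" "PF D w" "PF D u1" "PF D u2" "PN D \<alpha>" "PO D J1" "PO D J2"
      "PO D K1" "PO D K2" by (rule functor_square_PF[OF sq])
    note Y = universal_arrowD[OF t PF_functor[OF s(3)]]
    note th = fs.transport_hom[OF Y(1,2)]
    have bij: "bij_betw (ar i) (hom (PO D J1) (ob v X) (ob u1 Z))
        (hom (PO D P) (ob i (ob v X)) (ob i (ob u1 Z)))" if "Z \<in> Ob (PO D K1)" for Z
      using assms(3) restriction_bij_coreflective[OF i s(1) _ Y(3) ob_Ob[OF s(2) that]]
        restriction_bij_reflective[OF i s(2) _ that ob_Ob[OF s(1) Y(3)]] by blast
    have "Comp (PO D P) (cmp (\<alpha> \<star> id_nt i) Y) (ar (v \<odot> i) t)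
        = ar i (Comp (PO D J1) (cmp \<alpha> Y) (ar v t))"
      using cmp_whisker_right[OF s(5) i sfunctor_comp[OF s(1,3)] Y(1)] ar_comp[OF i s(1) Y(2)]
        ar_Comp[OF i ar_hom[OF s(1) Y(2)] fs.a_hom[OF Y(1)]] by simp
    then show ?thesis
      using universal_arrow_restrict[OF i s(2) ob_Ob[OF s(4) Y(1)] th bij] ob_comp[OF i s(1) Y(3)]
      by simp
  qed
  then show ?thesis
    using functor_categories(4)[OF PF_functor[OF s(2)]]
      functor_categories(4)[OF PF_functor[OF lax_squareD(2)[OF sqi]]]
    by (simp add: preserves_universal_def)
qed

lemma exact_id:
  assumes u: "sfunctor u J K"
  shows "exact (id_fctr J) u u (id_fctr K) (id_nt u)"
proof -
  note s = sfunctorD[OF u]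
  show ?thesis
  proof (rule exactI[OF identity_lax_square[OF u]])
    fix X Y t assume t: "universal_arrow (PF D u) X Y t" and X: "X \<in> Ob (PO D J)"
      and Y: "Y \<in> Ob (PO D K)" and th: "t \<in> hom (PO D J) X (ob u Y)"
    show "universal_arrow (PF D u) (ob (id_fctr J) X) (ob (id_fctr K) Y)
        (Comp (PO D J) (cmp (id_nt u) Y) (ar (id_fctr J) t))"
      using t X Y th PF_id[OF s(2)] PF_id[OF s(3)] cmp_id[OF u Y] homD(1)[OF th]
        Comp_Id_left[OF PO_category[OF s(2)] th] by simp
  qed
qed

lemma paste_transport:
  assumes sq: "lax_square v u1 u2 w \<alpha> J1 J2 K1 K2" and sq': "lax_square v' u1' u1 w' \<alpha>' J1' J1 K1' K1"
    and Y: "Y \<in> Ob (PO D K2)" and t: "t \<in> hom (PO D J2) X (ob u2 Y)"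
  shows "Comp (PO D J1') (cmp (paste w \<alpha> v' \<alpha>') Y) (ar (v \<odot> v') t)
    = Comp (PO D J1') (cmp \<alpha>' (ob w Y)) (ar v' (Comp (PO D J1) (cmp \<alpha> Y) (ar v t)))"
proof -
  note s = lax_squareD[OF sq] and s' = lax_squareD[OF sq'] and n = paste_nat[OF sq sq']
  interpret fs: functor_square "PF D v" "PF D w" "PF D u1" "PF D u2" "PN D \<alpha>" "PO D J1" "PO D J2"
    "PO D K1" "PO D K2" by (rule functor_square_PF[OF sq])
  interpret fs': functor_square "PF D v'" "PF D w'" "PF D u1'" "PF D u1" "PN D \<alpha>'" "PO D J1'"
    "PO D J1" "PO D K1'" "PO D K1" by (rule functor_square_PF[OF sq'])
  have "cmp (paste w \<alpha> v' \<alpha>') Y = Comp (PO D J1') (cmp \<alpha>' (ob w Y)) (ar v' (cmp \<alpha> Y))"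
    using cmp_vcomp[OF sfunctor_comp[OF sfunctor_comp[OF s'(1) s(1)] s(3)] n(1,2) Y]
      cmp_whisker_left[OF s'(5) sfunctor_comp[OF s'(1,3)] s(4) Y]
      cmp_whisker_right[OF s(5) s'(1) sfunctor_comp[OF s(1,3)] Y]
    by (simp add: paste_def)
  then show ?thesis
    using ar_comp[OF s'(1) s(1) t] ar_Comp[OF s'(1) ar_hom[OF s(1) t] fs.a_hom[OF Y]]
      Comp_assoc[OF fs'.cats(1) ar_hom[OF s'(1) ar_hom[OF s(1) t]] ar_hom[OF s'(1) fs.a_hom[OF Y]]
        fs'.a_hom[OF ob_Ob[OF s(4) Y]]]
    by simp
qed

text \<open>In terms of universal arrows pasting is just composition of two implications.\<close>

lemma exact_paste:
  assumes sq: "lax_square v u1 u2 w \<alpha> J1 J2 K1 K2" and sq': "lax_square v' u1' u1 w' \<alpha>' J1' J1 K1' K1"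
    and ex: "exact v u1 u2 w \<alpha>" and ex': "exact v' u1' u1 w' \<alpha>'"
  shows "exact (v \<odot> v') u1' u2 (w \<odot> w') (paste w \<alpha> v' \<alpha>')"
proof (rule exactI[OF paste_nat(3)[OF sq sq']])
  note s = lax_squareD[OF sq] and s' = lax_squareD[OF sq']
  fix X Y t assume t: "universal_arrow (PF D u2) X Y t" and X: "X \<in> Ob (PO D J2)"
    and Y: "Y \<in> Ob (PO D K2)" and th: "t \<in> hom (PO D J2) X (ob u2 Y)"
  show "universal_arrow (PF D u1') (ob (v \<odot> v') X) (ob (w \<odot> w') Y)
      (Comp (PO D J1') (cmp (paste w \<alpha> v' \<alpha>') Y) (ar (v \<odot> v') t))"
    using exactD[OF sq' ex' exactD[OF sq ex t]] paste_transport[OF sq sq' Y th]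
      ob_comp[OF s'(1) s(1) X] ob_comp[OF s'(4) s(4) Y] by simp
qed

end

section \<open>Exactness in the presence of Kan extensions\<close>

locale prederiv_kan = prederiv D for D :: "('s::small_universe, 'b, 'c) prederiv" +
  assumes kan: "Der3 D"
begin

lemma ex_left_adjoint: "sfunctor u J K \<Longrightarrow> \<exists>L \<eta> \<epsilon>. adjunction L (PF D u) \<eta> \<epsilon>"
  using kan by (simp add: Der3_def)

lemma ex_right_adjoint: "sfunctor u J K \<Longrightarrow> \<exists>R \<eta> \<epsilon>. adjunction (PF D u) R \<eta> \<epsilon>"
  using kan by (simp add: Der3_def)

lemma ex_universal:
  assumes u: "sfunctor u J K" and X: "X \<in> Ob (PO D J)"
  shows "\<exists>Y t. universal_arrow (PF D u) X Y t"
  using ex_left_adjoint[OF u] unit_universal[OF _ PF_functor[OF u] X] by blast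

lemma ex_couniversal:
  assumes u: "sfunctor u J K" and X: "X \<in> Ob (PO D J)"
  shows "\<exists>Y t. couniversal_arrow (PF D u) X Y t"
proof -
  obtain R \<eta> \<epsilon> where a: "adjunction (PF D u) R \<eta> \<epsilon>" using ex_right_adjoint[OF u] by blast
  show ?thesis
    using unit_universal[OF op_adjunction[OF a] op_functor[OF PF_functor[OF u]]] X
    unfolding couniversal_arrow_op by auto
qed

lemma exact_left_iff:
  assumes sq: "lax_square v u1 u2 w \<alpha> J1 J2 K1 K2"
  shows "exact_left D v u1 u2 w \<alpha> \<longleftrightarrow> exact v u1 u2 w \<alpha>"
proof -
  interpret fs: functor_square "PF D v" "PF D w" "PF D u1" "PF D u2" "PN D \<alpha>" "PO D J1" "PO D J2"
    "PO D K1" "PO D K2" by (rule functor_square_PF[OF sq])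
  show ?thesis
    using ex_left_adjoint[OF lax_squareD(2)[OF sq]] ex_left_adjoint[OF lax_squareD(3)[OF sq]]
      fs.nat_iso_beck_chevalley_left
    unfolding exact_left_def bc_left_def by blast
qed

text \<open>The two Beck--Chevalley transformations of one square are conjugate, hence invertible at the
  same time. In the right-hand version \<open>u1\<close>, \<open>v\<close> and \<open>w\<close>, \<open>u2\<close> exchange their roles.\<close>

lemma exact_right_iff:
  assumes sq: "lax_square v u1 u2 w \<alpha> J1 J2 K1 K2"
  shows "exact_right D u1 v w u2 \<alpha> \<longleftrightarrow> exact v u1 u2 w \<alpha>"
proof -
  note s = lax_squareD[OF sq]
  interpret fs: functor_square "PF D v" "PF D w" "PF D u1" "PF D u2" "PN D \<alpha>" "PO D J1" "PO D J2"
    "PO D K1" "PO D K2" by (rule functor_square_PF[OF sq])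
  have "exact_right D u1 v w u2 \<alpha>
      \<longleftrightarrow> preserves_couniversal (PF D u1) (PF D v) (PF D w) (PF D u2) (PN D \<alpha>)"
    using ex_right_adjoint[OF s(1)] ex_right_adjoint[OF s(4)]
      nat_iso_beck_chevalley_right[OF fs.R1 fs.R2 fs.V fs.W fs.a]
    unfolding exact_right_def bc_right_def by blast
  then show ?thesis
    using fs.preserves_universal_iff_couniversal ex_universal[OF s(3)] ex_couniversal[OF s(4)] by blast
qed

text \<open>Let the square be pasted, at every object \<open>k\<close>, with an exact square over \<open>k\<close>. The
  comparison of the candidate with a universal arrow restricts at \<open>k\<close> to the comparison of two
  universal arrows, an isomorphism; by (Der2) the comparison itself is one.\<close>

lemma exact_if_pointwise:
  assumes Der2: "Der2 D" and sq: "lax_square v u1 u2 w \<alpha> J1 J2 K1 K2"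
    and sqk: "\<And>k. k \<in> Ob K1 \<Longrightarrow> lax_square (s k) (q k) u1 (point K1 k) (\<sigma> k) (S k) J1 terminal_cat K1"
    and ex: "\<And>k. k \<in> Ob K1 \<Longrightarrow> exact (s k) (q k) u1 (point K1 k) (\<sigma> k)"
    and exp: "\<And>k. k \<in> Ob K1 \<Longrightarrow>
      exact (v \<odot> s k) (q k) u2 (w \<odot> point K1 k) (paste w \<alpha> (s k) (\<sigma> k))"
  shows "exact v u1 u2 w \<alpha>"
proof (rule exactI[OF sq])
  note s = lax_squareD[OF sq]
  interpret fs: functor_square "PF D v" "PF D w" "PF D u1" "PF D u2" "PN D \<alpha>" "PO D J1" "PO D J2"
    "PO D K1" "PO D K2" by (rule functor_square_PF[OF sq])
  fix X Y t assume t: "universal_arrow (PF D u2) X Y t" and X: "X \<in> Ob (PO D J2)"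
    and Y: "Y \<in> Ob (PO D K2)" and th: "t \<in> hom (PO D J2) X (ob u2 Y)"
  define \<theta> where "\<theta> = Comp (PO D J1) (cmp \<alpha> Y) (ar v t)"
  have \<theta>: "\<theta> \<in> hom (PO D J1) (ob v X) (ob u1 (ob w Y))"
    unfolding \<theta>_def by (rule fs.transport_hom[OF Y th])
  obtain Z r where r: "universal_arrow (PF D u1) (ob v X) Z r"
    using ex_universal[OF s(2) ob_Ob[OF s(1) X]] by blast
  note Z = universal_arrowD[OF r PF_functor[OF s(2)]]
  obtain f where f: "f \<in> hom (PO D K1) Z (ob w Y)" "Comp (PO D J1) (ar u1 f) r = \<theta>"
    using universal_arrow_factor[OF r PF_functor[OF s(2)] ob_Ob[OF s(4) Y] \<theta>] .
  have "is_iso (PO D terminal_cat) (ar (point K1 k) f)" if k: "k \<in> Ob K1" for k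
  proof -
    note sk = sqk[OF k]
    note s' = lax_squareD[OF sk]
    interpret fk: functor_square "PF D (s k)" "PF D (point K1 k)" "PF D (q k)" "PF D u1" "PN D (\<sigma> k)"
      "PO D (S k)" "PO D J1" "PO D terminal_cat" "PO D K1" by (rule functor_square_PF[OF sk])
    have "universal_arrow (PF D (q k)) (ob (s k) (ob v X)) (ob (point K1 k) (ob w Y))
        (Comp (PO D (S k)) (cmp (\<sigma> k) (ob w Y)) (ar (s k) \<theta>))"
      using exactD[OF paste_nat(3)[OF sq sk] exp[OF k] t] paste_transport[OF sq sk Y th]
        ob_comp[OF s'(1) s(1) X] ob_comp[OF s'(4) s(4) Y] by (simp add: \<theta>_def)
    then show ?thesis
      using fk.transport_Comp[OF Z(2) f(1)] f(2)
        universal_arrow_iso[OF exactD[OF sk ex[OF k] r] PF_functor[OF s'(2)] ar_hom[OF s'(4) f(1)]]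
      by simp
  qed
  then have "is_iso (PO D K1) f"
    using Der2 sfunctorD(2)[OF s(4)] homD(1)[OF f(1)] unfolding Der2_def by blast
  then show "universal_arrow (PF D u1) (ob v X) (ob w Y) (Comp (PO D J1) (cmp \<alpha> Y) (ar v t))"
    using universal_arrow_iso[OF r PF_functor[OF s(2)] f(1)] f(2) by (simp add: \<theta>_def)
qed

end

section \<open>Comma categories and slices\<close>

lemma pair_eq_iff [simp]: "pair a b = pair c d \<longleftrightarrow> a = c \<and> b = d"
  by (metis pfst_pair psnd_pair)

lemma small_dependent_pairs:
  assumes "small A" "\<And>a. a \<in> A \<Longrightarrow> small (B a)"
  shows "small {pair a b | a b. a \<in> A \<and> b \<in> B a}"
proof -
  have "{pair a b | a b. a \<in> A \<and> b \<in> B a} = (\<Union>a\<in>A. pair a ` B a)" by auto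
  then show ?thesis using small_Union[OF assms(1)] small_image[OF assms(2)] by simp
qed

lemma labelled_Ob [simp]: "Ob (labelled_cat X H i c) = X"
  by (simp add: labelled_cat_def Let_def)

lemma labelled_Ar:
  "Ar (labelled_cat X H i c) = {pair (pair x y) l | x y l. x \<in> X \<and> y \<in> X \<and> l \<in> H x y}"
  by (simp add: labelled_cat_def Let_def)

lemma labelled_hom:
  "m \<in> hom (labelled_cat X H i c) x y \<longleftrightarrow> x \<in> X \<and> y \<in> X \<and> (\<exists>l\<in>H x y. m = pair (pair x y) l)"
proof
  have dc: "Dom (labelled_cat X H i c) a = pfst (pfst a)" "Cod (labelled_cat X H i c) a = psnd (pfst a)"
    if "a \<in> Ar (labelled_cat X H i c)" for a
    using that by (simp_all add: labelled_cat_def Let_def)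
  {
    assume m: "m \<in> hom (labelled_cat X H i c) x y"
    obtain x' y' l where "m = pair (pair x' y') l" "x' \<in> X" "y' \<in> X" "l \<in> H x' y'"
      using homD(1)[OF m] unfolding labelled_Ar by blast
    moreover have "x = pfst (pfst m)" "y = psnd (pfst m)" using dc homD[OF m] by auto
    ultimately show "x \<in> X \<and> y \<in> X \<and> (\<exists>l\<in>H x y. m = pair (pair x y) l)" by auto
  }
  assume "x \<in> X \<and> y \<in> X \<and> (\<exists>l\<in>H x y. m = pair (pair x y) l)"
  then obtain l where "x \<in> X" "y \<in> X" "l \<in> H x y" and m: "m = pair (pair x y) l" by blast
  then have "m \<in> Ar (labelled_cat X H i c)" unfolding labelled_Ar by blast
  then show "m \<in> hom (labelled_cat X H i c) x y" using dc m by (intro homI) simp_all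
qed

lemma labelled_Id: "x \<in> X \<Longrightarrow> Id (labelled_cat X H i c) x = pair (pair x x) (i x)"
  by (simp add: labelled_cat_def Let_def)

lemma labelled_Comp:
  "x \<in> X \<Longrightarrow> y \<in> X \<Longrightarrow> z \<in> X \<Longrightarrow> l \<in> H x y \<Longrightarrow> m \<in> H y z \<Longrightarrow>
   Comp (labelled_cat X H i c) (pair (pair y z) m) (pair (pair x y) l) = pair (pair x z) (c m l)"
  using labelled_hom[of "pair (pair x y) l" X H i c x y] labelled_hom[of "pair (pair y z) m" X H i c y z]
  by (auto simp: labelled_cat_def Let_def)

lemma labelled_category:
  assumes i: "\<And>x. x \<in> X \<Longrightarrow> i x \<in> H x x"
    and c: "\<And>x y z l m. x \<in> X \<Longrightarrow> y \<in> X \<Longrightarrow> z \<in> X \<Longrightarrow> l \<in> H x y \<Longrightarrow> m \<in> H y z \<Longrightarrow> c m l \<in> H x z"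
    and r: "\<And>x y l. x \<in> X \<Longrightarrow> y \<in> X \<Longrightarrow> l \<in> H x y \<Longrightarrow> c l (i x) = l"
    and l: "\<And>x y l. x \<in> X \<Longrightarrow> y \<in> X \<Longrightarrow> l \<in> H x y \<Longrightarrow> c (i y) l = l"
    and a: "\<And>x y z t l m n. x \<in> X \<Longrightarrow> y \<in> X \<Longrightarrow> z \<in> X \<Longrightarrow> t \<in> X \<Longrightarrow> l \<in> H x y \<Longrightarrow> m \<in> H y z \<Longrightarrow>
      n \<in> H z t \<Longrightarrow> c n (c m l) = c (c n m) l"
  shows "category (labelled_cat X H i c)" (is "category ?C")
proof -
  note h = labelled_hom[of _ X H i c]
  have dc: "Dom ?C (pair (pair x y) l) = x" "Cod ?C (pair (pair x y) l) = y"
    if "x \<in> X" "y \<in> X" "l \<in> H x y" for x y l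
    using h[of "pair (pair x y) l" x y] that by (auto simp: hom_def)
  have arE: "\<exists>x y l. f = pair (pair x y) l \<and> x \<in> X \<and> y \<in> X \<and> l \<in> H x y" if "f \<in> Ar ?C" for f
    using that by (auto simp: labelled_Ar)
  have idh: "Id ?C x \<in> hom ?C x x" if "x \<in> X" for x
    using that i by (auto simp: h labelled_Id)
  have ch: "Comp ?C g f \<in> hom ?C (Dom ?C f) (Cod ?C g)"
    if "f \<in> Ar ?C" "g \<in> Ar ?C" "Cod ?C f = Dom ?C g" for f g
    using arE[OF that(1)] arE[OF that(2)] that(3) by (auto simp: h labelled_Comp dc c)
  have un: "Comp ?C f (Id ?C (Dom ?C f)) = f \<and> Comp ?C (Id ?C (Cod ?C f)) f = f" if "f \<in> Ar ?C" for f
    using arE[OF that] by (auto simp: dc labelled_Comp labelled_Id i r l)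
  have as: "Comp ?C k (Comp ?C g f) = Comp ?C (Comp ?C k g) f"
    if "f \<in> Ar ?C" "g \<in> Ar ?C" "k \<in> Ar ?C" "Cod ?C f = Dom ?C g" "Cod ?C g = Dom ?C k" for f g k
    using arE[OF that(1)] arE[OF that(2)] arE[OF that(3)] that(4,5)
    by (auto simp: dc labelled_Comp c a)
  have ex: "Dom ?C \<in> extensional (Ar ?C)" "Cod ?C \<in> extensional (Ar ?C)" "Id ?C \<in> extensional (Ob ?C)"
    by (simp_all add: labelled_cat_def Let_def)
  have un': "Comp ?C g f = undefined" if "\<not> (f \<in> Ar ?C \<and> g \<in> Ar ?C \<and> Cod ?C f = Dom ?C g)" for f g
  proof -
    have "f \<in> Ar ?C \<Longrightarrow> g \<in> Ar ?C \<Longrightarrow> psnd (pfst f) \<noteq> pfst (pfst g)"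
      using that arE[of f] arE[of g] dc by fastforce
    then show ?thesis unfolding labelled_Ar by (auto simp: labelled_cat_def Let_def)
  qed
  have do: "Dom ?C f \<in> Ob ?C \<and> Cod ?C f \<in> Ob ?C" if "f \<in> Ar ?C" for f
    using arE[OF that] dc by auto
  show ?thesis
    unfolding category_def using idh ch un as ex un' do by simp
qed

lemma labelled_small_cat:
  assumes "category (labelled_cat X H i c)" "small X" "\<And>x y. x \<in> X \<Longrightarrow> y \<in> X \<Longrightarrow> small (H x y)"
  shows "small_cat (labelled_cat X H i c)"
proof -
  have "Ar (labelled_cat X H i c) = (\<Union>x\<in>X. \<Union>y\<in>X. pair (pair x y) ` H x y)"
    by (auto simp: labelled_Ar)
  then have "small (Ar (labelled_cat X H i c))" using assms(2,3) by (simp add: small_Union small_image)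
  then show ?thesis using assms by (simp add: small_cat_def)
qed

lemma terminal_cat_simps [simp]:
  "Ob terminal_cat = {tag0}" "Ar terminal_cat = {tag0}" "Id terminal_cat tag0 = tag0"
  "Dom terminal_cat tag0 = tag0" "Cod terminal_cat tag0 = tag0"
  "Comp terminal_cat tag0 tag0 = tag0" "hom terminal_cat tag0 tag0 = {tag0}"
  by (auto simp: terminal_cat_def hom_def)

lemma terminal_small_cat: "small_cat terminal_cat"
  by (auto simp: small_cat_def category_def terminal_cat_def hom_def small_finite)

lemma to_terminal_sfunctor:
  assumes "small_cat J"
  shows "sfunctor (to_terminal J) J terminal_cat"
proof -
  have J: "category J" using assms by (simp add: small_cat_def)
  have "functor_from_to (to_terminal J) J terminal_cat"
    by (rule functorI)
      (use J terminal_small_cat hom_objects[OF J Ar_hom] homD(1)[OF Id_hom[OF J]]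
          homD(1)[OF Comp_hom[OF J]] in
        \<open>auto simp: to_terminal_def small_cat_def hom_def\<close>)
  then show ?thesis using assms terminal_small_cat by (simp add: sfunctor_def)
qed

lemma point_sfunctor:
  assumes K: "small_cat K" and k: "k \<in> Ob K"
  shows "sfunctor (point K k) terminal_cat K"
proof -
  have c: "category K" using K by (simp add: small_cat_def)
  have "functor_from_to (point K k) terminal_cat K"
    by (rule functorI)
      (use c k terminal_small_cat Id_hom[OF c k] Comp_Id_left[OF c Id_hom[OF c k]] in
        \<open>auto simp: point_def small_cat_def terminal_cat_def\<close>)
  then show ?thesis using K terminal_small_cat by (simp add: sfunctor_def)
qed

lemma point_simps [simp]:
  "Src (point K k) = terminal_cat" "Tgt (point K k) = K" "FO (point K k) tag0 = k"
  "FA (point K k) tag0 = Id K k"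
  by (simp_all add: point_def)

lemma comp_point:
  assumes u: "sfunctor u J K" and j: "j \<in> Ob J"
  shows "u \<odot> point J j = point K (FO u j)"
  by (rule functor_eqI_arrows[OF sfunctorD(1)[OF sfunctor_comp[OF point_sfunctor u]]
        sfunctorD(1)[OF point_sfunctor]])
    (use sfunctorD[OF u] j functor_ob[OF sfunctorD(1)[OF u] j]
        functor_Id[OF sfunctorD(1)[OF u] j] in simp_all)

locale comma =
  fixes u1 u2 :: "'s::small_universe sfctr" and J1 J2 K :: "'s scat"
  assumes u1: "sfunctor u1 J1 K" and u2: "sfunctor u2 J2 K"
begin

abbreviation C where "C \<equiv> comma_cat u1 u2"

lemmas f1 = sfunctorD(1)[OF u1] and f2 = sfunctorD(1)[OF u2]
lemmas s1 = sfunctorD[OF u1] and s2 = sfunctorD[OF u2]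

lemma comma_Ob:
  "x \<in> Ob C \<longleftrightarrow> (\<exists>j1 j2 a. x = pair j1 (pair j2 a) \<and> j1 \<in> Ob J1 \<and> j2 \<in> Ob J2 \<and>
     a \<in> hom K (FO u1 j1) (FO u2 j2))"
  by (simp add: comma_cat_def s1 s2)

lemma comma_Ob_pair:
  "pair j1 (pair j2 a) \<in> Ob C \<longleftrightarrow> j1 \<in> Ob J1 \<and> j2 \<in> Ob J2 \<and> a \<in> hom K (FO u1 j1) (FO u2 j2)"
  unfolding comma_Ob by (metis pfst_pair psnd_pair)

lemma comma_hom:
  "m \<in> hom C x y \<longleftrightarrow> x \<in> Ob C \<and> y \<in> Ob C \<and> (\<exists>g1 g2. m = pair (pair x y) (pair g1 g2) \<and>
     g1 \<in> hom J1 (pfst x) (pfst y) \<and> g2 \<in> hom J2 (pfst (psnd x)) (pfst (psnd y)) \<and>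
     Comp K (psnd (psnd y)) (FA u1 g1) = Comp K (FA u2 g2) (psnd (psnd x)))"
  unfolding comma_cat_def labelled_hom labelled_Ob s1 s2 by auto

lemma comma_hom_pair:
  "pair (pair x y) (pair g1 g2) \<in> hom C x y \<longleftrightarrow> x \<in> Ob C \<and> y \<in> Ob C \<and>
     g1 \<in> hom J1 (pfst x) (pfst y) \<and> g2 \<in> hom J2 (pfst (psnd x)) (pfst (psnd y)) \<and>
     Comp K (psnd (psnd y)) (FA u1 g1) = Comp K (FA u2 g2) (psnd (psnd x))"
  unfolding comma_hom by (metis pfst_pair psnd_pair)

lemma comma_objD:
  assumes "x \<in> Ob C"
  shows "pfst x \<in> Ob J1" "pfst (psnd x) \<in> Ob J2"
    "psnd (psnd x) \<in> hom K (FO u1 (pfst x)) (FO u2 (pfst (psnd x)))"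
  using assms by (auto simp: comma_Ob)

lemma comma_homD:
  assumes "m \<in> hom C x y"
  shows "x \<in> Ob C" "y \<in> Ob C" "m = pair (pair x y) (pair (pfst (psnd m)) (psnd (psnd m)))"
    "pfst (psnd m) \<in> hom J1 (pfst x) (pfst y)"
    "psnd (psnd m) \<in> hom J2 (pfst (psnd x)) (pfst (psnd y))"
    "Comp K (psnd (psnd y)) (FA u1 (pfst (psnd m))) = Comp K (FA u2 (psnd (psnd m))) (psnd (psnd x))"
  using assms by (auto simp: comma_hom)

lemma comma_Id:
  "x \<in> Ob C \<Longrightarrow> Id C x = pair (pair x x) (pair (Id J1 (pfst x)) (Id J2 (pfst (psnd x))))"
  unfolding comma_cat_def labelled_Ob by (subst labelled_Id) (simp_all add: s1 s2)

lemma comma_Comp: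
  assumes "m \<in> hom C x y" "n \<in> hom C y z"
  shows "Comp C n m = pair (pair x z) (pair (Comp J1 (pfst (psnd n)) (pfst (psnd m)))
     (Comp J2 (psnd (psnd n)) (psnd (psnd m))))"
proof -
  obtain l1 l2 where m: "m = pair (pair x y) (pair l1 l2)" and n: "\<exists>k1 k2. n = pair (pair y z) (pair k1 k2)"
    using comma_homD(3)[OF assms(1)] comma_homD(3)[OF assms(2)] by blast
  then obtain k1 k2 where n: "n = pair (pair y z) (pair k1 k2)" by blast
  show ?thesis
    using assms unfolding m n comma_hom unfolding comma_cat_def labelled_Ob
    by (subst labelled_Comp) (auto simp: s1 s2)
qed

lemma comma_square_Comp:
  assumes x: "a \<in> hom K (FO u1 x1) (FO u2 x2)" and y: "b \<in> hom K (FO u1 y1) (FO u2 y2)"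
    and z: "c \<in> hom K (FO u1 z1) (FO u2 z2)"
    and g: "g1 \<in> hom J1 x1 y1" "g2 \<in> hom J2 x2 y2" "Comp K b (FA u1 g1) = Comp K (FA u2 g2) a"
    and h: "h1 \<in> hom J1 y1 z1" "h2 \<in> hom J2 y2 z2" "Comp K c (FA u1 h1) = Comp K (FA u2 h2) b"
  shows "Comp K c (FA u1 (Comp J1 h1 g1)) = Comp K (FA u2 (Comp J2 h2 g2)) a"
proof -
  note K = Comp_assoc[OF s1(5)]
  note F = functor_hom[OF f1 g(1)] functor_hom[OF f1 h(1)] functor_hom[OF f2 g(2)]
    functor_hom[OF f2 h(2)]
  have "Comp K c (FA u1 (Comp J1 h1 g1)) = Comp K (Comp K c (FA u1 h1)) (FA u1 g1)"
    using functor_Comp[OF f1 g(1) h(1)] K[OF F(1,2) z] by simp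
  also have "\<dots> = Comp K (FA u2 h2) (Comp K b (FA u1 g1))" using h(3) K[OF F(1) y F(4)] by simp
  also have "\<dots> = Comp K (Comp K (FA u2 h2) (FA u2 g2)) a" using g(3) K[OF x F(3,4)] by simp
  finally show ?thesis using functor_Comp[OF f2 g(2) h(2)] by simp
qed

lemma comma_category: "category C"
  unfolding comma_cat_def s1 s2
proof (rule labelled_category, goal_cases)
  case (1 x)
  then show ?case
    using Id_hom[OF s1(4)] Id_hom[OF s2(4)] functor_Id[OF f1] functor_Id[OF f2]
      Comp_Id_left[OF s1(5)] Comp_Id_right[OF s1(5)] by auto
next
  case (2 x y z l m)
  then show ?case
    using Comp_hom[OF s1(4)] Comp_hom[OF s2(4)] comma_square_Comp by fastforce
next
  case (3 x y l)
  then show ?case using Comp_Id_right[OF s1(4)] Comp_Id_right[OF s2(4)] by auto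
next
  case (4 x y l)
  then show ?case using Comp_Id_left[OF s1(4)] Comp_Id_left[OF s2(4)] by auto
next
  case (5 x y z t l m n)
  then show ?case using Comp_assoc[OF s1(4)] Comp_assoc[OF s2(4)] by auto
qed

lemma comma_small_cat: "small_cat C"
proof -
  have sm: "small (Ob J1)" "small (Ar J1)" "small (Ob J2)" "small (Ar J2)" "small (Ar K)"
    using s1 s2 by (auto simp: small_cat_def)
  have "small {pair j1 z | j1 z. j1 \<in> Ob J1 \<and> z \<in> {pair j2 a | j2 a. j2 \<in> Ob J2 \<and> a \<in> Ar K}}"
    using sm by (intro small_dependent_pairs)
  then have ob: "small (Ob C)"
    by (rule small_subset) (use comma_Ob homD(1) in fastforce)
  have ar: "small {pair g1 g2 | g1 g2. g1 \<in> Ar J1 \<and> g2 \<in> Ar J2}"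
    using sm by (intro small_dependent_pairs)
  show ?thesis
    using comma_category ob unfolding comma_cat_def
    by (intro labelled_small_cat) (auto intro!: small_subset[OF ar] simp: s1 s2 hom_def)
qed

lemma comma_pr_simps [simp]:
  "Src (comma_pr1 u1 u2) = C" "Tgt (comma_pr1 u1 u2) = J1"
  "Src (comma_pr2 u1 u2) = C" "Tgt (comma_pr2 u1 u2) = J2"
  "x \<in> Ob C \<Longrightarrow> FO (comma_pr1 u1 u2) x = pfst x"
  "x \<in> Ob C \<Longrightarrow> FO (comma_pr2 u1 u2) x = pfst (psnd x)"
  "m \<in> Ar C \<Longrightarrow> FA (comma_pr1 u1 u2) m = pfst (psnd m)"
  "m \<in> Ar C \<Longrightarrow> FA (comma_pr2 u1 u2) m = psnd (psnd m)"
  by (simp_all add: comma_pr1_def comma_pr2_def s1 s2)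

lemma comma_pr_sfunctor:
  "sfunctor (comma_pr1 u1 u2) C J1" "sfunctor (comma_pr2 u1 u2) C J2"
proof -
  have I: "Id C x \<in> Ar C" if "x \<in> Ob C" for x using homD(1)[OF Id_hom[OF comma_category that]] .
  have Cm: "Comp C g f \<in> Ar C" "pfst (psnd (Comp C g f)) = Comp J1 (pfst (psnd g)) (pfst (psnd f))"
    "psnd (psnd (Comp C g f)) = Comp J2 (psnd (psnd g)) (psnd (psnd f))"
    if "f \<in> Ar C" "g \<in> Ar C" "Cod C f = Dom C g" for f g
  proof -
    have f: "f \<in> hom C (Dom C f) (Dom C g)" using that by (simp add: hom_def)
    show "Comp C g f \<in> Ar C" using homD(1)[OF Comp_hom[OF comma_category f Ar_hom[OF that(2)]]] .
    show "pfst (psnd (Comp C g f)) = Comp J1 (pfst (psnd g)) (pfst (psnd f))"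
      "psnd (psnd (Comp C g f)) = Comp J2 (psnd (psnd g)) (psnd (psnd f))"
      using comma_Comp[OF f Ar_hom[OF that(2)]] by simp_all
  qed
  have "functor_from_to (comma_pr1 u1 u2) C J1"
    by (rule functorI)
      (use comma_category s1 comma_objD comma_homD[OF Ar_hom] I Cm comma_Id in
        \<open>auto simp: comma_pr1_def\<close>)
  moreover have "functor_from_to (comma_pr2 u1 u2) C J2"
    by (rule functorI)
      (use comma_category s2 comma_objD comma_homD[OF Ar_hom] I Cm comma_Id in
        \<open>auto simp: comma_pr2_def\<close>)
  ultimately show "sfunctor (comma_pr1 u1 u2) C J1" "sfunctor (comma_pr2 u1 u2) C J2"
    using comma_small_cat s1 s2 by (simp_all add: sfunctor_def)
qed

lemma comma_nt_Cmp: "x \<in> Ob C \<Longrightarrow> Cmp (comma_nt u1 u2) x = psnd (psnd x)"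
  by (simp add: comma_nt_def)

lemma comma_lax_square:
  "lax_square (comma_pr1 u1 u2) (comma_pr2 u1 u2) u1 u2 (comma_nt u1 u2) C J1 J2 K"
proof -
  note p1 = comma_pr_sfunctor(1) and p2 = comma_pr_sfunctor(2)
  have "nat_from_to (comma_nt u1 u2) (u1 \<odot> comma_pr1 u1 u2) (u2 \<odot> comma_pr2 u1 u2)"
  proof (rule natI[OF sfunctorD(1)[OF sfunctor_comp[OF p1 u1]] sfunctorD(1)[OF sfunctor_comp[OF p2 u2]]])
    show "Comp K (Cmp (comma_nt u1 u2) y) (FA (u1 \<odot> comma_pr1 u1 u2) f)
        = Comp K (FA (u2 \<odot> comma_pr2 u1 u2) f) (Cmp (comma_nt u1 u2) x)"
      if f: "f \<in> hom C x y" and "x \<in> Ob C" "y \<in> Ob C" for f x y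
      using that comma_homD[OF f] homD(1)[OF f] by (simp add: comma_nt_Cmp)
  qed (use comma_objD in \<open>auto simp: comma_nt_def\<close>)
  then show ?thesis using p1 p2 u1 u2 by (simp add: lax_square_def)
qed

end

lemma (in comma) comma_functor_eqI:
  assumes F: "sfunctor F L C" and G: "sfunctor G L C"
    and "comma_pr1 u1 u2 \<odot> F = comma_pr1 u1 u2 \<odot> G" "comma_pr2 u1 u2 \<odot> F = comma_pr2 u1 u2 \<odot> G"
    and eq: "\<And>x. x \<in> Ob L \<Longrightarrow> psnd (psnd (FO F x)) = psnd (psnd (FO G x))"
  shows "F = G"
proof -
  note fF = sfunctorD(1)[OF F] and fG = sfunctorD(1)[OF G]
  have o: "FO F x = FO G x" if x: "x \<in> Ob L" for x
  proof -
    have "pfst (FO F x) = pfst (FO G x)"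
      using arg_cong[OF assms(3), of "\<lambda>H. FO H x"] x sfunctorD[OF F] sfunctorD[OF G]
        functor_ob[OF fF x] functor_ob[OF fG x] by simp
    moreover have "pfst (psnd (FO F x)) = pfst (psnd (FO G x))"
      using arg_cong[OF assms(4), of "\<lambda>H. FO H x"] x sfunctorD[OF F] sfunctorD[OF G]
        functor_ob[OF fF x] functor_ob[OF fG x] by simp
    ultimately show ?thesis
      using eq[OF x] functor_ob[OF fF x] functor_ob[OF fG x] unfolding comma_Ob by auto
  qed
  show ?thesis
  proof (rule functor_eqI[OF fF fG o])
    fix m assume m: "m \<in> Ar L"
    note mh = Ar_hom[OF m]
    note xy = hom_objects[OF sfunctorD(4)[OF F] mh]
    note Fm = functor_hom[OF fF mh] and Gm = functor_hom[OF fG mh]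
    have "pfst (psnd (FA F m)) = pfst (psnd (FA G m))"
      using arg_cong[OF assms(3), of "\<lambda>H. FA H m"] m sfunctorD[OF F] sfunctorD[OF G]
        homD(1)[OF Fm] homD(1)[OF Gm] by simp
    moreover have "psnd (psnd (FA F m)) = psnd (psnd (FA G m))"
      using arg_cong[OF assms(4), of "\<lambda>H. FA H m"] m sfunctorD[OF F] sfunctorD[OF G]
        homD(1)[OF Fm] homD(1)[OF Gm] by simp
    ultimately show "FA F m = FA G m"
      using comma_homD(3)[OF Fm] comma_homD(3)[OF Gm] o[OF xy(1)] o[OF xy(2)] by simp
  qed
qed

text \<open>The functor into the comma category with components \<open>f\<close>, \<open>g\<close> and structure transformation
  \<open>\<gamma> : u1 f \<rightarrow> u2 g\<close>, as given by the universal property of the comma square.\<close>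

definition into_comma ::
  "'s::small_universe sfctr \<Rightarrow> 's sfctr \<Rightarrow> 's sfctr \<Rightarrow> 's sfctr \<Rightarrow> 's snt \<Rightarrow> 's sfctr" where
  "into_comma u1 u2 f g \<gamma> =
     (let o' = (\<lambda>x\<in>Ob (Src f). pair (FO f x) (pair (FO g x) (Cmp \<gamma> x)))
      in \<lparr>Src = Src f, Tgt = comma_cat u1 u2, FO = o',
          FA = (\<lambda>a\<in>Ar (Src f). pair (pair (o' (Dom (Src f) a)) (o' (Cod (Src f) a)))
            (pair (FA f a) (FA g a)))\<rparr>)"

locale comma_cone = comma u1 u2 J1 J2 K
  for u1 u2 :: "'s::small_universe sfctr" and J1 J2 K :: "'s scat" +
  fixes f g :: "'s sfctr" and \<gamma> :: "'s snt" and L :: "'s scat"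
  assumes cone: "lax_square f g u1 u2 \<gamma> L J1 J2 K"
begin

abbreviation h where "h \<equiv> into_comma u1 u2 f g \<gamma>"

lemmas cf = lax_squareD(1)[OF cone] and cg = lax_squareD(2)[OF cone]
lemmas \<gamma> = lax_squareD(5)[OF cone]

lemma into_comma_FO: "x \<in> Ob L \<Longrightarrow> FO h x = pair (FO f x) (pair (FO g x) (Cmp \<gamma> x))"
  by (simp add: into_comma_def Let_def sfunctorD[OF cf])

lemma into_comma_FA: "m \<in> hom L x y \<Longrightarrow> FA h m = pair (pair (FO h x) (FO h y)) (pair (FA f m) (FA g m))"
  using hom_objects[OF sfunctorD(4)[OF cf], of m x y]
  by (simp add: into_comma_def Let_def sfunctorD[OF cf] homD)

lemma \<gamma>_hom: "x \<in> Ob L \<Longrightarrow> Cmp \<gamma> x \<in> hom K (FO u1 (FO f x)) (FO u2 (FO g x))"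
  using nat_hom[OF \<gamma> sfunctorD(1)[OF sfunctor_comp[OF cf u1]]] sfunctorD[OF cf] sfunctorD[OF cg]
  by simp

lemma into_comma_hom: "m \<in> hom L x y \<Longrightarrow> FA h m \<in> hom C (FO h x) (FO h y)"
proof -
  assume m: "m \<in> hom L x y"
  note xy = hom_objects[OF sfunctorD(4)[OF cf] m]
  have "Comp K (Cmp \<gamma> y) (FA u1 (FA f m)) = Comp K (FA u2 (FA g m)) (Cmp \<gamma> x)"
    using nat_natural[OF \<gamma> sfunctorD(1)[OF sfunctor_comp[OF cf u1]] m] homD(1)[OF m]
      sfunctorD[OF cf] sfunctorD[OF cg] by simp
  then show ?thesis
    unfolding into_comma_FA[OF m] comma_hom_pair
    using functor_hom[OF sfunctorD(1)[OF cf] m] functor_hom[OF sfunctorD(1)[OF cg] m] xy \<gamma>_hom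
      functor_ob[OF sfunctorD(1)[OF cf]] functor_ob[OF sfunctorD(1)[OF cg]]
    by (simp add: into_comma_FO comma_Ob_pair)
qed

lemma into_comma_sfunctor: "sfunctor h L C"
proof -
  note F = sfunctorD[OF cf] and G = sfunctorD[OF cg]
  have ob: "FO h x \<in> Ob C" if "x \<in> Ob L" for x
    using that \<gamma>_hom functor_ob[OF F(1)] functor_ob[OF G(1)]
    by (simp add: into_comma_FO comma_Ob_pair)
  have "functor_from_to h L C"
  proof (rule functorI[OF F(4) comma_category])
    show "FA h (Id L x) = Id C (FO h x)" if x: "x \<in> Ob L" for x
      using into_comma_FA[OF Id_hom[OF F(4) x]] comma_Id[OF ob[OF x]] functor_Id[OF F(1) x]
        functor_Id[OF G(1) x] into_comma_FO[OF x] by simp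
    show "FA h (Comp L n m) = Comp C (FA h n) (FA h m)"
      if "m \<in> Ar L" "n \<in> Ar L" "Cod L m = Dom L n" for m n
    proof -
      have m: "m \<in> hom L (Dom L m) (Dom L n)" and n: "n \<in> hom L (Dom L n) (Cod L n)"
        using that by (auto simp: hom_def)
      show ?thesis
        using into_comma_FA[OF Comp_hom[OF F(4) m n]]
          comma_Comp[OF into_comma_hom[OF m] into_comma_hom[OF n]] into_comma_FA[OF m]
          into_comma_FA[OF n] functor_Comp[OF F(1) m n] functor_Comp[OF G(1) m n] by simp
    qed
  qed (use F ob into_comma_hom[OF Ar_hom] in \<open>auto simp: into_comma_def Let_def\<close>)
  then show ?thesis using comma_small_cat F by (simp add: sfunctor_def)
qed

lemma pr1_into_comma: "comma_pr1 u1 u2 \<odot> h = f"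
proof (rule functor_eqI_arrows[OF _ sfunctorD(1)[OF cf]])
  show "functor_from_to (comma_pr1 u1 u2 \<odot> h) L J1"
    by (rule sfunctorD(1)[OF sfunctor_comp[OF into_comma_sfunctor comma_pr_sfunctor(1)]])
  show "FA (comma_pr1 u1 u2 \<odot> h) m = FA f m" if "m \<in> Ar L" for m
    using into_comma_FA[OF Ar_hom[OF that]] homD(1)[OF into_comma_hom[OF Ar_hom[OF that]]] that
      sfunctorD[OF into_comma_sfunctor] by simp
qed

lemma pr2_into_comma: "comma_pr2 u1 u2 \<odot> h = g"
proof (rule functor_eqI_arrows[OF _ sfunctorD(1)[OF cg]])
  show "functor_from_to (comma_pr2 u1 u2 \<odot> h) L J2"
    by (rule sfunctorD(1)[OF sfunctor_comp[OF into_comma_sfunctor comma_pr_sfunctor(2)]])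
  show "FA (comma_pr2 u1 u2 \<odot> h) m = FA g m" if "m \<in> Ar L" for m
    using into_comma_FA[OF Ar_hom[OF that]] homD(1)[OF into_comma_hom[OF Ar_hom[OF that]]] that
      sfunctorD[OF into_comma_sfunctor] by simp
qed

lemma comma_nt_into_comma: "comma_nt u1 u2 \<star> id_nt h = \<gamma>"
proof (rule nt_eqI[OF _ \<gamma> sfunctorD(1)[OF sfunctor_comp[OF cf u1]]])
  note l = comma_lax_square and i = into_comma_sfunctor
  show "nat_from_to (comma_nt u1 u2 \<star> id_nt h) (u1 \<odot> f) (u2 \<odot> g)"
    using lax_squareD(5)[OF lax_square_restrict[OF l i]] by (simp add: pr1_into_comma pr2_into_comma)
  show "Cmp (comma_nt u1 u2 \<star> id_nt h) x = Cmp \<gamma> x" if x: "x \<in> Ob L" for x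
    using whisker_right_Cmp[OF sfunctorD(1)[OF i] lax_squareD(5)[OF l]
        sfunctorD(1)[OF sfunctor_comp[OF comma_pr_sfunctor(1) u1]] x]
      comma_nt_Cmp[OF functor_ob[OF sfunctorD(1)[OF i] x]] into_comma_FO[OF x] by simp
qed

end

text \<open>An isomorphism of categories has couniversal arrows that are identities.\<close>

lemma coreflective_over_bijective:
  assumes i: "functor_from_to i P C" and p: "functor_from_to p C K"
    and surj: "\<And>c. c \<in> Ob C \<Longrightarrow> \<exists>x\<in>Ob P. FO i x = c"
    and full: "\<And>x y m. x \<in> Ob P \<Longrightarrow> y \<in> Ob P \<Longrightarrow> m \<in> hom C (FO i x) (FO i y) \<Longrightarrow>
      \<exists>!l. l \<in> hom P x y \<and> FA i l = m"
  shows "coreflective_over i p"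
  unfolding coreflective_over_def functor_categories(4)[OF i] functor_categories(4)[OF p]
proof
  fix c assume c: "c \<in> Ob C"
  note C = functor_categories(2)[OF i]
  obtain x where x: "x \<in> Ob P" "FO i x = c" using surj[OF c] by blast
  have "couniversal_arrow i c x (Id C c)"
    unfolding couniversal_arrow_def functor_categories(3,4)[OF i]
  proof (intro conjI ballI x(1))
    show "Id C c \<in> hom C (FO i x) c" using Id_hom[OF C c] x(2) by simp
    fix y g assume y: "y \<in> Ob P" and g: "g \<in> hom C (FO i y) c"
    have "Comp C (Id C c) (FA i l) = FA i l" if "l \<in> hom P y x" for l
      using Comp_Id_left[OF C, of "FA i l" "FO i y" c] functor_hom[OF i that] x(2) by simp
    then show "\<exists>!l. l \<in> hom P y x \<and> Comp C (Id C c) (FA i l) = g"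
      using full[OF y x(1), of g] g x(2) by (metis (lifting))
  qed
  then show "\<exists>x k. couniversal_arrow i c x k \<and> FA p k = Id K (FO p c)"
    using functor_Id[OF p c] by blast
qed

text \<open>The common shape of slices and coslices: objects carry an object of \<open>J\<close>, arrows are arrows of \<open>J\<close>
  subject to a condition \<open>R\<close> that contains the identities and is closed under composition.\<close>

lemma fibred_labels_sfunctor:
  fixes J :: "'s::small_universe scat"
  defines "E X R \<equiv> labelled_cat X (\<lambda>x y. {g \<in> hom J (pfst x) (pfst y). R x y g})
     (\<lambda>x. Id J (pfst x)) (Comp J)"
  assumes J: "small_cat J" and X: "small X" "\<And>x. x \<in> X \<Longrightarrow> pfst x \<in> Ob J"
    and i: "\<And>x. x \<in> X \<Longrightarrow> R x x (Id J (pfst x))"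
    and c: "\<And>x y z g h. x \<in> X \<Longrightarrow> y \<in> X \<Longrightarrow> z \<in> X \<Longrightarrow> g \<in> hom J (pfst x) (pfst y) \<Longrightarrow> R x y g \<Longrightarrow>
      h \<in> hom J (pfst y) (pfst z) \<Longrightarrow> R y z h \<Longrightarrow> R x z (Comp J h g)"
  shows "sfunctor \<lparr>Src = E X R, Tgt = J, FO = (\<lambda>x\<in>Ob (E X R). pfst x),
     FA = (\<lambda>a\<in>Ar (E X R). psnd a)\<rparr> (E X R) J" (is "sfunctor ?p ?E J")
proof -
  have cJ: "category J" and sJ: "small (Ar J)" using J by (simp_all add: small_cat_def)
  have cat: "category ?E"
    unfolding E_def
    by (rule labelled_category)
      (use X i c Id_hom[OF cJ] Comp_hom[OF cJ] Comp_Id_right[OF cJ] Comp_Id_left[OF cJ]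
        Comp_assoc[OF cJ, symmetric] in auto)
  have sm: "small_cat ?E"
    using cat X(1) unfolding E_def
    by (rule labelled_small_cat) (auto intro!: small_subset[OF sJ] simp: hom_def)
  have h: "m \<in> hom ?E x y \<longleftrightarrow> x \<in> X \<and> y \<in> X \<and>
      (\<exists>l. l \<in> hom J (pfst x) (pfst y) \<and> R x y l \<and> m = pair (pair x y) l)" for m x y
    unfolding E_def labelled_hom by auto
  have o: "Ob ?E = X" by (simp add: E_def)
  have "functor_from_to ?p ?E J"
  proof (rule functorI[OF cat cJ])
    show "FA ?p f \<in> hom J (FO ?p (Dom ?E f)) (FO ?p (Cod ?E f))" if f: "f \<in> Ar ?E" for f
    proof -
      obtain l where l: "Dom ?E f \<in> X" "Cod ?E f \<in> X" "l \<in> hom J (pfst (Dom ?E f)) (pfst (Cod ?E f))"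
        and fl: "f = pair (pair (Dom ?E f) (Cod ?E f)) l" using Ar_hom[OF f] unfolding h by blast
      have "psnd f = l" using arg_cong[OF fl, of psnd] by simp
      then show ?thesis using f l by (simp add: o)
    qed
    show "FA ?p (Id ?E x) = Id J (FO ?p x)" if x: "x \<in> Ob ?E" for x
      using homD(1)[OF Id_hom[OF cat x]] x by (simp add: o) (simp add: E_def labelled_Id)
    show "FA ?p (Comp ?E g f) = Comp J (FA ?p g) (FA ?p f)"
      if "f \<in> Ar ?E" "g \<in> Ar ?E" "Cod ?E f = Dom ?E g" for f g
    proof -
      have fh: "f \<in> hom ?E (Dom ?E f) (Dom ?E g)" using that by (simp add: hom_def)
      note gh = Ar_hom[OF that(2)]
      obtain a b where a: "f = pair (pair (Dom ?E f) (Dom ?E g)) a" "R (Dom ?E f) (Dom ?E g) a"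
          "a \<in> hom J (pfst (Dom ?E f)) (pfst (Dom ?E g))"
        and b: "g = pair (pair (Dom ?E g) (Cod ?E g)) b" "R (Dom ?E g) (Cod ?E g) b"
          "b \<in> hom J (pfst (Dom ?E g)) (pfst (Cod ?E g))"
        using fh gh unfolding h by blast
      have "Comp ?E (pair (pair (Dom ?E g) (Cod ?E g)) b) (pair (pair (Dom ?E f) (Dom ?E g)) a)
          = pair (pair (Dom ?E f) (Cod ?E g)) (Comp J b a)"
        using fh gh a b unfolding h unfolding E_def by (intro labelled_Comp) simp_all
      then have "Comp ?E g f = pair (pair (Dom ?E f) (Cod ?E g)) (Comp J b a)" using a(1) b(1) by simp
      moreover have "psnd f = a" "psnd g = b"
        using arg_cong[OF a(1), of psnd] arg_cong[OF b(1), of psnd] by simp_all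
      ultimately have "psnd (Comp ?E g f) = Comp J (psnd g) (psnd f)" by simp
      then show ?thesis using that homD(1)[OF Comp_hom[OF cat fh gh]] by simp
    qed
  qed (use X(2) in \<open>auto simp: o\<close>)
  then show ?thesis using J sm by (simp add: sfunctor_def)
qed

locale slice =
  fixes u :: "'s::small_universe sfctr" and J K k
  assumes u: "sfunctor u J K" and k: "k \<in> Ob K"
begin

lemmas su = sfunctorD[OF u]

lemma small_slice_objects: "small {pair j f | j f. j \<in> Ob J \<and> f \<in> Ar K \<and> P j f}"
proof -
  have "small {pair j f | j f. j \<in> Ob J \<and> f \<in> Ar K}"
    using su by (intro small_dependent_pairs) (auto simp: small_cat_def)
  then show ?thesis by (rule small_subset) auto
qed

lemma slice_pr_sfunctor: "sfunctor (slice_pr u k) (slice_cat u k) J"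
  unfolding slice_pr_def slice_cat_def su
proof (rule fibred_labels_sfunctor[OF su(2)])
  show "small {pair j f | j f. j \<in> Ob J \<and> f \<in> hom K (FO u j) k}"
    unfolding hom_def using small_slice_objects by simp
  fix x y z g h
  assume x: "x \<in> {pair j f | j f. j \<in> Ob J \<and> f \<in> hom K (FO u j) k}"
  then show "pfst x \<in> Ob J" "Comp K (psnd x) (FA u (Id J (pfst x))) = psnd x"
    using functor_Id[OF su(1)] Comp_Id_right[OF su(5)] by auto
  assume z: "z \<in> {pair j f | j f. j \<in> Ob J \<and> f \<in> hom K (FO u j) k}"
    and g: "g \<in> hom J (pfst x) (pfst y)" "Comp K (psnd y) (FA u g) = psnd x"
    and h: "h \<in> hom J (pfst y) (pfst z)" "Comp K (psnd z) (FA u h) = psnd y"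
  have zh: "psnd z \<in> hom K (FO u (pfst z)) k" using z by auto
  then show "Comp K (psnd z) (FA u (Comp J h g)) = psnd x"
    using functor_Comp[OF su(1) g(1) h(1)] g(2) h(2)
      Comp_assoc[OF su(5) functor_hom[OF su(1) g(1)] functor_hom[OF su(1) h(1)] zh] by simp
qed

lemma coslice_pr_sfunctor: "sfunctor (coslice_pr u k) (coslice_cat u k) J"
  unfolding coslice_pr_def coslice_cat_def su
proof (rule fibred_labels_sfunctor[OF su(2)])
  show "small {pair j f | j f. j \<in> Ob J \<and> f \<in> hom K k (FO u j)}"
    unfolding hom_def using small_slice_objects by simp
  fix x y z g h
  assume x: "x \<in> {pair j f | j f. j \<in> Ob J \<and> f \<in> hom K k (FO u j)}"
  then show "pfst x \<in> Ob J" "Comp K (FA u (Id J (pfst x))) (psnd x) = psnd x"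
    using functor_Id[OF su(1)] Comp_Id_left[OF su(5)] by auto
  assume g: "g \<in> hom J (pfst x) (pfst y)" "Comp K (FA u g) (psnd x) = psnd y"
    and h: "h \<in> hom J (pfst y) (pfst z)" "Comp K (FA u h) (psnd y) = psnd z"
  have xh: "psnd x \<in> hom K k (FO u (pfst x))" using x by auto
  then show "Comp K (FA u (Comp J h g)) (psnd x) = psnd z"
    using functor_Comp[OF su(1) g(1) h(1)] g(2) h(2)
      Comp_assoc[OF su(5) xh functor_hom[OF su(1) g(1)] functor_hom[OF su(1) h(1)]] by simp
qed

lemma slice_Ob: "x \<in> Ob (slice_cat u k) \<longleftrightarrow> (\<exists>j f. x = pair j f \<and> j \<in> Ob J \<and> f \<in> hom K (FO u j) k)"
  by (simp add: slice_cat_def su)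

lemma coslice_Ob:
  "x \<in> Ob (coslice_cat u k) \<longleftrightarrow> (\<exists>j f. x = pair j f \<and> j \<in> Ob J \<and> f \<in> hom K k (FO u j))"
  by (simp add: coslice_cat_def su)

lemma slice_hom:
  "m \<in> hom (slice_cat u k) x y \<longleftrightarrow> x \<in> Ob (slice_cat u k) \<and> y \<in> Ob (slice_cat u k) \<and>
    (\<exists>g. m = pair (pair x y) g \<and> g \<in> hom J (pfst x) (pfst y) \<and> Comp K (psnd y) (FA u g) = psnd x)"
  unfolding slice_cat_def labelled_hom labelled_Ob su by auto

lemma coslice_hom:
  "m \<in> hom (coslice_cat u k) x y \<longleftrightarrow> x \<in> Ob (coslice_cat u k) \<and> y \<in> Ob (coslice_cat u k) \<and>
    (\<exists>g. m = pair (pair x y) g \<and> g \<in> hom J (pfst x) (pfst y) \<and> Comp K (FA u g) (psnd x) = psnd y)"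
  unfolding coslice_cat_def labelled_hom labelled_Ob su by auto

lemma slice_lax_square:
  "lax_square (slice_pr u k) (to_terminal (slice_cat u k)) u (point K k) (slice_nt u k)
     (slice_cat u k) J terminal_cat K"
proof -
  let ?S = "slice_cat u k"
  note p = slice_pr_sfunctor and pt = point_sfunctor[OF su(3) k]
  note t = to_terminal_sfunctor[OF sfunctorD(2)[OF p]]
  have nat: "nat_from_to (slice_nt u k) (u \<odot> slice_pr u k) (point K k \<odot> to_terminal ?S)"
  proof (rule natI[OF sfunctorD(1)[OF sfunctor_comp[OF p u]] sfunctorD(1)[OF sfunctor_comp[OF t pt]]])
    show "Cmp (slice_nt u k) x \<in> hom K (FO (u \<odot> slice_pr u k) x) (FO (point K k \<odot> to_terminal ?S) x)"
      if "x \<in> Ob ?S" for x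
      using that slice_Ob[of x] by (auto simp: slice_nt_def slice_pr_def to_terminal_def)
    show "Comp K (Cmp (slice_nt u k) y) (FA (u \<odot> slice_pr u k) f)
        = Comp K (FA (point K k \<odot> to_terminal ?S) f) (Cmp (slice_nt u k) x)"
      if f: "f \<in> hom ?S x y" and x: "x \<in> Ob ?S" and y: "y \<in> Ob ?S" for f x y
      using f slice_hom[of f x y] slice_Ob[of x] x y homD(1)[OF f] Comp_Id_left[OF su(5)]
      by (auto simp: slice_nt_def slice_pr_def to_terminal_def)
  qed (auto simp: slice_nt_def su)
  then show ?thesis using p t u pt by (simp add: lax_square_def)
qed

lemma coslice_lax_square:
  "lax_square (to_terminal (coslice_cat u k)) (coslice_pr u k) (point K k) u (coslice_nt u k)
     (coslice_cat u k) terminal_cat J K"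
proof -
  let ?S = "coslice_cat u k"
  note p = coslice_pr_sfunctor and pt = point_sfunctor[OF su(3) k]
  note t = to_terminal_sfunctor[OF sfunctorD(2)[OF p]]
  have nat: "nat_from_to (coslice_nt u k) (point K k \<odot> to_terminal ?S) (u \<odot> coslice_pr u k)"
  proof (rule natI[OF sfunctorD(1)[OF sfunctor_comp[OF t pt]] sfunctorD(1)[OF sfunctor_comp[OF p u]]])
    show "Cmp (coslice_nt u k) x \<in> hom K (FO (point K k \<odot> to_terminal ?S) x) (FO (u \<odot> coslice_pr u k) x)"
      if "x \<in> Ob ?S" for x
      using that coslice_Ob[of x] by (auto simp: coslice_nt_def coslice_pr_def to_terminal_def)
    show "Comp K (Cmp (coslice_nt u k) y) (FA (point K k \<odot> to_terminal ?S) f)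
        = Comp K (FA (u \<odot> coslice_pr u k) f) (Cmp (coslice_nt u k) x)"
      if f: "f \<in> hom ?S x y" and x: "x \<in> Ob ?S" and y: "y \<in> Ob ?S" for f x y
      using f coslice_hom[of f x y] coslice_Ob[of y] x y homD(1)[OF f] Comp_Id_right[OF su(5)]
      by (auto simp: coslice_nt_def coslice_pr_def to_terminal_def)
  qed (auto simp: coslice_nt_def su)
  then show ?thesis using p t u pt by (simp add: lax_square_def)
qed

end

text \<open>A comma category with one leg a point is isomorphic to the slice; a third component in the
  terminal category is the only difference.\<close>

lemma (in prederiv) exact_slice_iff:
  assumes u: "sfunctor u J K" and k: "k \<in> Ob K"
  shows "exact (slice_pr u k) (to_terminal (slice_cat u k)) u (point K k) (slice_nt u k) \<longleftrightarrow>
    exact (comma_pr1 u (point K k)) (comma_pr2 u (point K k)) u (point K k) (comma_nt u (point K k))"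
proof -
  interpret slice u J K k by (unfold_locales; fact)
  interpret comma_cone u "point K k" J terminal_cat K "slice_pr u k" "to_terminal (slice_cat u k)"
    "slice_nt u k" "slice_cat u k"
    by unfold_locales (use u point_sfunctor[OF su(3) k] slice_lax_square in auto)
  note hs = into_comma_sfunctor
  have val: "FO h (pair j f) = pair j (pair tag0 f)" if "pair j f \<in> Ob (slice_cat u k)" for j f
    using into_comma_FO[OF that] that by (simp add: slice_pr_def to_terminal_def slice_nt_def)
  have "coreflective_over h (comma_pr1 u (point K k))"
  proof (rule coreflective_over_bijective[OF sfunctorD(1)[OF hs] sfunctorD(1)[OF comma_pr_sfunctor(1)]])
    show "\<exists>x\<in>Ob (slice_cat u k). FO h x = c" if c: "c \<in> Ob C" for c
    proof -
      obtain j f where "c = pair j (pair tag0 f)" "pair j f \<in> Ob (slice_cat u k)"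
        using c by (auto simp: comma_Ob slice_Ob)
      then show ?thesis using val by blast
    qed
    fix x y m assume x: "x \<in> Ob (slice_cat u k)" and y: "y \<in> Ob (slice_cat u k)"
      and m: "m \<in> hom C (FO h x) (FO h y)"
    obtain i f where xx: "x = pair i f" "f \<in> hom K (FO u i) k" using x by (auto simp: slice_Ob)
    obtain j g where yy: "y = pair j g" using y by (auto simp: slice_Ob)
    obtain l where l: "m = pair (pair (FO h x) (FO h y)) (pair l tag0)" "l \<in> hom J i j"
        "Comp K g (FA u l) = f"
      using m x y xx yy Comp_Id_left[OF su(5) xx(2)] by (auto simp: comma_hom val)
    have L: "pair (pair x y) l \<in> hom (slice_cat u k) x y" using x y l xx yy by (simp add: slice_hom)
    have hom_val: "FA h (pair (pair x y) l') = pair (pair (FO h x) (FO h y)) (pair l' tag0)"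
      if "pair (pair x y) l' \<in> hom (slice_cat u k) x y" for l'
      using into_comma_FA[OF that] homD(1)[OF that] by (simp add: slice_pr_def to_terminal_def)
    show "\<exists>!n. n \<in> hom (slice_cat u k) x y \<and> FA h n = m"
      using L hom_val l(1) by (intro ex1I[of _ "pair (pair x y) l"]) (auto simp: slice_hom)
  qed
  then show ?thesis
    using exact_restrict_iff[OF comma_lax_square hs]
    by (simp add: pr1_into_comma pr2_into_comma comma_nt_into_comma)
qed

lemma (in prederiv) exact_coslice_iff:
  assumes u: "sfunctor u J K" and k: "k \<in> Ob K"
  shows "exact (to_terminal (coslice_cat u k)) (coslice_pr u k) (point K k) u (coslice_nt u k) \<longleftrightarrow>
    exact (comma_pr1 (point K k) u) (comma_pr2 (point K k) u) (point K k) u (comma_nt (point K k) u)"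
proof -
  interpret slice u J K k by (unfold_locales; fact)
  interpret comma_cone "point K k" u terminal_cat J K "to_terminal (coslice_cat u k)" "coslice_pr u k"
    "coslice_nt u k" "coslice_cat u k"
    by unfold_locales (use u point_sfunctor[OF su(3) k] coslice_lax_square in auto)
  note hs = into_comma_sfunctor
  have val: "FO h (pair j f) = pair tag0 (pair j f)" if "pair j f \<in> Ob (coslice_cat u k)" for j f
    using into_comma_FO[OF that] that by (simp add: coslice_pr_def to_terminal_def coslice_nt_def)
  have "coreflective_over h (comma_pr1 (point K k) u)"
  proof (rule coreflective_over_bijective[OF sfunctorD(1)[OF hs] sfunctorD(1)[OF comma_pr_sfunctor(1)]])
    show "\<exists>x\<in>Ob (coslice_cat u k). FO h x = c" if c: "c \<in> Ob C" for c
    proof -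
      obtain j f where "c = pair tag0 (pair j f)" "pair j f \<in> Ob (coslice_cat u k)"
        using c by (auto simp: comma_Ob coslice_Ob)
      then show ?thesis using val by blast
    qed
    fix x y m assume x: "x \<in> Ob (coslice_cat u k)" and y: "y \<in> Ob (coslice_cat u k)"
      and m: "m \<in> hom C (FO h x) (FO h y)"
    obtain i f where xx: "x = pair i f" using x by (auto simp: coslice_Ob)
    obtain j g where yy: "y = pair j g" "g \<in> hom K k (FO u j)" using y by (auto simp: coslice_Ob)
    obtain l where l: "m = pair (pair (FO h x) (FO h y)) (pair tag0 l)" "l \<in> hom J i j"
        "Comp K (FA u l) f = g"
      using m x y xx yy Comp_Id_right[OF su(5) yy(2)] by (auto simp: comma_hom val)
    have L: "pair (pair x y) l \<in> hom (coslice_cat u k) x y" using x y l xx yy by (simp add: coslice_hom)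
    have hom_val: "FA h (pair (pair x y) l') = pair (pair (FO h x) (FO h y)) (pair tag0 l')"
      if "pair (pair x y) l' \<in> hom (coslice_cat u k) x y" for l'
      using into_comma_FA[OF that] homD(1)[OF that] by (simp add: coslice_pr_def to_terminal_def)
    show "\<exists>!n. n \<in> hom (coslice_cat u k) x y \<and> FA h n = m"
      using L hom_val l(1) by (intro ex1I[of _ "pair (pair x y) l"]) (auto simp: coslice_hom)
  qed
  then show ?thesis
    using exact_restrict_iff[OF comma_lax_square hs]
    by (simp add: pr1_into_comma pr2_into_comma comma_nt_into_comma)
qed

section \<open>Arrows in a pullback\<close>

lemma tag_neq [simp]: "tag0 \<noteq> tag1" "tag1 \<noteq> tag0"
  using tag0_neq_tag1 by metis+

text \<open>The poset \<open>tag0 < tag1\<close>; functors out of it are single arrows.\<close>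

definition walking_arrow :: "'s::small_universe scat" where
  "walking_arrow = labelled_cat {tag0, tag1} (\<lambda>x y. if x = tag1 \<and> y = tag0 then {} else {tag0})
     (\<lambda>_. tag0) (\<lambda>_ _. tag0)"

definition the_arrow :: "'s::small_universe" where "the_arrow = pair (pair tag0 tag1) tag0"

definition arrow_functor :: "'s::small_universe scat \<Rightarrow> 's \<Rightarrow> 's sfctr" where
  "arrow_functor J f = (let o' = (\<lambda>x. if x = tag0 then Dom J f else Cod J f) in
     \<lparr>Src = walking_arrow, Tgt = J, FO = (\<lambda>x\<in>Ob walking_arrow. o' x),
      FA = (\<lambda>a\<in>Ar walking_arrow. if a = the_arrow then f else Id J (o' (pfst (pfst a))))\<rparr>)"

lemma walking_arrow_Ob: "Ob walking_arrow = {tag0, tag1}"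
  by (simp add: walking_arrow_def)

lemma walking_arrow_hom:
  "m \<in> hom walking_arrow x y \<longleftrightarrow> x \<in> {tag0, tag1} \<and> y \<in> {tag0, tag1} \<and> \<not> (x = tag1 \<and> y = tag0) \<and>
     m = pair (pair x y) tag0"
  unfolding walking_arrow_def labelled_hom by auto

lemma walking_arrow_small_cat: "small_cat (walking_arrow :: 's::small_universe scat)"
proof -
  have "category (walking_arrow :: 's scat)"
    unfolding walking_arrow_def
    by (rule labelled_category) (auto split: if_splits)
  then show ?thesis
    unfolding walking_arrow_def by (rule labelled_small_cat) (auto intro: small_finite)
qed

lemma walking_arrow_Ar:
  fixes m :: "'s::small_universe"
  shows "m \<in> Ar walking_arrow \<longleftrightarrow> m \<in> {pair (pair tag0 tag0) tag0, pair (pair tag1 tag1) tag0, the_arrow}"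
proof -
  have "m \<in> Ar walking_arrow \<longleftrightarrow> (\<exists>x y. m \<in> hom walking_arrow x y)" by (auto simp: hom_def)
  then show ?thesis by (auto simp: walking_arrow_hom the_arrow_def)
qed

lemma walking_arrow_simps:
  fixes x :: "'s::small_universe"
  shows "Dom walking_arrow (the_arrow :: 's) = tag0" "Cod walking_arrow (the_arrow :: 's) = tag1"
  "x \<in> {tag0, tag1} \<Longrightarrow> Dom walking_arrow (pair (pair x x) tag0) = x"
  "x \<in> {tag0, tag1} \<Longrightarrow> Cod walking_arrow (pair (pair x x) tag0) = x"
  "x \<in> {tag0, tag1} \<Longrightarrow> Id walking_arrow x = pair (pair x x) tag0"
proof -
  have "(the_arrow :: 's) \<in> hom walking_arrow tag0 tag1"
    by (simp add: walking_arrow_hom the_arrow_def)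
  then show "Dom walking_arrow (the_arrow :: 's) = tag0" "Cod walking_arrow (the_arrow :: 's) = tag1"
    by (simp_all add: homD)
  show "Dom walking_arrow (pair (pair x x) tag0) = x" "Cod walking_arrow (pair (pair x x) tag0) = x"
    if "x \<in> {tag0, tag1}"
  proof -
    have "pair (pair x x) tag0 \<in> hom walking_arrow x x"
      using that by (auto simp: walking_arrow_hom)
    then show "Dom walking_arrow (pair (pair x x) tag0) = x"
      "Cod walking_arrow (pair (pair x x) tag0) = x" by (simp_all add: homD)
  qed
  show "Id walking_arrow x = pair (pair x x) tag0" if "x \<in> {tag0, tag1}"
    using that by (simp add: walking_arrow_def labelled_Id)
qed

lemma arrow_functor_simps:
  "FO (arrow_functor J f) tag0 = Dom J f" "FO (arrow_functor J f) tag1 = Cod J f"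
  "FA (arrow_functor J f) the_arrow = f"
  "FA (arrow_functor J f) (pair (pair tag0 tag0) tag0) = Id J (Dom J f)"
  "FA (arrow_functor J f) (pair (pair tag1 tag1) tag0) = Id J (Cod J f)"
  "Src (arrow_functor J f) = walking_arrow" "Tgt (arrow_functor J f) = J"
  by (auto simp: arrow_functor_def Let_def walking_arrow_Ob walking_arrow_Ar the_arrow_def)

lemma arrow_functor_sfunctor:
  fixes J :: "'s::small_universe scat"
  assumes J: "small_cat J" and f: "f \<in> Ar J"
  shows "sfunctor (arrow_functor J f) walking_arrow J"
proof -
  have cJ: "category J" using J by (simp add: small_cat_def)
  have cW: "category (walking_arrow :: 's scat)"
    using walking_arrow_small_cat unfolding small_cat_def by (rule conjunct1)
  note fh = Ar_hom[OF f] and df = hom_objects[OF cJ Ar_hom[OF f]]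
  have W: "Comp walking_arrow h (Id walking_arrow (Dom walking_arrow h)) = h"
    "Comp walking_arrow (Id walking_arrow (Cod walking_arrow h)) h = h" if "h \<in> Ar walking_arrow" for h :: 's
    using Comp_Id_left[OF cW Ar_hom[OF that]] Comp_Id_right[OF cW Ar_hom[OF that]] by auto
  have "functor_from_to (arrow_functor J f) walking_arrow J"
  proof (rule functorI[OF cW cJ])
    show "FA (arrow_functor J f) m \<in> hom J (FO (arrow_functor J f) (Dom walking_arrow m))
        (FO (arrow_functor J f) (Cod walking_arrow m))" if "m \<in> Ar walking_arrow" for m :: 's
      using that fh df Id_hom[OF cJ]
      by (auto simp: walking_arrow_Ar walking_arrow_simps arrow_functor_simps)
    show "FA (arrow_functor J f) (Comp walking_arrow n m)
        = Comp J (FA (arrow_functor J f) n) (FA (arrow_functor J f) m)"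
      if m: "m \<in> Ar walking_arrow" and n: "n \<in> Ar walking_arrow"
        and mn: "Cod walking_arrow m = Dom walking_arrow n" for m n
    proof -
      have e: "FA (arrow_functor J f) (Id walking_arrow x) = Id J (FO (arrow_functor J f) x)"
        if "x \<in> {tag0, tag1}" for x
        using that by (auto simp: walking_arrow_simps arrow_functor_simps)
      have hm: "FA (arrow_functor J f) a \<in> hom J (FO (arrow_functor J f) (Dom walking_arrow a))
          (FO (arrow_functor J f) (Cod walking_arrow a))" if "a \<in> Ar walking_arrow" for a
        using that fh df Id_hom[OF cJ]
        by (auto simp: walking_arrow_Ar walking_arrow_simps arrow_functor_simps)
      consider "m = Id walking_arrow (Dom walking_arrow n)" | "n = Id walking_arrow (Cod walking_arrow m)"
        using m n mn by (auto simp: walking_arrow_Ar walking_arrow_simps)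
      then show ?thesis
      proof cases
        case 1
        have "Dom walking_arrow n \<in> {tag0, tag1}" using n by (auto simp: walking_arrow_Ar walking_arrow_simps)
        then have "FA (arrow_functor J f) m = Id J (FO (arrow_functor J f) (Dom walking_arrow n))"
          using 1 e by metis
        then show ?thesis using W(1)[OF n] 1 Comp_Id_right[OF cJ hm[OF n]] by metis
      next
        case 2
        have "Cod walking_arrow m \<in> {tag0, tag1}" using m by (auto simp: walking_arrow_Ar walking_arrow_simps)
        then have "FA (arrow_functor J f) n = Id J (FO (arrow_functor J f) (Cod walking_arrow m))"
          using 2 e by metis
        then show ?thesis using W(2)[OF m] 2 Comp_Id_left[OF cJ hm[OF m]] by metis
      qed
    qed
    show "FO (arrow_functor J f) \<in> extensional (Ob walking_arrow)"
      "FA (arrow_functor J f) \<in> extensional (Ar walking_arrow)"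
      by (simp_all add: arrow_functor_def Let_def)
  qed (use df in \<open>auto simp: walking_arrow_Ob walking_arrow_simps arrow_functor_simps\<close>)
  then show ?thesis using J walking_arrow_small_cat by (simp add: sfunctor_def)
qed

lemma arrow_functor_unique:
  fixes J :: "'s::small_universe scat"
  assumes h: "sfunctor h walking_arrow J"
  shows "h = arrow_functor J (FA h the_arrow)"
proof -
  have m: "(the_arrow :: 's) \<in> hom walking_arrow tag0 tag1"
    by (simp add: walking_arrow_hom the_arrow_def)
  have hm: "FA h the_arrow \<in> hom J (FO h tag0) (FO h tag1)"
    by (rule functor_hom[OF sfunctorD(1)[OF h] m])
  show ?thesis
  proof (rule functor_eqI_arrows[OF sfunctorD(1)[OF h]
        sfunctorD(1)[OF arrow_functor_sfunctor[OF sfunctorD(3)[OF h] homD(1)[OF hm]]]])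
    fix a :: 's assume "a \<in> Ar walking_arrow"
    then consider "a = the_arrow" | "a = Id walking_arrow tag0" | "a = Id walking_arrow tag1"
      by (auto simp: walking_arrow_Ar walking_arrow_simps)
    then show "FA h a = FA (arrow_functor J (FA h the_arrow)) a"
      using functor_Id[OF sfunctorD(1)[OF h], of tag0] functor_Id[OF sfunctorD(1)[OF h], of tag1]
        homD[OF hm]
      by cases (simp_all add: walking_arrow_simps arrow_functor_simps walking_arrow_Ob)
  qed
qed

lemma comp_arrow_functor:
  fixes J K :: "'s::small_universe scat"
  assumes u: "sfunctor u J K" and f: "f \<in> Ar J"
  shows "u \<odot> arrow_functor J f = arrow_functor K (FA u f)"
proof -
  have "(the_arrow :: 's) \<in> Ar walking_arrow" by (simp add: walking_arrow_Ar)
  then show ?thesis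
    using arrow_functor_unique[OF sfunctor_comp[OF arrow_functor_sfunctor[OF sfunctorD(2)[OF u] f] u]]
    by (simp add: arrow_functor_simps)
qed

text \<open>Tested on the walking arrow, the universal property of a pullback says that its arrows are the
  pairs of arrows with the same image.\<close>

lemma pullback_arrow:
  fixes v u1 u2 w :: "'s::small_universe sfctr"
  assumes pb: "is_pullback_square v u1 u2 w" and f: "f \<in> Ar (Tgt v)" and g: "g \<in> Ar (Tgt u1)"
    and fg: "FA u2 f = FA w g"
  shows "\<exists>!m. m \<in> Ar (Src v) \<and> FA v m = f \<and> FA u1 m = g"
proof -
  have v: "sfunctor v (Src v) (Tgt v)" and u1: "sfunctor u1 (Src v) (Tgt u1)"
    and u2: "sfunctor u2 (Tgt v) (Tgt u2)" and w: "sfunctor w (Tgt u1) (Tgt u2)"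
    using pb by (simp_all add: is_pullback_square_def)
  let ?a = "arrow_functor (Tgt v) f" and ?b = "arrow_functor (Tgt u1) g"
  have a: "sfunctor ?a walking_arrow (Tgt v)" and b: "sfunctor ?b walking_arrow (Tgt u1)"
    using arrow_functor_sfunctor f g sfunctorD(3)[OF v] sfunctorD(3)[OF u1] by blast+
  have "w \<odot> ?b = u2 \<odot> ?a" using comp_arrow_functor[OF w g] comp_arrow_functor[OF u2 f] fg by simp
  then have ex: "\<exists>!h. sfunctor h walking_arrow (Src v) \<and> v \<odot> h = ?a \<and> u1 \<odot> h = ?b"
    using pb a b unfolding is_pullback_square_def by blast
  then obtain h where h: "sfunctor h walking_arrow (Src v)" "v \<odot> h = ?a" "u1 \<odot> h = ?b" by blast
  have t: "(the_arrow :: 's) \<in> hom walking_arrow tag0 tag1"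
    by (simp add: walking_arrow_hom the_arrow_def)
  have hm: "FA h the_arrow \<in> Ar (Src v)"
    using homD(1)[OF functor_hom[OF sfunctorD(1)[OF h(1)] t]] .
  have "FA (v \<odot> h) the_arrow = f" "FA (u1 \<odot> h) the_arrow = g"
    unfolding h(2,3) by (simp_all add: arrow_functor_simps)
  then have vh: "FA v (FA h the_arrow) = f" "FA u1 (FA h the_arrow) = g"
    using homD(1)[OF t] sfunctorD(6)[OF h(1)] by simp_all
  show ?thesis
  proof (rule ex1I[of _ "FA h the_arrow"])
    show "FA h the_arrow \<in> Ar (Src v) \<and> FA v (FA h the_arrow) = f \<and> FA u1 (FA h the_arrow) = g"
      using hm vh by simp
    fix m assume m: "m \<in> Ar (Src v) \<and> FA v m = f \<and> FA u1 m = g"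
    then have "sfunctor (arrow_functor (Src v) m) walking_arrow (Src v) \<and>
        v \<odot> arrow_functor (Src v) m = ?a \<and> u1 \<odot> arrow_functor (Src v) m = ?b"
      using arrow_functor_sfunctor[OF sfunctorD(2)[OF v]] comp_arrow_functor[OF v]
        comp_arrow_functor[OF u1] by simp
    then have "h = arrow_functor (Src v) m" using ex h by blast
    then show "m = FA h the_arrow" by (simp add: arrow_functor_simps)
  qed
qed

section \<open>(Der4) and comma squares\<close>

context prederiv_kan
begin

lemma base_change_comma_iff:
  "base_change_comma D \<longleftrightarrow> (\<forall>J1 J2 K u1 u2. sfunctor u1 J1 K \<and> sfunctor u2 J2 K \<longrightarrow>
     exact (comma_pr1 u1 u2) (comma_pr2 u1 u2) u1 u2 (comma_nt u1 u2))"
proof -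
  have "exact_left D (comma_pr1 u1 u2) (comma_pr2 u1 u2) u1 u2 (comma_nt u1 u2) \<longleftrightarrow>
      exact (comma_pr1 u1 u2) (comma_pr2 u1 u2) u1 u2 (comma_nt u1 u2)"
    if "sfunctor u1 J1 K" "sfunctor u2 J2 K" for u1 u2 J1 J2 K
    using exact_left_iff[OF comma.comma_lax_square[OF comma.intro[OF that]]] .
  then show ?thesis unfolding base_change_comma_def by blast
qed

lemma Der4_iff:
  "Der4 D \<longleftrightarrow> (\<forall>J K u k. sfunctor u J K \<and> k \<in> Ob K \<longrightarrow>
     exact (comma_pr1 u (point K k)) (comma_pr2 u (point K k)) u (point K k) (comma_nt u (point K k)) \<and>
     exact (comma_pr1 (point K k) u) (comma_pr2 (point K k) u) (point K k) u (comma_nt (point K k) u))"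
proof -
  have "exact_left D (slice_pr u k) (to_terminal (slice_cat u k)) u (point K k) (slice_nt u k) \<and>
      exact_right D (coslice_pr u k) (to_terminal (coslice_cat u k)) u (point K k) (coslice_nt u k)
    \<longleftrightarrow>
      exact (comma_pr1 u (point K k)) (comma_pr2 u (point K k)) u (point K k) (comma_nt u (point K k)) \<and>
      exact (comma_pr1 (point K k) u) (comma_pr2 (point K k) u) (point K k) u (comma_nt (point K k) u)"
    if u: "sfunctor u J K" and k: "k \<in> Ob K" for u J K k
  proof -
    interpret slice u J K k by (unfold_locales; fact)
    show ?thesis
      using exact_left_iff[OF slice_lax_square] exact_right_iff[OF coslice_lax_square]
        exact_slice_iff[OF u k] exact_coslice_iff[OF u k] by simp
  qed
  then show ?thesis unfolding Der4_def by blast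
qed

lemma Der4_if_comma: "base_change_comma D \<Longrightarrow> Der4 D"
  unfolding base_change_comma_iff Der4_iff
  using point_sfunctor sfunctorD(3) by blast

text \<open>Test at \<open>j \<in> J2\<close>. An object of the slice of the second projection over \<open>j\<close> is an arrow
  \<open>a : u1 j1 \<rightarrow> u2 j2\<close> with an arrow \<open>f : j2 \<rightarrow> j\<close>. Sending it to \<open>(u2 f) a\<close> defines a functor to the slice of
  \<open>u1\<close> over \<open>u2 j\<close>, whose square is exact by (Der4). The pasted square is the restriction of that
  square along this functor, which is a left adjoint.\<close>

lemma comma_exact_if_pointwise:
  assumes u1: "sfunctor u1 J1 K" and u2: "sfunctor u2 J2 K" and Der2: "Der2 D" and Der4: "Der4 D"
  shows "exact (comma_pr1 u1 u2) (comma_pr2 u1 u2) u1 u2 (comma_nt u1 u2)"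
proof -
  interpret comma u1 u2 J1 J2 K by (unfold_locales; fact)
  note pr2 = comma_pr_sfunctor(2)
  have pt: "sfunctor (point J2 j) terminal_cat J2" if "j \<in> Ob J2" for j
    using point_sfunctor[OF s2(2) that] .
  let ?s = "\<lambda>j. comma_pr1 (comma_pr2 u1 u2) (point J2 j)"
    and ?q = "\<lambda>j. comma_pr2 (comma_pr2 u1 u2) (point J2 j)"
    and ?\<sigma> = "\<lambda>j. comma_nt (comma_pr2 u1 u2) (point J2 j)"
  show ?thesis
  proof (rule exact_if_pointwise[OF Der2 comma_lax_square])
    fix j assume j: "j \<in> Ob J2"
    interpret sl: comma "comma_pr2 u1 u2" "point J2 j" C terminal_cat J2
      using pr2 pt[OF j] by unfold_locales
    show "lax_square (?s j) (?q j) (comma_pr2 u1 u2) (point J2 j) (?\<sigma> j) sl.C C terminal_cat J2"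
      by (rule sl.comma_lax_square)
    show "exact (?s j) (?q j) (comma_pr2 u1 u2) (point J2 j) (?\<sigma> j)"
      using Der4 pr2 j unfolding Der4_iff by blast
    let ?p = "paste u2 (comma_nt u1 u2) (?s j) (?\<sigma> j)" and ?k = "FO u2 j"
    note sl_sq = sl.comma_lax_square
    have k: "?k \<in> Ob K" by (rule functor_ob[OF f2 j])
    have cone: "lax_square (comma_pr1 u1 u2 \<odot> ?s j) (?q j) u1 (point K ?k) ?p sl.C J1 terminal_cat K"
      using paste_nat(3)[OF comma_lax_square sl_sq] comp_point[OF u2 j] by simp
    interpret tg: comma_cone u1 "point K ?k" J1 terminal_cat K "comma_pr1 u1 u2 \<odot> ?s j" "?q j" ?p sl.C
      using u1 point_sfunctor[OF s2(3) k] cone by unfold_locales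
    note hs = tg.into_comma_sfunctor
    have val: "FO tg.h (pair (pair i1 (pair i2 b)) (pair tag0 f)) = pair i1 (pair tag0 (Comp K (FA u2 f) b))"
      if "pair (pair i1 (pair i2 b)) (pair tag0 f) \<in> Ob sl.C" for i1 i2 b f
      using tg.into_comma_FO[OF that] paste_Cmp[OF comma_lax_square sl_sq that]
        sl.comma_objD[OF that] that by (simp add: sl.comma_nt_Cmp comma_nt_Cmp)
    have fval: "FA tg.h (pair (pair y x) (pair (pair (pair y0 x0) (pair g1 g2)) g3))
        = pair (pair (FO tg.h y) (FO tg.h x)) (pair g1 g3)"
      if m: "pair (pair y x) (pair (pair (pair y0 x0) (pair g1 g2)) g3) \<in> hom sl.C y x"
      for x y x0 y0 g1 g2 g3
      using tg.into_comma_FA[OF m] homD(1)[OF m] homD(1)[OF sl.comma_homD(4)[OF m]] by simp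
    have "coreflective_over tg.h (comma_pr1 u1 (point K ?k))"
      unfolding coreflective_over_def sfunctorD(7)[OF hs] tg.comma_pr_simps
    proof
      fix c assume c: "c \<in> Ob tg.C"
      then obtain j1 a where cc: "c = pair j1 (pair tag0 a)" and j1: "j1 \<in> Ob J1"
        and a: "a \<in> hom K (FO u1 j1) ?k" by (auto simp: tg.comma_Ob)
      \<comment> \<open>The counit at \<open>(j1, a)\<close> is an identity: the right adjoint sends it to \<open>((j1, j, a), id)\<close>.\<close>
      define x0 where "x0 = pair j1 (pair j a)"
      define x where "x = pair x0 (pair tag0 (Id J2 j))"
      have x0: "x0 \<in> Ob C" using j1 j a by (simp add: x0_def comma_Ob_pair)
      have x: "x \<in> Ob sl.C" using x0 Id_hom[OF s2(4) j] by (simp add: x_def sl.comma_Ob_pair) (simp add: x0_def)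
      have hx: "FO tg.h x = c"
        using val[OF x[unfolded x_def x0_def]] functor_Id[OF f2 j] Comp_Id_left[OF s1(5) a]
        by (simp add: x_def x0_def cc)
      have "couniversal_arrow tg.h c x (Id tg.C c)"
        unfolding couniversal_arrow_def sfunctorD(6,7)[OF hs]
      proof (intro conjI ballI x)
        show "Id tg.C c \<in> hom tg.C (FO tg.h x) c" using Id_hom[OF tg.comma_category c] hx by simp
        fix y g assume y: "y \<in> Ob sl.C" and g: "g \<in> hom tg.C (FO tg.h y) c"
        obtain y0 f where y1: "y = pair y0 (pair tag0 f)" "y0 \<in> Ob C"
          using y by (auto simp: sl.comma_Ob)
        then obtain i1 i2 b where y0: "y0 = pair i1 (pair i2 b)" and b: "b \<in> hom K (FO u1 i1) (FO u2 i2)"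
          by (auto simp: comma_Ob)
        have f: "f \<in> hom J2 i2 j" using sl.comma_objD(3)[OF y] y1 y0 by simp
        have hy: "FO tg.h y = pair i1 (pair tag0 (Comp K (FA u2 f) b))"
          using val y unfolding y1 y0 by blast
        have fb: "Comp K (FA u2 f) b \<in> hom K (FO u1 i1) ?k"
          by (rule Comp_hom[OF s1(5) b functor_hom[OF f2 f]])
        obtain g1 where gg: "g = pair (pair (FO tg.h y) c) (pair g1 tag0)" and g1: "g1 \<in> hom J1 i1 j1"
          and sq: "Comp K a (FA u1 g1) = Comp K (FA u2 f) b"
          using g unfolding tg.comma_hom hy cc by (auto simp: Comp_Id_left[OF s1(5) fb])
        define l0 where "l0 = pair (pair y0 x0) (pair g1 f)"
        define l where "l = pair (pair y x) (pair l0 tag0)"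
        have l0: "l0 \<in> hom C y0 x0"
          using y1 x0 g1 f sq unfolding l0_def comma_hom_pair by (simp add: y0 x0_def)
        have l: "l \<in> hom sl.C y x"
          using y x l0 homD(1)[OF l0] unfolding l_def sl.comma_hom_pair
          by (simp add: y1 x_def) (simp add: l0_def)
        have Id_l: "Comp tg.C (Id tg.C c) (FA tg.h m) = FA tg.h m" if "m \<in> hom sl.C y x" for m
          using Comp_Id_left[OF tg.comma_category, of "FA tg.h m" "FO tg.h y" c]
            functor_hom[OF sfunctorD(1)[OF hs] that] hx by simp
        show "\<exists>!m. m \<in> hom sl.C y x \<and> Comp tg.C (Id tg.C c) (FA tg.h m) = g"
        proof (rule ex1I[of _ l])
          show "l \<in> hom sl.C y x \<and> Comp tg.C (Id tg.C c) (FA tg.h l) = g"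
            using l Id_l[OF l] fval[of y x y0 x0 g1 f tag0] hx by (simp add: l_def l0_def gg)
          fix m assume m': "m \<in> hom sl.C y x \<and> Comp tg.C (Id tg.C c) (FA tg.h m) = g"
          then have m: "m \<in> hom sl.C y x" and hm: "FA tg.h m = g" using Id_l by auto
          obtain m0 where m0: "m = pair (pair y x) (pair m0 tag0)" "m0 \<in> hom C y0 x0"
            and m0sq: "Comp J2 (Id J2 j) (FA (comma_pr2 u1 u2) m0) = Comp J2 (Id J2 j) f"
            using m unfolding sl.comma_hom by (auto simp: y1 x_def)
          obtain h1 h2 where m0h: "m0 = pair (pair y0 x0) (pair h1 h2)" "h2 \<in> hom J2 i2 j"
            using m0(2) unfolding comma_hom by (auto simp: y0 x0_def)
          have "FA (comma_pr2 u1 u2) m0 = h2" using homD(1)[OF m0(2)] m0h(1) by simp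
          then have "h2 = f" using m0sq Comp_Id_left[OF s2(4) m0h(2)] Comp_Id_left[OF s2(4) f] by simp
          moreover have "h1 = g1" using fval[OF m[unfolded m0 m0h]] hm gg m0(1) m0h(1) by simp
          ultimately show "m = l" by (simp add: l_def l0_def m0(1) m0h(1))
        qed
      qed
      then show "\<exists>x k. couniversal_arrow tg.h c x k \<and>
          FA (comma_pr1 u1 (point K ?k)) k = Id J1 (FO (comma_pr1 u1 (point K ?k)) c)"
        using functor_Id[OF sfunctorD(1)[OF tg.comma_pr_sfunctor(1)] c] by blast
    qed
    then have "exact (comma_pr1 u1 (point K ?k) \<odot> tg.h) (comma_pr2 u1 (point K ?k) \<odot> tg.h) u1
        (point K ?k) (comma_nt u1 (point K ?k) \<star> id_nt tg.h)"
      using exact_restrict_iff[OF tg.comma_lax_square hs] Der4 u1 k unfolding Der4_iff by blast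
    then show "exact (comma_pr1 u1 u2 \<odot> ?s j) (?q j) u1 (u2 \<odot> point J2 j) ?p"
      unfolding tg.pr1_into_comma tg.pr2_into_comma tg.comma_nt_into_comma comp_point[OF u2 j] .
  qed
qed

end

section \<open>Comma squares and fibrations\<close>

lemma Ex1_eq: "\<exists>!x. Q x \<Longrightarrow> Q a \<Longrightarrow> Q b \<Longrightarrow> a = b"
  by blast

lemma pullback_squareD:
  assumes "is_pullback_square v u1 u2 w"
  shows "sfunctor v (Src v) (Tgt v)" "sfunctor u1 (Src v) (Tgt u1)"
    "sfunctor u2 (Tgt v) (Tgt u2)" "sfunctor w (Tgt u1) (Tgt u2)" "w \<odot> u1 = u2 \<odot> v"
  using assms by (simp_all add: is_pullback_square_def)

lemma pullback_object:
  assumes pb: "is_pullback_square v u1 u2 w" and j: "j \<in> Ob (Tgt v)" and k: "k \<in> Ob (Tgt u1)"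
    and jk: "FO u2 j = FO w k"
  shows "\<exists>x\<in>Ob (Src v). FO v x = j \<and> FO u1 x = k"
proof -
  note s = pullback_squareD[OF pb]
  note J = sfunctorD[OF s(3)] and K = sfunctorD[OF s(4)]
  note Ij = Id_hom[OF J(4) j] and Ik = Id_hom[OF K(4) k]
  have "FA u2 (Id (Tgt v) j) = FA w (Id (Tgt u1) k)"
    using functor_Id[OF J(1) j] functor_Id[OF K(1) k] jk by simp
  then obtain m where m: "m \<in> Ar (Src v)" "FA v m = Id (Tgt v) j" "FA u1 m = Id (Tgt u1) k"
    using pullback_arrow[OF pb homD(1)[OF Ij] homD(1)[OF Ik]] by blast
  have "FO v (Dom (Src v) m) = j"
    using homD(2)[OF functor_hom[OF sfunctorD(1)[OF s(1)] Ar_hom[OF m(1)]]] m(2) homD(2)[OF Ij] by simp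
  moreover have "FO u1 (Dom (Src v) m) = k"
    using homD(2)[OF functor_hom[OF sfunctorD(1)[OF s(2)] Ar_hom[OF m(1)]]] m(3) homD(2)[OF Ik] by simp
  ultimately show ?thesis using hom_objects(1)[OF sfunctorD(4)[OF s(1)] Ar_hom[OF m(1)]] by blast
qed

lemma pullback_object_unique:
  assumes pb: "is_pullback_square v u1 u2 w" and x: "x \<in> Ob (Src v)" and y: "y \<in> Ob (Src v)"
    and eq: "FO v x = FO v y" "FO u1 x = FO u1 y"
  shows "x = y"
proof -
  note s = pullback_squareD[OF pb]
  note V = sfunctorD[OF s(1)] and U = sfunctorD[OF s(2)]
  note Ix = Id_hom[OF V(4) x] and Iy = Id_hom[OF V(4) y]
  have g: "FA w (FA u1 (Id (Src v) x)) = FA u2 (FA v (Id (Src v) x))"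
    using arg_cong[OF s(5), of "\<lambda>F. FA F (Id (Src v) x)"] homD(1)[OF Ix] U(6) by simp
  have same: "FA v (Id (Src v) y) = FA v (Id (Src v) x)" "FA u1 (Id (Src v) y) = FA u1 (Id (Src v) x)"
    using functor_Id[OF V(1) x] functor_Id[OF V(1) y] functor_Id[OF U(1) x] functor_Id[OF U(1) y] eq
    by simp_all
  have "\<exists>!m. m \<in> Ar (Src v) \<and> FA v m = FA v (Id (Src v) x) \<and> FA u1 m = FA u1 (Id (Src v) x)"
    by (rule pullback_arrow[OF pb homD(1)[OF functor_hom[OF V(1) Ix]]
        homD(1)[OF functor_hom[OF U(1) Ix]] g[symmetric]])
  then have "Id (Src v) x = Id (Src v) y"
    by (rule Ex1_eq) (use homD(1)[OF Ix] homD(1)[OF Iy] same in simp_all)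
  then have "Dom (Src v) (Id (Src v) x) = Dom (Src v) (Id (Src v) y)" by (rule arg_cong)
  then show ?thesis unfolding homD(2)[OF Ix] homD(2)[OF Iy] .
qed

lemma pullback_hom:
  assumes pb: "is_pullback_square v u1 u2 w" and x: "x \<in> Ob (Src v)" and y: "y \<in> Ob (Src v)"
    and f: "f \<in> hom (Tgt v) (FO v x) (FO v y)" and g: "g \<in> hom (Tgt u1) (FO u1 x) (FO u1 y)"
    and fg: "FA u2 f = FA w g"
  shows "\<exists>!m. m \<in> hom (Src v) x y \<and> FA v m = f \<and> FA u1 m = g"
proof -
  note s = pullback_squareD[OF pb]
  note V = sfunctorD[OF s(1)] and U = sfunctorD[OF s(2)]
  have ex: "\<exists>!m. m \<in> Ar (Src v) \<and> FA v m = f \<and> FA u1 m = g"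
    by (rule pullback_arrow[OF pb homD(1)[OF f] homD(1)[OF g] fg])
  have "m \<in> hom (Src v) x y" if m: "m \<in> Ar (Src v)" "FA v m = f" "FA u1 m = g" for m
  proof (rule homI[OF m(1)])
    note mh = Ar_hom[OF m(1)]
    note vm = functor_hom[OF V(1) mh] and um = functor_hom[OF U(1) mh]
    note o = hom_objects[OF V(4) mh]
    show "Dom (Src v) m = x"
      by (rule pullback_object_unique[OF pb o(1) x])
        (use homD(2)[OF vm] homD(2)[OF um] homD(2)[OF f] homD(2)[OF g] m in simp_all)
    show "Cod (Src v) m = y"
      by (rule pullback_object_unique[OF pb o(2) y])
        (use homD(3)[OF vm] homD(3)[OF um] homD(3)[OF f] homD(3)[OF g] m in simp_all)
  qed
  then have "m \<in> hom (Src v) x y \<and> FA v m = f \<and> FA u1 m = g \<longleftrightarrow>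
      m \<in> Ar (Src v) \<and> FA v m = f \<and> FA u1 m = g" for m
    using homD(1)[of m "Src v" x y] by auto
  then show ?thesis using ex by simp
qed

lemma cartesian_factor:
  assumes \<phi>: "cartesian u \<phi>" and u: "functor_from_to u J K" and ph: "\<phi> \<in> hom J y z"
    and \<psi>: "\<psi> \<in> hom J x z" and g: "g \<in> hom K (FO u x) (FO u y)" and "Comp K (FA u \<phi>) g = FA u \<psi>"
  shows "\<exists>!\<chi>. \<chi> \<in> hom J x y \<and> Comp J \<phi> \<chi> = \<psi> \<and> FA u \<chi> = g"
proof -
  have all: "\<forall>\<psi>\<in>Ar J. \<forall>g\<in>hom K (FO u (Dom J \<psi>)) (FO u (Dom J \<phi>)).
      Cod J \<psi> = Cod J \<phi> \<and> Comp K (FA u \<phi>) g = FA u \<psi> \<longrightarrow>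
      (\<exists>!\<chi>. \<chi> \<in> hom J (Dom J \<psi>) (Dom J \<phi>) \<and> Comp J \<phi> \<chi> = \<psi> \<and> FA u \<chi> = g)"
    using \<phi> unfolding cartesian_def functor_categories(3,4)[OF u] by (rule conjunct2)
  show ?thesis
    using bspec[OF bspec[OF all homD(1)[OF \<psi>], unfolded homD[OF \<psi>] homD[OF ph]] g] assms(6) by simp
qed

lemma opcartesian_factor:
  assumes \<phi>: "opcartesian u \<phi>" and u: "functor_from_to u J K" and ph: "\<phi> \<in> hom J z y"
    and \<psi>: "\<psi> \<in> hom J z x" and g: "g \<in> hom K (FO u y) (FO u x)" and "Comp K g (FA u \<phi>) = FA u \<psi>"
  shows "\<exists>!\<chi>. \<chi> \<in> hom J y x \<and> Comp J \<chi> \<phi> = \<psi> \<and> FA u \<chi> = g"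
proof -
  have all: "\<forall>\<psi>\<in>Ar J. \<forall>g\<in>hom K (FO u (Cod J \<phi>)) (FO u (Cod J \<psi>)).
      Dom J \<psi> = Dom J \<phi> \<and> Comp K g (FA u \<phi>) = FA u \<psi> \<longrightarrow>
      (\<exists>!\<chi>. \<chi> \<in> hom J (Cod J \<phi>) (Cod J \<psi>) \<and> Comp J \<chi> \<phi> = \<psi> \<and> FA u \<chi> = g)"
    using \<phi> unfolding opcartesian_def functor_categories(3,4)[OF u] by (rule conjunct2)
  show ?thesis
    using bspec[OF bspec[OF all homD(1)[OF \<psi>], unfolded homD[OF \<psi>] homD[OF ph]] g] assms(6) by simp
qed

text \<open>The pullback of \<open>w\<close> and \<open>u2\<close>, mapped to the comma category \<open>(w/u2)\<close> with identities as structure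
  arrows.\<close>

locale pullback_in_comma =
  fixes v u1 u2 w :: "'s::small_universe sfctr"
  assumes pb: "is_pullback_square v u1 u2 w"
begin

abbreviation "P \<equiv> Src v"
abbreviation "J \<equiv> Tgt v"
abbreviation "K \<equiv> Tgt u1"
abbreviation "B \<equiv> Tgt u2"

lemmas sv = sfunctorD[OF pullback_squareD(1)[OF pb]] and su1 = sfunctorD[OF pullback_squareD(2)[OF pb]]
  and su2 = sfunctorD[OF pullback_squareD(3)[OF pb]] and sw = sfunctorD[OF pullback_squareD(4)[OF pb]]
lemmas commutes = pullback_squareD(5)[OF pb]

lemma pullback_lax_square: "lax_square u1 v w u2 (id_nt (w \<odot> u1)) P K J B"
proof -
  note s = pullback_squareD[OF pb]
  have "nat_from_to (id_nt (w \<odot> u1)) (w \<odot> u1) (u2 \<odot> v)"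
    using id_nt_nat[OF sfunctorD(1)[OF sfunctor_comp[OF s(2,4)]]] commutes by simp
  then show ?thesis using s(1-4) by (simp add: lax_square_def)
qed

sublocale comma_cone w u2 K J B u1 v "id_nt (w \<odot> u1)" P
  using pullback_squareD[OF pb] pullback_lax_square by unfold_locales

lemma commutes_FO: "x \<in> Ob P \<Longrightarrow> FO w (FO u1 x) = FO u2 (FO v x)"
  using arg_cong[OF commutes, of "\<lambda>F. FO F x"] su1 sv by simp

lemma commutes_FA: "m \<in> hom P x y \<Longrightarrow> FA w (FA u1 m) = FA u2 (FA v m)"
  using arg_cong[OF commutes, of "\<lambda>F. FA F m"] su1 sv by (simp add: homD(1))

lemma inclusion_FO: "x \<in> Ob P \<Longrightarrow> FO h x = pair (FO u1 x) (pair (FO v x) (Id B (FO w (FO u1 x))))"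
  using into_comma_FO su1 sw by simp

text \<open>For a fibration \<open>u2\<close> the pullback is coreflective in the comma category: an object
  \<open>a : w k \<rightarrow> u2 j\<close> is replaced by the cartesian lift of \<open>a\<close> to \<open>j\<close>.\<close>

lemma coreflective_if_fibration:
  assumes fib: "grothendieck_fibration u2"
  shows "coreflective_over h (comma_pr1 w u2)"
  unfolding coreflective_over_def sfunctorD(7)[OF into_comma_sfunctor] comma_pr_simps
proof
  note hs = into_comma_sfunctor
  note fu2 = su2(1) and fw = sw(1)
  fix c assume c: "c \<in> Ob C"
  then obtain k j a where cc: "c = pair k (pair j a)" and k: "k \<in> Ob K" and j: "j \<in> Ob J"
    and a: "a \<in> hom B (FO w k) (FO u2 j)" by (auto simp: comma_Ob)
  obtain \<phi> where \<phi>: "cartesian u2 \<phi>" "Cod J \<phi> = j" "FA u2 \<phi> = a"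
    using fib j a unfolding grothendieck_fibration_def su2(6) by (auto simp: hom_def)
  have ph: "\<phi> \<in> hom J (Dom J \<phi>) j"
    using \<phi>(1,2) unfolding cartesian_def su2(6) by (auto intro: homI)
  have "FO u2 (Dom J \<phi>) = FO w k"
    using homD(2)[OF functor_hom[OF fu2 ph]] homD(2)[OF a] \<phi>(3) by simp
  then obtain x where x: "x \<in> Ob P" "FO v x = Dom J \<phi>" "FO u1 x = k"
    using pullback_object[OF pb hom_objects(1)[OF su2(4) ph] k] by blast
  define \<kappa> where "\<kappa> = pair (pair (FO h x) c) (pair (Id K k) \<phi>)"
  note hx = functor_ob[OF sfunctorD(1)[OF hs] x(1)]
  have \<kappa>: "\<kappa> \<in> hom C (FO h x) c"
    unfolding \<kappa>_def comma_hom_pair using hx c ph x Id_hom[OF sw(4) k] functor_Id[OF fw k] \<phi>(3)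
    by (simp add: inclusion_FO cc)
  have comp: "Comp C \<kappa> (FA h m) = pair (pair (FO h y) c) (pair (FA u1 m) (Comp J \<phi> (FA v m)))"
    if m: "m \<in> hom P y x" for m y
    using comma_Comp[OF into_comma_hom[OF m] \<kappa>] into_comma_FA[OF m]
      Comp_Id_left[OF sw(4)] functor_hom[OF su1(1) m] x(3) by (simp add: \<kappa>_def)
  have "couniversal_arrow h c x \<kappa>"
    unfolding couniversal_arrow_def sfunctorD(6,7)[OF hs]
  proof (intro conjI ballI x(1) \<kappa>)
    fix y g assume y: "y \<in> Ob P" and g: "g \<in> hom C (FO h y) c"
    obtain g1 g2 where gg: "g = pair (pair (FO h y) c) (pair g1 g2)" and g1: "g1 \<in> hom K (FO u1 y) k"
      and g2: "g2 \<in> hom J (FO v y) j"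
      and sq: "Comp B a (FA w g1) = Comp B (FA u2 g2) (Id B (FO w (FO u1 y)))"
      using g y unfolding comma_hom by (auto simp: inclusion_FO cc)
    have wg1: "FA w g1 \<in> hom B (FO u2 (FO v y)) (FO u2 (Dom J \<phi>))"
      using functor_hom[OF fw g1] commutes_FO[OF y] commutes_FO[OF x(1)] x by simp
    have sq': "Comp B (FA u2 \<phi>) (FA w g1) = FA u2 g2"
      using sq Comp_Id_right[OF su2(5) functor_hom[OF fu2 g2]] commutes_FO[OF y] \<phi>(3) by simp
    have ex\<chi>: "\<exists>!\<chi>. \<chi> \<in> hom J (FO v y) (Dom J \<phi>) \<and> Comp J \<phi> \<chi> = g2 \<and> FA u2 \<chi> = FA w g1"
      by (rule cartesian_factor[OF \<phi>(1) fu2 ph g2 wg1 sq'])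
    then obtain \<chi> where \<chi>: "\<chi> \<in> hom J (FO v y) (Dom J \<phi>)" "Comp J \<phi> \<chi> = g2" "FA u2 \<chi> = FA w g1"
      by blast
    have exm: "\<exists>!m. m \<in> hom P y x \<and> FA v m = \<chi> \<and> FA u1 m = g1"
      using pullback_hom[OF pb y x(1)] \<chi> g1 x by simp
    then obtain m where m: "m \<in> hom P y x" "FA v m = \<chi>" "FA u1 m = g1" by blast
    show "\<exists>!m. m \<in> hom P y x \<and> Comp C \<kappa> (FA h m) = g"
    proof (rule ex1I[of _ m])
      show "m \<in> hom P y x \<and> Comp C \<kappa> (FA h m) = g" using comp[OF m(1)] m \<chi>(2) gg by simp
      fix m' assume m': "m' \<in> hom P y x \<and> Comp C \<kappa> (FA h m') = g"
      then have m'h: "m' \<in> hom P y x" by simp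
      have 1: "FA u1 m' = g1" "Comp J \<phi> (FA v m') = g2" using m' comp[OF m'h] gg by simp_all
      have 2: "FA v m' \<in> hom J (FO v y) (Dom J \<phi>)" using functor_hom[OF sv(1) m'h] x(2) by simp
      have 3: "FA u2 (FA v m') = FA w g1" using commutes_FA[OF m'h] 1(1) by simp
      have "FA v m' = \<chi>" by (rule Ex1_eq[OF ex\<chi>]) (use 1 2 3 \<chi> in simp_all)
      then show "m' = m" by (intro Ex1_eq[OF exm]) (use m m'h 1 in simp_all)
    qed
  qed
  then show "\<exists>x \<kappa>. couniversal_arrow h c x \<kappa> \<and>
      FA (comma_pr1 w u2) \<kappa> = Id K (FO (comma_pr1 w u2) c)"
    using homD(1)[OF \<kappa>] c by (intro exI[of _ x] exI[of _ \<kappa>]) (simp add: \<kappa>_def cc)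
qed

text \<open>For an opfibration \<open>w\<close> the pullback is reflective: now an opcartesian lift of \<open>a\<close> moves \<open>k\<close>, and \<open>j\<close>
  stays in place.\<close>

lemma reflective_if_opfibration:
  assumes fib: "grothendieck_opfibration w"
  shows "reflective_over h (comma_pr2 w u2)"
  unfolding reflective_over_def sfunctorD(7)[OF into_comma_sfunctor] comma_pr_simps
proof
  note hs = into_comma_sfunctor
  note fu2 = su2(1) and fw = sw(1)
  fix c assume c: "c \<in> Ob C"
  then obtain k j a where cc: "c = pair k (pair j a)" and k: "k \<in> Ob K" and j: "j \<in> Ob J"
    and a: "a \<in> hom B (FO w k) (FO u2 j)" by (auto simp: comma_Ob)
  obtain \<phi> where \<phi>: "opcartesian w \<phi>" "Dom K \<phi> = k" "FA w \<phi> = a"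
    using fib k a unfolding grothendieck_opfibration_def sw by (auto simp: hom_def)
  have ph: "\<phi> \<in> hom K k (Cod K \<phi>)"
    using \<phi>(1,2) unfolding opcartesian_def sw by (auto intro: homI)
  have "FO u2 j = FO w (Cod K \<phi>)"
    using homD(3)[OF functor_hom[OF fw ph]] homD(3)[OF a] \<phi>(3) by simp
  then obtain x where x: "x \<in> Ob P" "FO v x = j" "FO u1 x = Cod K \<phi>"
    using pullback_object[OF pb j hom_objects(2)[OF sw(4) ph]] by blast
  define \<kappa> where "\<kappa> = pair (pair c (FO h x)) (pair \<phi> (Id J j))"
  note hx = functor_ob[OF sfunctorD(1)[OF hs] x(1)]
  have \<kappa>: "\<kappa> \<in> hom C c (FO h x)"
    unfolding \<kappa>_def comma_hom_pair
    using hx c ph x Id_hom[OF su2(4) j] functor_Id[OF fu2 j] \<phi>(3) commutes_FO[OF x(1)]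
    by (simp add: inclusion_FO cc)
  have comp: "Comp C (FA h m) \<kappa> = pair (pair c (FO h y)) (pair (Comp K (FA u1 m) \<phi>) (FA v m))"
    if m: "m \<in> hom P x y" for m y
    using comma_Comp[OF \<kappa> into_comma_hom[OF m]] into_comma_FA[OF m]
      Comp_Id_right[OF su2(4)] functor_hom[OF sv(1) m] x(2) by (simp add: \<kappa>_def)
  have "universal_arrow h c x \<kappa>"
    unfolding universal_arrow_def sfunctorD(6,7)[OF hs]
  proof (intro conjI ballI x(1) \<kappa>)
    fix y g assume y: "y \<in> Ob P" and g: "g \<in> hom C c (FO h y)"
    obtain g1 g2 where gg: "g = pair (pair c (FO h y)) (pair g1 g2)" and g1: "g1 \<in> hom K k (FO u1 y)"
      and g2: "g2 \<in> hom J j (FO v y)"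
      and sq: "Comp B (Id B (FO w (FO u1 y))) (FA w g1) = Comp B (FA u2 g2) a"
      using g y unfolding comma_hom by (auto simp: inclusion_FO cc)
    have ug2: "FA u2 g2 \<in> hom B (FO w (Cod K \<phi>)) (FO w (FO u1 y))"
      using functor_hom[OF fu2 g2] commutes_FO[OF y] commutes_FO[OF x(1)] x by simp
    have sq': "Comp B (FA u2 g2) (FA w \<phi>) = FA w g1"
      using sq Comp_Id_left[OF sw(5) functor_hom[OF fw g1]] \<phi>(3) by simp
    have ex\<chi>: "\<exists>!\<chi>. \<chi> \<in> hom K (Cod K \<phi>) (FO u1 y) \<and> Comp K \<chi> \<phi> = g1 \<and> FA w \<chi> = FA u2 g2"
      by (rule opcartesian_factor[OF \<phi>(1) fw ph g1 ug2 sq'])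
    then obtain \<chi> where \<chi>: "\<chi> \<in> hom K (Cod K \<phi>) (FO u1 y)" "Comp K \<chi> \<phi> = g1" "FA w \<chi> = FA u2 g2"
      by blast
    have exm: "\<exists>!m. m \<in> hom P x y \<and> FA v m = g2 \<and> FA u1 m = \<chi>"
      using pullback_hom[OF pb x(1) y] \<chi> g2 x by simp
    then obtain m where m: "m \<in> hom P x y" "FA v m = g2" "FA u1 m = \<chi>" by blast
    show "\<exists>!m. m \<in> hom P x y \<and> Comp C (FA h m) \<kappa> = g"
    proof (rule ex1I[of _ m])
      show "m \<in> hom P x y \<and> Comp C (FA h m) \<kappa> = g" using comp[OF m(1)] m \<chi>(2) gg by simp
      fix m' assume m': "m' \<in> hom P x y \<and> Comp C (FA h m') \<kappa> = g"
      then have m'h: "m' \<in> hom P x y" by simp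
      have 1: "FA v m' = g2" "Comp K (FA u1 m') \<phi> = g1" using m' comp[OF m'h] gg by simp_all
      have 2: "FA u1 m' \<in> hom K (Cod K \<phi>) (FO u1 y)" using functor_hom[OF su1(1) m'h] x(3) by simp
      have 3: "FA w (FA u1 m') = FA u2 g2" using commutes_FA[OF m'h] 1(1) by simp
      have "FA u1 m' = \<chi>" by (rule Ex1_eq[OF ex\<chi>]) (use 1 2 3 \<chi> in simp_all)
      then show "m' = m" by (intro Ex1_eq[OF exm]) (use m m'h 1 in simp_all)
    qed
  qed
  then show "\<exists>x \<kappa>. universal_arrow h c x \<kappa> \<and>
      FA (comma_pr2 w u2) \<kappa> = Id J (FO (comma_pr2 w u2) c)"
    using homD(1)[OF \<kappa>] c by (intro exI[of _ x] exI[of _ \<kappa>]) (simp add: \<kappa>_def cc)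
qed

end

text \<open>The pullback square is the restriction of the comma square along the inclusion of the pullback,
  and the right or left adjoint of the inclusion makes the two squares exact at the same time.\<close>

lemma (in prederiv_kan) base_change_fibrations_if_comma:
  assumes comma: "base_change_comma D"
  shows "base_change_fibrations D"
  unfolding base_change_fibrations_def
proof (intro allI impI, elim conjE)
  fix v u1 u2 w :: "'s sfctr"
  assume pb: "is_pullback_square v u1 u2 w"
    and fib: "grothendieck_fibration u2 \<or> grothendieck_opfibration w"
  interpret pullback_in_comma v u1 u2 w by unfold_locales (rule pb)
  have "exact (comma_pr1 w u2) (comma_pr2 w u2) w u2 (comma_nt w u2)"
    using comma pullback_squareD(3,4)[OF pb] unfolding base_change_comma_iff by blast
  moreover have "coreflective_over h (comma_pr1 w u2) \<or> reflective_over h (comma_pr2 w u2)"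
    using fib coreflective_if_fibration reflective_if_opfibration by blast
  ultimately have "exact u1 v w u2 (id_nt (w \<odot> u1))"
    using exact_restrict_iff[OF comma_lax_square into_comma_sfunctor]
    unfolding pr1_into_comma pr2_into_comma comma_nt_into_comma by blast
  then show "exact_right D v u1 u2 w (id_nt (w \<odot> u1))"
    using exact_right_iff[OF pullback_lax_square] by simp
qed

section \<open>Comma squares as pullbacks of opfibrations\<close>

text \<open>The comma category \<open>(u/K)\<close> of \<open>u\<close> and the identity functor of \<open>K\<close>.\<close>

locale arrows_under =
  fixes u :: "'s::small_universe sfctr" and J K
  assumes u: "sfunctor u J K"
begin

lemmas su = sfunctorD[OF u]
lemmas idK = sfunctor_id[OF su(3)]

sublocale comma u "id_fctr K" J K K
  using u idK by unfold_locales

sublocale ids: comma_cone u "id_fctr K" J K K "id_fctr J" u "id_nt u" J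
  using identity_lax_square[OF u] by unfold_locales

lemma under_Ob: "pair j (pair k a) \<in> Ob C \<longleftrightarrow> j \<in> Ob J \<and> k \<in> Ob K \<and> a \<in> hom K (FO u j) k"
  using comma_Ob_pair by auto

lemma under_ObE:
  assumes "c \<in> Ob C"
  obtains j k a where "c = pair j (pair k a)" "j \<in> Ob J" "k \<in> Ob K" "a \<in> hom K (FO u j) k"
  using assms comma_Ob by auto

lemma under_hom:
  "pair (pair x y) (pair g1 g2) \<in> hom C x y \<longleftrightarrow> x \<in> Ob C \<and> y \<in> Ob C \<and> g1 \<in> hom J (pfst x) (pfst y) \<and>
     g2 \<in> hom K (pfst (psnd x)) (pfst (psnd y)) \<and>
     Comp K (psnd (psnd y)) (FA u g1) = Comp K g2 (psnd (psnd x))"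
  unfolding comma_hom_pair by (auto simp: homD(1))

text \<open>The functor \<open>j \<mapsto> (j, u j, id)\<close> is left adjoint to the source projection; the counit at
  \<open>(j, k, a)\<close> is the pair \<open>(id, a)\<close>.\<close>

lemma identities_coreflective: "coreflective_over ids.h (comma_pr1 u (id_fctr K))"
  unfolding coreflective_over_def sfunctorD(7)[OF ids.into_comma_sfunctor] comma_pr_simps
proof
  note hs = ids.into_comma_sfunctor
  fix c assume c: "c \<in> Ob C"
  then obtain j k a where cc: "c = pair j (pair k a)" and j: "j \<in> Ob J" and k: "k \<in> Ob K"
    and a: "a \<in> hom K (FO u j) k" by (rule under_ObE)
  have val: "FO ids.h y = pair y (pair (FO u y) (Id K (FO u y)))" if "y \<in> Ob J" for y
    using ids.into_comma_FO[OF that] that su by simp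
  define \<kappa> where "\<kappa> = pair (pair (FO ids.h j) c) (pair (Id J j) a)"
  note hj = functor_ob[OF sfunctorD(1)[OF hs] j]
  have \<kappa>: "\<kappa> \<in> hom C (FO ids.h j) c"
    unfolding \<kappa>_def under_hom using hj c a Id_hom[OF su(4) j] functor_Id[OF su(1) j]
    by (simp add: val[OF j] cc)
  have comp: "Comp C \<kappa> (FA ids.h m) = pair (pair (FO ids.h y) c) (pair m (Comp K a (FA u m)))"
    if m: "m \<in> hom J y j" for m y
    using comma_Comp[OF ids.into_comma_hom[OF m] \<kappa>] ids.into_comma_FA[OF m]
      Comp_Id_left[OF su(4) m] homD(1)[OF m] by (simp add: \<kappa>_def)
  have "couniversal_arrow ids.h c j \<kappa>"
    unfolding couniversal_arrow_def sfunctorD(6,7)[OF hs]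
  proof (intro conjI ballI j \<kappa>)
    fix y g assume y: "y \<in> Ob J" and g: "g \<in> hom C (FO ids.h y) c"
    obtain g1 g2 where gg: "g = pair (pair (FO ids.h y) c) (pair g1 g2)"
      using comma_homD(3)[OF g] by blast
    have g1: "g1 \<in> hom J y j" and g2: "g2 \<in> hom K (FO u y) k"
      and sq: "Comp K a (FA u g1) = Comp K g2 (Id K (FO u y))"
      using g y unfolding gg under_hom by (simp_all add: val cc)
    show "\<exists>!m. m \<in> hom J y j \<and> Comp C \<kappa> (FA ids.h m) = g"
      by (rule ex1I[of _ g1]) (use g1 comp sq Comp_Id_right[OF su(5) g2] gg in auto)
  qed
  then show "\<exists>x \<kappa>. couniversal_arrow ids.h c x \<kappa> \<and>
      FA (comma_pr1 u (id_fctr K)) \<kappa> = Id J (FO (comma_pr1 u (id_fctr K)) c)"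
    using homD(1)[OF \<kappa>] c by (intro exI[of _ j] exI[of _ \<kappa>]) (simp add: \<kappa>_def cc)
qed

text \<open>Composing the structure arrow with \<open>f\<close> gives the opcartesian lift of \<open>f\<close>.\<close>

lemma target_opfibration: "grothendieck_opfibration (comma_pr2 u (id_fctr K))" (is "grothendieck_opfibration ?t")
  unfolding grothendieck_opfibration_def comma_pr_simps
proof (intro conjI ballI impI)
  show "is_functor ?t" using functor_categories(5)[OF sfunctorD(1)[OF comma_pr_sfunctor(2)]] .
  fix c f assume c: "c \<in> Ob C" and f: "f \<in> Ar K" and df: "Dom K f = FO ?t c"
  obtain j k a where cc: "c = pair j (pair k a)" and j: "j \<in> Ob J" and k: "k \<in> Ob K"
    and a: "a \<in> hom K (FO u j) k" using c by (rule under_ObE)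
  define k' where "k' = Cod K f"
  have fh: "f \<in> hom K k k'" using f df c by (intro homI) (simp_all add: k'_def cc)
  define c' where "c' = pair j (pair k' (Comp K f a))"
  have c': "c' \<in> Ob C"
    using j hom_objects(2)[OF su(5) fh] Comp_hom[OF su(5) a fh] by (simp add: c'_def under_Ob)
  define \<phi> where "\<phi> = pair (pair c c') (pair (Id J j) f)"
  have \<phi>: "\<phi> \<in> hom C c c'"
    unfolding \<phi>_def under_hom
    using c c' Id_hom[OF su(4) j] fh functor_Id[OF su(1) j] Comp_Id_right[OF su(5) Comp_hom[OF su(5) a fh]]
    by (simp add: cc c'_def)
  have t\<phi>: "FA ?t \<phi> = f" using homD(1)[OF \<phi>] by (simp add: \<phi>_def)
  have "opcartesian ?t \<phi>"
    unfolding opcartesian_def comma_pr_simps homD[OF \<phi>]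
  proof (intro conjI ballI impI; (elim conjE)?)
    show "\<phi> \<in> Ar C" by (rule homD(1)[OF \<phi>])
    fix \<psi> g
    assume \<psi>: "\<psi> \<in> Ar C" "Dom C \<psi> = c" and g: "g \<in> hom K (FO ?t c') (FO ?t (Cod C \<psi>))"
      and gf: "Comp K g (FA ?t \<phi>) = FA ?t \<psi>"
    define d where "d = Cod C \<psi>"
    have ps: "\<psi> \<in> hom C c d" using \<psi> by (auto intro: homI simp: d_def)
    obtain j' k'' b where dd: "d = pair j' (pair k'' b)" and b: "b \<in> hom K (FO u j') k''"
      using comma_homD(2)[OF ps] by (rule under_ObE)
    obtain p1 p2 where pp: "\<psi> = pair (pair c d) (pair p1 p2)" using comma_homD(3)[OF ps] by blast
    have p1: "p1 \<in> hom J j j'" and sq: "Comp K b (FA u p1) = Comp K p2 a"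
      using ps unfolding pp under_hom by (simp_all add: cc dd)
    have gh: "g \<in> hom K k' k''"
      using g c' comma_homD(2)[OF ps] by (simp add: d_def[symmetric]) (simp add: c'_def dd)
    have gf': "Comp K g f = p2" using gf t\<phi> \<psi>(1) pp by simp
    define \<chi> where "\<chi> = pair (pair c' d) (pair p1 g)"
    have \<chi>: "\<chi> \<in> hom C c' d"
      unfolding \<chi>_def under_hom
      using c' comma_homD(2)[OF ps] p1 gh sq gf' Comp_assoc[OF su(5) a fh gh] by (simp add: c'_def dd)
    show "\<exists>!\<chi>. \<chi> \<in> hom C c' (Cod C \<psi>) \<and> Comp C \<chi> \<phi> = \<psi> \<and> FA ?t \<chi> = g"
      unfolding d_def[symmetric]
    proof (rule ex1I[of _ \<chi>])
      show "\<chi> \<in> hom C c' d \<and> Comp C \<chi> \<phi> = \<psi> \<and> FA ?t \<chi> = g"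
        using \<chi> comma_Comp[OF \<phi> \<chi>] homD(1)[OF \<chi>] Comp_Id_right[OF su(4) p1] gf'
        by (simp add: \<chi>_def \<phi>_def pp)
      fix \<xi> assume x: "\<xi> \<in> hom C c' d \<and> Comp C \<xi> \<phi> = \<psi> \<and> FA ?t \<xi> = g"
      then have \<xi>: "\<xi> \<in> hom C c' d" by simp
      obtain x1 x2 where xx: "\<xi> = pair (pair c' d) (pair x1 x2)" using comma_homD(3)[OF \<xi>] by blast
      have "x1 \<in> hom J j j'" using \<xi> unfolding xx under_hom by (simp add: c'_def dd)
      moreover have "x2 = g" using x homD(1)[OF \<xi>] by (simp add: xx)
      moreover have "Comp J x1 (Id J j) = p1" using x comma_Comp[OF \<phi> \<xi>] by (simp add: xx \<phi>_def pp)
      ultimately show "\<xi> = \<chi>" using Comp_Id_right[OF su(4)] by (simp add: xx \<chi>_def)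
    qed
  qed
  then show "\<exists>\<phi>. opcartesian ?t \<phi> \<and> Dom C \<phi> = c \<and> FA ?t \<phi> = f" using homD(2)[OF \<phi>] t\<phi> by blast
qed

end

locale comma_as_pullback = comma u1 u2 J1 J2 K
  for u1 u2 :: "'s::small_universe sfctr" and J1 J2 K :: "'s scat"
begin

sublocale un: arrows_under u1 J1 K
  using u1 by unfold_locales

abbreviation "s \<equiv> comma_pr1 u1 (id_fctr K)"
abbreviation "t \<equiv> comma_pr2 u1 (id_fctr K)"

lemma comma_over_lax_square:
  "lax_square (comma_pr1 u1 u2) (u2 \<odot> comma_pr2 u1 u2) u1 (id_fctr K) (comma_nt u1 u2) C J1 K K"
  using lax_squareD[OF comma_lax_square] un.idK sfunctor_comp[OF comma_pr_sfunctor(2) u2]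
    comp_id_fctr(2)[OF sfunctorD(1)[OF sfunctor_comp[OF comma_pr_sfunctor(2) u2]]]
  by (simp add: lax_square_def)

sublocale over: comma_cone u1 "id_fctr K" J1 K K "comma_pr1 u1 u2" "u2 \<odot> comma_pr2 u1 u2"
  "comma_nt u1 u2" C
  using comma_over_lax_square by unfold_locales

text \<open>An object of \<open>(u1/K)\<close> with target \<open>u2 j\<close> is the same as an object of \<open>(u1/u2)\<close> over \<open>j\<close>.\<close>

lemma comma_pullback: "is_pullback_square (comma_pr2 u1 u2) over.h u2 t"
  unfolding is_pullback_square_def comma_pr_simps un.comma_pr_simps sfunctorD(7)[OF over.into_comma_sfunctor]
    s2(7)
proof (intro conjI allI impI; (elim conjE)?)
  show "sfunctor (comma_pr2 u1 u2) C J2" by (rule comma_pr_sfunctor)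
  show "sfunctor over.h C un.C" by (rule over.into_comma_sfunctor)
  show "sfunctor u2 J2 K" by (rule u2)
  show "sfunctor t un.C K" by (rule un.comma_pr_sfunctor)
  show "t \<odot> over.h = u2 \<odot> comma_pr2 u1 u2" by (rule over.pr2_into_comma)
  fix L a b
  assume a: "sfunctor a L J2" and b: "sfunctor b L un.C" and ab: "t \<odot> b = u2 \<odot> a"
  let ?g = "comma_nt u1 (id_fctr K) \<star> id_nt b"
  note sqb = lax_squareD[OF lax_square_restrict[OF un.comma_lax_square b]]
  have "lax_square (s \<odot> b) a u1 u2 ?g L J1 J2 K"
    using sqb a u1 u2 comp_id_fctr(2)[OF sfunctorD(1)[OF sfunctor_comp[OF a u2]]] ab
    by (simp add: lax_square_def)
  then interpret m: comma_cone u1 u2 J1 J2 K "s \<odot> b" a ?g L by unfold_locales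
  have third: "psnd (psnd (FO over.h x)) = psnd (psnd x)" if "x \<in> Ob C" for x
    using over.into_comma_FO[OF that] comma_nt_Cmp[OF that] by simp
  have gb: "Cmp ?g x = psnd (psnd (FO b x))" if x: "x \<in> Ob L" for x
    using whisker_right_Cmp[OF sfunctorD(1)[OF b] lax_squareD(5)[OF un.comma_lax_square]
        sfunctorD(1)[OF sfunctor_comp[OF un.comma_pr_sfunctor(1) u1]] x]
      un.comma_nt_Cmp[OF functor_ob[OF sfunctorD(1)[OF b] x]] by simp
  note hs = m.into_comma_sfunctor and cs = over.into_comma_sfunctor
  have assoc: "p \<odot> over.h \<odot> f = (p \<odot> over.h) \<odot> f" if "sfunctor p un.C E" "sfunctor f L C" for p f E
    using comp_fctr_assoc[OF sfunctorD(1)[OF that(2)] sfunctorD(1)[OF cs] sfunctorD(1)[OF that(1)]] by simp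
  have assoc2: "(u2 \<odot> comma_pr2 u1 u2) \<odot> f = u2 \<odot> comma_pr2 u1 u2 \<odot> f" if "sfunctor f L C" for f
    using comp_fctr_assoc[OF sfunctorD(1)[OF that] sfunctorD(1)[OF comma_pr_sfunctor(2)] f2] .
  have eq: "over.h \<odot> m.h = b"
  proof (rule un.comma_functor_eqI[OF sfunctor_comp[OF hs cs] b])
    show "s \<odot> over.h \<odot> m.h = s \<odot> b"
      using assoc[OF un.comma_pr_sfunctor(1) hs] by (simp add: over.pr1_into_comma m.pr1_into_comma)
    show "t \<odot> over.h \<odot> m.h = t \<odot> b"
      using assoc[OF un.comma_pr_sfunctor(2) hs] assoc2[OF hs]
      by (simp add: over.pr2_into_comma m.pr2_into_comma ab)
    show "psnd (psnd (FO (over.h \<odot> m.h) x)) = psnd (psnd (FO b x))" if x: "x \<in> Ob L" for x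
      using third[OF functor_ob[OF sfunctorD(1)[OF hs] x]] gb[OF x] m.into_comma_FO[OF x] x
        sfunctorD(6)[OF hs] by simp
  qed
  show "\<exists>!h. sfunctor h L C \<and> comma_pr2 u1 u2 \<odot> h = a \<and> over.h \<odot> h = b"
  proof (rule ex1I[of _ m.h])
    show "sfunctor m.h L C \<and> comma_pr2 u1 u2 \<odot> m.h = a \<and> over.h \<odot> m.h = b"
      using hs m.pr2_into_comma eq by simp
    fix h assume h: "sfunctor h L C \<and> comma_pr2 u1 u2 \<odot> h = a \<and> over.h \<odot> h = b"
    then have hf: "sfunctor h L C" and hb: "over.h \<odot> h = b" by auto
    show "h = m.h"
    proof (rule comma_functor_eqI[OF hf hs])
      show "comma_pr1 u1 u2 \<odot> h = comma_pr1 u1 u2 \<odot> m.h"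
        using assoc[OF un.comma_pr_sfunctor(1) hf]
        unfolding hb over.pr1_into_comma m.pr1_into_comma by (rule sym)
      show "comma_pr2 u1 u2 \<odot> h = comma_pr2 u1 u2 \<odot> m.h" using h m.pr2_into_comma by simp
      fix x assume x: "x \<in> Ob L"
      have "psnd (psnd (FO h x)) = psnd (psnd (FO b x))"
        using third[OF functor_ob[OF sfunctorD(1)[OF hf] x]] arg_cong[OF hb, of "\<lambda>F. FO F x"] x
          sfunctorD(6)[OF hf] by simp
      then show "psnd (psnd (FO h x)) = psnd (psnd (FO m.h x))"
        using m.into_comma_FO[OF x] gb[OF x] by simp
    qed
  qed
qed

lemma comma_pullback_lax_square:
  "lax_square over.h (comma_pr2 u1 u2) t u2 (id_nt (t \<odot> over.h)) C un.C J2 K"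
proof -
  interpret pb: pullback_in_comma "comma_pr2 u1 u2" over.h u2 t
    by unfold_locales (rule comma_pullback)
  show ?thesis using pb.pullback_lax_square sfunctorD(7)[OF over.into_comma_sfunctor] s2(7) by simp
qed

lemma comma_paste:
  "paste (id_fctr K) (comma_nt u1 (id_fctr K)) over.h (id_nt (t \<odot> over.h)) = comma_nt u1 u2"
  (is "?p = _")
proof (rule nt_eqI)
  note sq = un.comma_lax_square and sq' = comma_pullback_lax_square
  show "nat_from_to (comma_nt u1 u2) (u1 \<odot> comma_pr1 u1 u2) (u2 \<odot> comma_pr2 u1 u2)"
    by (rule lax_squareD(5)[OF comma_lax_square])
  show "nat_from_to ?p (u1 \<odot> comma_pr1 u1 u2) (u2 \<odot> comma_pr2 u1 u2)"
    using lax_squareD(5)[OF paste_nat(3)[OF sq sq']] over.pr1_into_comma comp_id_fctr(2)[OF f2] by simp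
  show "functor_from_to (u1 \<odot> comma_pr1 u1 u2) C K"
    by (rule sfunctorD(1)[OF sfunctor_comp[OF comma_pr_sfunctor(1) u1]])
  fix x assume x: "x \<in> Ob C"
  note cs = over.into_comma_sfunctor
  note a = comma_objD[OF x]
  have ci: "Cmp (id_nt (t \<odot> over.h)) x = Id K (FO u2 (pfst (psnd x)))"
    using x sfunctorD[OF cs] functor_ob[OF sfunctorD(1)[OF cs] x] over.into_comma_FO[OF x] s1 by simp
  have I: "Id K (FO u2 (pfst (psnd x))) \<in> Ar K"
    using homD(1)[OF Id_hom[OF s1(5) functor_ob[OF f2 a(2)]]] .
  show "Cmp ?p x = Cmp (comma_nt u1 u2) x"
    using paste_Cmp[OF sq sq' x] ci I un.comma_nt_Cmp[OF functor_ob[OF sfunctorD(1)[OF cs] x]]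
      over.into_comma_FO[OF x] comma_nt_Cmp[OF x] Comp_Id_left[OF s1(5) a(3)] by simp
qed

end

context prederiv_kan
begin

text \<open>Paste two exact squares: the one over \<open>(u1/K)\<close>, which restricts along \<open>j \<mapsto> (j, u1 j, id)\<close> to an
  identity square, and the pullback of the opfibration \<open>(u1/K) \<rightarrow> K\<close> along \<open>u2\<close>.\<close>

lemma comma_if_base_change_fibrations:
  assumes fib: "base_change_fibrations D"
  shows "base_change_comma D"
  unfolding base_change_comma_iff
proof (intro allI impI, elim conjE)
  fix J1 J2 K and u1 u2 :: "'s sfctr" assume u1: "sfunctor u1 J1 K" and u2: "sfunctor u2 J2 K"
  interpret comma_as_pullback u1 u2 J1 J2 K using u1 u2 by unfold_locales
  have "exact s t u1 (id_fctr K) (comma_nt u1 (id_fctr K))"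
    using exact_restrict_iff[OF un.comma_lax_square un.ids.into_comma_sfunctor]
      un.identities_coreflective exact_id[OF u1]
    unfolding un.ids.pr1_into_comma un.ids.pr2_into_comma un.ids.comma_nt_into_comma by blast
  moreover have "exact over.h (comma_pr2 u1 u2) t u2 (id_nt (t \<odot> over.h))"
    using fib comma_pullback un.target_opfibration exact_right_iff[OF comma_pullback_lax_square]
    unfolding base_change_fibrations_def by blast
  ultimately show "exact (comma_pr1 u1 u2) (comma_pr2 u1 u2) u1 u2 (comma_nt u1 u2)"
    using exact_paste[OF un.comma_lax_square comma_pullback_lax_square]
    unfolding comma_paste over.pr1_into_comma comp_id_fctr(2)[OF sfunctorD(1)[OF u2]] by blast
qed

end

theorem proposition1p32:
  fixes D :: "('s::small_universe, 'b, 'c) prederiv"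
  assumes "prederivator D" and "Der1 D" and "Der2 D" and "Der3 D"
  shows "(derivator D \<longleftrightarrow> base_change_fibrations D) \<and>
         (base_change_fibrations D \<longleftrightarrow> base_change_comma D)"
proof -
  interpret prederiv_kan D using assms by unfold_locales
  have "base_change_comma D" if "derivator D"
    using that comma_exact_if_pointwise[OF _ _ assms(3)]
    unfolding derivator_def base_change_comma_iff by blast
  moreover have "derivator D" if "base_change_comma D"
    using that Der4_if_comma assms by (simp add: derivator_def)
  ultimately show ?thesis
    using base_change_fibrations_if_comma comma_if_base_change_fibrations by blast
qed

end
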